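(* Let $\mathcal P\subset\mathcal M_1(\Omega,\mathcal A)$ be a nonempty family of probability measures, $k:\mathcal P\to\mathbb R$ a functional differentiable at $P_0\in\mathcal P$ with canonical gradient $\widetilde k$ satisfying $\int\widetilde k^2\,dP_0\neq0$, and $\alpha\in(0,1)$. Suppose that the tangent cone $K(P_0,\mathcal P)$ is dense in $T(P_0,\mathcal P)$ with respect to the $L_2(P_0)$-norm, and that $K(P_0,\mathcal P)\cap N(\widetilde k,P_0,\mathcal P)$ is dense in $N(\widetilde k,P_0,\mathcal P)$ with respect to the $L_2(P_0)$-norm. Then the test sequence $(\varphi_n)_n$ on $\Omega^n$ given by $$\varphi_n=1\ \text{ if }\ \Bigl|\frac1{\sqrt n}\sum_{i=1}^n\widetilde k(\omega_i)\Bigr|>u_{1-\frac\alpha2}\|\widetilde k\|_{L_2(P_0)},\qquad\varphi_n=0\ \text{ otherwise,}$$ is asymptotically optimal in the set of all test sequences for $\mathcal H_4$ against $\mathcal K_4$ that are asymptotically unbiased at level $\alpha$.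
   Context: $\Phi$ is the standard normal distribution function, $u_{p}=\Phi^{-1}(p)$; tests are measurable $[0,1]$-valued functions. $L_2^{(0)}(P)=\{h\in L_2(P):\int h\,dP=0\}$. With $dP/dQ$ the density quotient (a $[0,\infty]$-valued measurable $L$ with $P(A)=\int_AL\,dQ+P(A\cap\{L=\infty\})$, $Q(L<\infty)=1$), a curve $t\mapsto P_t$, $|t|<\varepsilon$, in $\mathcal P$ is $L_2(P_0)$-differentiable with tangent $g\in L_2(P_0)$ if $\|2((dP_t/dP_0)^{1/2}-1)-tg\|_{L_2(P_0)}=o(|t|)$ and $P_t(dP_t/dP_0=\infty)=o(t^2)$ as $t\to0$. The tangent cone $K(P_0,\mathcal P)\subset L_2^{(0)}(P_0)$ is the set of tangents of all such curves in $\mathcal P$ through $P_0$ at $t=0$; the tangent space $T(P_0,\mathcal P)$ is the $L_2(P_0)$-closure of its linear span. $k$ is differentiable at $P_0$ with gradient $\dot k\in L_2^{(0)}(P_0)$ if $\lim_{t\downarrow0}t^{-1}(k(P_t)-k(P_0))=\int\dot kg\,dP_0$ for each such curve with tangent $g$; the canonical gradient $\widetilde k$ is the unique gradient in $T(P_0,\mathcal P)$. $N(\widetilde k,P_0,\mathcal P)=\{h\in T(P_0,\mathcal P):\int\widetilde kh\,dP_0=0\}$. $\mathcal F_1$ is the set of sequences $(P_{t_n})_n$ (identified with the sequences of product measures $(P_{t_n}^n)_n$) such that $t_n\to0$, $\lim_nt_n\sqrt n>0$, and there are $\varepsilon>0$ and an $L_2(P_0)$-differentiable curve $f:(-\varepsilon,\varepsilon)\to\mathcal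 P$, $t\mapsto P_t$ (through $P_0$ at $t=0$) with $f(t_n)=P_{t_n}$ for all $n$. Implicit alternatives: $\mathcal K_4=\{(P_{t_n}^n)_n\in\mathcal F_1:\lim_n\sqrt n(k(P_{t_n})-k(P_0))\ne0\}$; implicit hypotheses: $\mathcal H_4=\{(P_{t_n}^n)_n\in\mathcal F_1:\lim_n\sqrt n(k(P_{t_n})-k(P_0))=0\}$. A sequence of tests $\psi_n$ on $\Omega^n$ is asymptotically unbiased at level $\alpha$ for $\mathcal H_4$ against $\mathcal K_4$ if $\limsup_n\int\psi_n\,dP_{t_n}^n\le\alpha$ for all $(P_{t_n}^n)_n\in\mathcal H_4$ and $\liminf_n\int\psi_n\,dP_{t_n}^n\ge\alpha$ for all $(P_{t_n}^n)_n\in\mathcal K_4$. "$(\varphi_n)$ is asymptotically optimal" in this class means: $(\varphi_n)$ belongs to the class, and for every $(\psi_n)$ in the class, $\limsup_n\int\psi_n\,dP_{t_n}^n\le\lim_n\int\varphi_n\,dP_{t_n}^n$ for all $(P_{t_n}^n)_n\in\mathcal F_1$ (the limit for $\varphi_n$ existing). *)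

theory Defs
  imports "HOL-Probability.Probability" "HOL-Library.Landau_Symbols"
begin

section \<open>Square integrable functions\<close>

text \<open>
  Elements of \<open>L\<^sub>2(P)\<close> are represented by functions rather than by classes modulo equality
  almost everywhere.  The tangent cone, the tangent space and \<open>gradient_complement\<close> below are
  closed under measurable modifications of their members on null sets.
\<close>

definition L2 :: "'a measure \<Rightarrow> ('a \<Rightarrow> real) set" where
  "L2 P = {h \<in> borel_measurable P. integrable P (\<lambda>x. (h x)\<^sup>2)}"

definition L2_centered :: "'a measure \<Rightarrow> ('a \<Rightarrow> real) set" where
  "L2_centered P = {h \<in> L2 P. (\<integral>x. h x \<partial>P) = 0}"

definition L2_norm :: "'a measure \<Rightarrow> ('a \<Rightarrow> real) \<Rightarrow> real" where
  "L2_norm P h = sqrt (\<integral>x. (h x)\<^sup>2 \<partial>P)"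

definition L2_closure :: "'a measure \<Rightarrow> ('a \<Rightarrow> real) set \<Rightarrow> ('a \<Rightarrow> real) set" where
  "L2_closure P S = {h \<in> L2 P. \<forall>\<delta>>0. \<exists>g\<in>S. L2_norm P (\<lambda>x. h x - g x) < \<delta>}"

definition L2_dense :: "'a measure \<Rightarrow> ('a \<Rightarrow> real) set \<Rightarrow> ('a \<Rightarrow> real) set \<Rightarrow> bool" where
  "L2_dense P D S \<longleftrightarrow> D \<subseteq> S \<and> S \<subseteq> L2_closure P D"

definition linear_span :: "('a \<Rightarrow> real) set \<Rightarrow> ('a \<Rightarrow> real) set" where
  "linear_span S = {h. \<exists>(m::nat) c g. (\<forall>i<m. g i \<in> S) \<and> h = (\<lambda>x. \<Sum>i<m. c i * g i x)}"


section \<open>Differentiable curves and tangents\<close>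

definition density_quotient :: "'a measure \<Rightarrow> 'a measure \<Rightarrow> ('a \<Rightarrow> ennreal) \<Rightarrow> bool" where
  "density_quotient P Q L \<longleftrightarrow>
     L \<in> borel_measurable Q \<and>
     (\<forall>A\<in>sets Q. emeasure P A = (\<integral>\<^sup>+x\<in>A. L x \<partial>Q) + emeasure P (A \<inter> {x. L x = \<infinity>})) \<and>
     measure Q {x \<in> space Q. L x < \<infinity>} = 1"

text \<open>
  The curve \<open>t \<mapsto> f t\<close>, \<open>\<bar>t\<bar> < \<epsilon>\<close>, lies in \<open>\<P>\<close>, passes through \<open>P\<^sub>0\<close> at \<open>t = 0\<close> and is
  \<open>L\<^sub>2(P\<^sub>0)\<close>-differentiable with tangent \<open>g\<close>.  A density quotient always exists and is unique
  almost everywhere with respect to both measures, so the choice of the versions \<open>L t\<close> is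
  immaterial.  The values of \<open>f\<close> outside \<open>{-\<epsilon><..<\<epsilon>}\<close> are irrelevant.
\<close>

definition differentiable_curve ::
  "'a measure set \<Rightarrow> 'a measure \<Rightarrow> real \<Rightarrow> (real \<Rightarrow> 'a measure) \<Rightarrow> ('a \<Rightarrow> real) \<Rightarrow> bool" where
  "differentiable_curve \<P> P\<^sub>0 \<epsilon> f g \<longleftrightarrow>
     0 < \<epsilon> \<and> f 0 = P\<^sub>0 \<and> (\<forall>t. \<bar>t\<bar> < \<epsilon> \<longrightarrow> f t \<in> \<P>) \<and> g \<in> L2 P\<^sub>0 \<and>
     (\<exists>L :: real \<Rightarrow> 'a \<Rightarrow> ennreal.
        (\<forall>t. \<bar>t\<bar> < \<epsilon> \<longrightarrow> density_quotient (f t) P\<^sub>0 (L t)) \<and>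
        (\<lambda>t. L2_norm P\<^sub>0 (\<lambda>x. 2 * (sqrt (enn2real (L t x)) - 1) - t * g x)) \<in> o[at 0](\<lambda>t. \<bar>t\<bar>) \<and>
        (\<lambda>t. measure (f t) {x \<in> space (f t). L t x = \<infinity>}) \<in> o[at 0](\<lambda>t. t\<^sup>2))"

definition tangent_cone :: "'a measure \<Rightarrow> 'a measure set \<Rightarrow> ('a \<Rightarrow> real) set" where
  "tangent_cone P\<^sub>0 \<P> = {g. \<exists>\<epsilon> f. differentiable_curve \<P> P\<^sub>0 \<epsilon> f g}"

definition tangent_space :: "'a measure \<Rightarrow> 'a measure set \<Rightarrow> ('a \<Rightarrow> real) set" where
  "tangent_space P\<^sub>0 \<P> = L2_closure P\<^sub>0 (linear_span (tangent_cone P\<^sub>0 \<P>))"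


section \<open>Differentiable functionals\<close>

definition has_gradient ::
  "('a measure \<Rightarrow> real) \<Rightarrow> 'a measure \<Rightarrow> 'a measure set \<Rightarrow> ('a \<Rightarrow> real) \<Rightarrow> bool" where
  "has_gradient k P\<^sub>0 \<P> k' \<longleftrightarrow>
     k' \<in> L2_centered P\<^sub>0 \<and>
     (\<forall>\<epsilon> f g. differentiable_curve \<P> P\<^sub>0 \<epsilon> f g \<longrightarrow>
        ((\<lambda>t. (k (f t) - k P\<^sub>0) / t) \<longlongrightarrow> (\<integral>x. k' x * g x \<partial>P\<^sub>0)) (at_right 0))"

definition canonical_gradient ::
  "('a measure \<Rightarrow> real) \<Rightarrow> 'a measure \<Rightarrow> 'a measure set \<Rightarrow> ('a \<Rightarrow> real) \<Rightarrow> bool" where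
  "canonical_gradient k P\<^sub>0 \<P> k' \<longleftrightarrow> has_gradient k P\<^sub>0 \<P> k' \<and> k' \<in> tangent_space P\<^sub>0 \<P>"

definition gradient_complement ::
  "('a \<Rightarrow> real) \<Rightarrow> 'a measure \<Rightarrow> 'a measure set \<Rightarrow> ('a \<Rightarrow> real) set" where
  "gradient_complement k' P\<^sub>0 \<P> = {h \<in> tangent_space P\<^sub>0 \<P>. (\<integral>x. k' x * h x \<partial>P\<^sub>0) = 0}"


section \<open>Local sequences, implicit hypotheses and alternatives\<close>

text \<open>
  A sequence \<open>(P\<^sub>t\<^sub>n)\<^sub>n\<close> is represented by the sequence of its marginals; the product measures
  are formed in \<open>test_power\<close>.  The limit of \<open>t\<^sub>n \<surd>n\<close> is a (finite) positive real number.
\<close>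

definition local_sequences :: "'a measure \<Rightarrow> 'a measure set \<Rightarrow> (nat \<Rightarrow> 'a measure) set" where
  "local_sequences P\<^sub>0 \<P> =
     {Q. \<exists>(t :: nat \<Rightarrow> real) \<epsilon> f g.
           t \<longlonglongrightarrow> 0 \<and>
           (\<exists>c>0. (\<lambda>n. t n * sqrt (real n)) \<longlonglongrightarrow> c) \<and>
           differentiable_curve \<P> P\<^sub>0 \<epsilon> f g \<and>
           (\<forall>n. \<bar>t n\<bar> < \<epsilon> \<and> Q n = f (t n))}"

definition implicit_alternatives ::
  "('a measure \<Rightarrow> real) \<Rightarrow> 'a measure \<Rightarrow> 'a measure set \<Rightarrow> (nat \<Rightarrow> 'a measure) set" where
  "implicit_alternatives k P\<^sub>0 \<P> =
     {Q \<in> local_sequences P\<^sub>0 \<P>.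
        \<exists>l. l \<noteq> 0 \<and> (\<lambda>n. sqrt (real n) * (k (Q n) - k P\<^sub>0)) \<longlonglongrightarrow> l}"

definition implicit_hypotheses ::
  "('a measure \<Rightarrow> real) \<Rightarrow> 'a measure \<Rightarrow> 'a measure set \<Rightarrow> (nat \<Rightarrow> 'a measure) set" where
  "implicit_hypotheses k P\<^sub>0 \<P> =
     {Q \<in> local_sequences P\<^sub>0 \<P>. (\<lambda>n. sqrt (real n) * (k (Q n) - k P\<^sub>0)) \<longlonglongrightarrow> 0}"


section \<open>Tests\<close>

text \<open>The sample space \<open>\<Omega>\<^sup>n\<close> is the product over the index set \<open>{..<n}\<close>.\<close>

definition test_sequences :: "'a measure \<Rightarrow> (nat \<Rightarrow> (nat \<Rightarrow> 'a) \<Rightarrow> real) set" where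
  "test_sequences M =
     {\<psi>. \<forall>n. \<psi> n \<in> borel_measurable (Pi\<^sub>M {..<n} (\<lambda>_. M)) \<and>
            (\<forall>\<omega>\<in>space (Pi\<^sub>M {..<n} (\<lambda>_. M)). 0 \<le> \<psi> n \<omega> \<and> \<psi> n \<omega> \<le> 1)}"

definition test_power ::
  "(nat \<Rightarrow> (nat \<Rightarrow> 'a) \<Rightarrow> real) \<Rightarrow> (nat \<Rightarrow> 'a measure) \<Rightarrow> nat \<Rightarrow> real" where
  "test_power \<psi> Q n = (\<integral>\<omega>. \<psi> n \<omega> \<partial>(Pi\<^sub>M {..<n} (\<lambda>_. Q n)))"

definition asymptotically_unbiased_tests ::
  "'a measure \<Rightarrow> real \<Rightarrow> (nat \<Rightarrow> 'a measure) set \<Rightarrow> (nat \<Rightarrow> 'a measure) set \<Rightarrow>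
     (nat \<Rightarrow> (nat \<Rightarrow> 'a) \<Rightarrow> real) set" where
  "asymptotically_unbiased_tests M \<alpha> \<H> \<K> =
     {\<psi> \<in> test_sequences M.
        (\<forall>Q\<in>\<H>. limsup (\<lambda>n. ereal (test_power \<psi> Q n)) \<le> ereal \<alpha>) \<and>
        (\<forall>Q\<in>\<K>. ereal \<alpha> \<le> liminf (\<lambda>n. ereal (test_power \<psi> Q n)))}"

definition asymptotically_optimal ::
  "(nat \<Rightarrow> 'a measure) set \<Rightarrow> (nat \<Rightarrow> (nat \<Rightarrow> 'a) \<Rightarrow> real) set \<Rightarrow>
     (nat \<Rightarrow> (nat \<Rightarrow> 'a) \<Rightarrow> real) \<Rightarrow> bool" where
  "asymptotically_optimal \<F> \<Psi> \<phi> \<longleftrightarrow>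
     \<phi> \<in> \<Psi> \<and>
     (\<forall>Q\<in>\<F>. convergent (test_power \<phi> Q) \<and>
        (\<forall>\<psi>\<in>\<Psi>. limsup (\<lambda>n. ereal (test_power \<psi> Q n)) \<le> ereal (lim (test_power \<phi> Q))))"

definition std_normal_quantile :: "real \<Rightarrow> real" where
  "std_normal_quantile = inv (cdf std_normal_distribution)"

definition two_sided_gradient_test ::
  "real \<Rightarrow> 'a measure \<Rightarrow> ('a \<Rightarrow> real) \<Rightarrow> nat \<Rightarrow> (nat \<Rightarrow> 'a) \<Rightarrow> real" where
  "two_sided_gradient_test \<alpha> P\<^sub>0 k' n \<omega> =
     (if \<bar>1 / sqrt (real n) * (\<Sum>i<n. k' (\<omega> i))\<bar> > std_normal_quantile (1 - \<alpha> / 2) * L2_norm P\<^sub>0 k'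
      then 1 else 0)"

end

theory Submission
  imports Defs
begin

text \<open>
  By a Hellinger bound for product measures, a local sequence with tangent \<open>w\<close> is, up to an error
  \<open>\<parallel>w - g\<parallel>\<close> in the power of any test, asymptotically equivalent to the exponential tilt of \<open>P\<^sub>0\<close> by a
  bounded centered \<open>g\<close>.  Under such tilts the statistic of the test is asymptotically normal, which
  gives its limiting power.  For the optimality, write the tangent as \<open>h + s e\<close> with \<open>e = \<plusminus>k'\<close> and
  \<open>h\<close> orthogonal to \<open>k'\<close>.  The tilts by \<open>h + s e\<close>, \<open>h\<close> and \<open>h - \<delta> e\<close> form an exponential family in
  the statistic, so a Neyman-Pearson argument bounds the power at \<open>h + s e\<close> in terms of the powers at
  \<open>h\<close> and \<open>h - \<delta> e\<close>.  By the density assumptions these are controlled by the hypotheses and the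
  alternatives, and \<open>\<delta> \<rightarrow> 0\<close> yields the power of the two-sided test.
\<close>

section \<open>Square integrable functions\<close>

text \<open>The two density assumptions serve different purposes. A sequence is an implicit
  hypothesis only if the inner product of its tangent with \<open>k'\<close> is exactly zero, which
  approximation would destroy; so approximants must themselves lie in the cone and be orthogonal to
  \<open>k'\<close>. A nonzero inner product survives small perturbations, so for alternatives
  density of the cone suffices. Curves may have singular parts and \<open>k'\<close> need not have
  exponential moments, whereas tilts by bounded functions have explicit exponential likelihoods. The
  price is an error that does not vanish with the sample size but only with the quality of the
  approximation. Hence three nested limits in this order: sample size \<open>n\<close>,
  approximation index \<open>j\<close>, then \<delta>. The power of an arbitrary test is never
  differentiated at \<open>h\<close>. Unbiasedness is used at \<open>h - \<delta> e\<close>, on the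
  side opposite to \<open>h + s e\<close>, and this finite difference replaces the vanishing
  derivative of the classical argument.\<close>

lemma L2_measurable: "h \<in> L2 P \<Longrightarrow> h \<in> borel_measurable P"
  by (simp add: L2_def)

lemma L2_integrable_square: "h \<in> L2 P \<Longrightarrow> integrable P (\<lambda>x. (h x)\<^sup>2)"
  by (simp add: L2_def)

lemma L2_integrable_mult:
  assumes "f \<in> L2 P" "g \<in> L2 P"
  shows "integrable P (\<lambda>x. f x * g x)"
proof (rule Bochner_Integration.integrable_bound)
  show "integrable P (\<lambda>x. (f x)\<^sup>2 + (g x)\<^sup>2)"
    using assms by (simp add: L2_def)
  show "(\<lambda>x. f x * g x) \<in> borel_measurable P"
    using assms by (auto simp: L2_def)
  have "\<bar>f x * g x\<bar> \<le> (f x)\<^sup>2 + (g x)\<^sup>2" for x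
    using sum_squares_bound[of "\<bar>f x\<bar>" "\<bar>g x\<bar>"] mult_nonneg_nonneg[of "\<bar>f x\<bar>" "\<bar>g x\<bar>"]
    by (simp add: abs_mult del: mult_nonneg_nonneg)
  then show "AE x in P. norm (f x * g x) \<le> norm ((f x)\<^sup>2 + (g x)\<^sup>2)"
    by simp
qed

lemma L2_cmult: "f \<in> L2 P \<Longrightarrow> (\<lambda>x. c * f x) \<in> L2 P"
  by (auto simp: L2_def power_mult_distrib)

lemma L2_add:
  assumes "f \<in> L2 P" "g \<in> L2 P"
  shows "(\<lambda>x. f x + g x) \<in> L2 P"
  using assms L2_integrable_mult[OF assms]
  by (auto simp: L2_def power2_sum mult.assoc)

lemma L2_diff:
  assumes "f \<in> L2 P" "g \<in> L2 P"
  shows "(\<lambda>x. f x - g x) \<in> L2 P"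
  using L2_add[OF assms(1) L2_cmult[OF assms(2), of "-1"]] by simp

lemma L2_sum: "(\<And>i. i \<in> I \<Longrightarrow> f i \<in> L2 P) \<Longrightarrow> (\<lambda>x. \<Sum>i\<in>I. f i x) \<in> L2 P"
proof (induction I rule: infinite_finite_induct)
  case (insert i I)
  then show ?case by (auto intro!: L2_add)
qed (simp_all add: L2_def)

lemma L2_norm_nonneg: "0 \<le> L2_norm P h"
  by (simp add: L2_norm_def)

lemma L2_norm_power2: "(L2_norm P h)\<^sup>2 = (\<integral>x. (h x)\<^sup>2 \<partial>P)"
  by (simp add: L2_norm_def)

lemma L2_norm_cmult: "L2_norm P (\<lambda>x. c * h x) = \<bar>c\<bar> * L2_norm P h"
  by (simp add: L2_norm_def power_mult_distrib real_sqrt_mult)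

lemma L2_norm_minus_commute: "L2_norm P (\<lambda>x. f x - g x) = L2_norm P (\<lambda>x. g x - f x)"
  by (simp add: L2_norm_def power2_commute)

lemma L2_integral_square_add:
  assumes "f \<in> L2 P" "g \<in> L2 P"
  shows "(\<integral>x. (f x + g x)\<^sup>2 \<partial>P)
    = (\<integral>x. (f x)\<^sup>2 \<partial>P) + 2 * (\<integral>x. f x * g x \<partial>P) + (\<integral>x. (g x)\<^sup>2 \<partial>P)"
  using assms L2_integrable_mult[OF assms]
  by (simp add: power2_sum mult.assoc L2_def)

text \<open>The quadratic polynomial in \<open>t\<close> given by the squared norm of
  \<open>f + t g\<close> is nonnegative; evaluating it at its minimum \<open>- B / C\<close> gives
  the inequality.\<close>

lemma L2_Cauchy_Schwarz:
  assumes "f \<in> L2 P" "g \<in> L2 P"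
  shows "\<bar>\<integral>x. f x * g x \<partial>P\<bar> \<le> L2_norm P f * L2_norm P g"
proof -
  define A B C where "A = (\<integral>x. (f x)\<^sup>2 \<partial>P)" and "B = (\<integral>x. f x * g x \<partial>P)"
    and "C = (\<integral>x. (g x)\<^sup>2 \<partial>P)"
  have quad: "0 \<le> A + 2 * t * B + t\<^sup>2 * C" for t
  proof -
    have "0 \<le> (\<integral>x. (f x + t * g x)\<^sup>2 \<partial>P)" by simp
    also have "\<dots> = A + 2 * (\<integral>x. f x * (t * g x) \<partial>P) + (\<integral>x. (t * g x)\<^sup>2 \<partial>P)"
      unfolding A_def by (rule L2_integral_square_add) (use assms L2_cmult in auto)
    also have "(\<integral>x. f x * (t * g x) \<partial>P) = t * B"
      unfolding B_def by (simp flip: integral_mult_right_zero add: algebra_simps)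
    also have "(\<integral>x. (t * g x)\<^sup>2 \<partial>P) = t\<^sup>2 * C"
      unfolding C_def by (simp add: power_mult_distrib)
    finally show ?thesis by (simp add: mult.assoc)
  qed
  have nonneg: "0 \<le> A" "0 \<le> C" by (simp_all add: A_def C_def)
  have "B\<^sup>2 \<le> A * C"
  proof (cases "C = 0")
    case True
    have "B = 0"
    proof (rule ccontr)
      assume "B \<noteq> 0"
      \<comment> \<open>With \<open>C = 0\<close> the polynomial is affine in \<open>t\<close>; at
        this point it takes the value -1.\<close>
      then show False
        using quad[of "-(A + 1) / (2 * B)"] True by (simp add: field_simps)
    qed
    with True show ?thesis by simp
  next
    case False
    with nonneg have "0 < C" by simp
    have "0 \<le> (A + 2 * (- B / C) * B + (- B / C)\<^sup>2 * C) * C"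
      using quad[of "- B / C"] nonneg by (intro mult_nonneg_nonneg)
    also have "\<dots> = A * C - B\<^sup>2"
      using \<open>0 < C\<close> by (simp add: field_simps power2_eq_square)
    finally show ?thesis by simp
  qed
  then have "\<bar>B\<bar> \<le> sqrt (A * C)"
    by (simp add: real_le_rsqrt)
  then show ?thesis
    by (simp add: A_def B_def C_def L2_norm_def real_sqrt_mult)
qed

lemma L2_norm_triangle:
  assumes "f \<in> L2 P" "g \<in> L2 P"
  shows "L2_norm P (\<lambda>x. f x + g x) \<le> L2_norm P f + L2_norm P g"
proof (rule power2_le_imp_le)
  have "(L2_norm P (\<lambda>x. f x + g x))\<^sup>2
      = (L2_norm P f)\<^sup>2 + 2 * (\<integral>x. f x * g x \<partial>P) + (L2_norm P g)\<^sup>2"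
    unfolding L2_norm_power2 by (rule L2_integral_square_add[OF assms])
  also have "\<dots> \<le> (L2_norm P f + L2_norm P g)\<^sup>2"
    using L2_Cauchy_Schwarz[OF assms] by (simp add: power2_sum)
  finally show "(L2_norm P (\<lambda>x. f x + g x))\<^sup>2 \<le> (L2_norm P f + L2_norm P g)\<^sup>2" .
qed (simp add: L2_norm_nonneg)

text \<open>Membership in \<open>L2\<close> is part of the notion because the Bochner integral of a
  non-integrable function is 0, so a small value of \<open>L2_norm\<close> alone carries no
  information.\<close>

definition L2_lim :: "'a measure \<Rightarrow> (nat \<Rightarrow> 'a \<Rightarrow> real) \<Rightarrow> ('a \<Rightarrow> real) \<Rightarrow> bool" where
  "L2_lim P F f \<longleftrightarrow> (\<forall>n. F n \<in> L2 P) \<and> f \<in> L2 P \<and>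
     (\<lambda>n. L2_norm P (\<lambda>x. F n x - f x)) \<longlonglongrightarrow> 0"

lemma L2_lim_const: "f \<in> L2 P \<Longrightarrow> L2_lim P (\<lambda>_. f) f"
  by (simp add: L2_lim_def L2_norm_def)

lemma L2_lim_scale:
  assumes "a \<longlonglongrightarrow> c" "L2_lim P F f"
  shows "L2_lim P (\<lambda>n x. a n * F n x) (\<lambda>x. c * f x)"
proof -
  have F: "F n \<in> L2 P" and f: "f \<in> L2 P" for n
    using assms by (auto simp: L2_lim_def)
  have le: "L2_norm P (\<lambda>x. a n * F n x - c * f x)
      \<le> \<bar>a n\<bar> * L2_norm P (\<lambda>x. F n x - f x) + \<bar>a n - c\<bar> * L2_norm P f" for n
  proof -
    have "a n * F n x - c * f x = a n * (F n x - f x) + (a n - c) * f x" for x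
      by (simp add: algebra_simps)
    then show ?thesis
      using L2_norm_triangle[OF L2_cmult[OF L2_diff[OF F f], of "a n"] L2_cmult[OF f, of "a n - c"]]
      unfolding L2_norm_cmult by simp
  qed
  have "(\<lambda>n. \<bar>a n\<bar> * L2_norm P (\<lambda>x. F n x - f x) + \<bar>a n - c\<bar> * L2_norm P f)
      \<longlonglongrightarrow> \<bar>c\<bar> * 0 + \<bar>c - c\<bar> * L2_norm P f"
    using assms by (intro tendsto_intros) (auto simp: L2_lim_def)
  then have lim: "(\<lambda>n. \<bar>a n\<bar> * L2_norm P (\<lambda>x. F n x - f x) + \<bar>a n - c\<bar> * L2_norm P f) \<longlonglongrightarrow> 0"
    by simp
  have "(\<lambda>n. L2_norm P (\<lambda>x. a n * F n x - c * f x)) \<longlonglongrightarrow> 0"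
    by (rule Lim_null_comparison[OF _ lim]) (simp add: L2_norm_nonneg le)
  then show ?thesis
    using F f by (simp add: L2_lim_def L2_cmult)
qed

lemma L2_lim_cmult: "L2_lim P F f \<Longrightarrow> L2_lim P (\<lambda>n x. c * F n x) (\<lambda>x. c * f x)"
  by (rule L2_lim_scale[OF tendsto_const])

lemma L2_lim_add:
  assumes "L2_lim P F f" "L2_lim P G g"
  shows "L2_lim P (\<lambda>n x. F n x + G n x) (\<lambda>x. f x + g x)"
proof -
  have lim: "(\<lambda>n. L2_norm P (\<lambda>x. F n x - f x) + L2_norm P (\<lambda>x. G n x - g x)) \<longlonglongrightarrow> 0"
    using assms by (auto simp: L2_lim_def intro: tendsto_add_zero)
  have le: "L2_norm P (\<lambda>x. F n x + G n x - (f x + g x))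
      \<le> L2_norm P (\<lambda>x. F n x - f x) + L2_norm P (\<lambda>x. G n x - g x)" for n
    using L2_norm_triangle[of "\<lambda>x. F n x - f x" P "\<lambda>x. G n x - g x"] assms
    by (simp add: L2_lim_def L2_diff algebra_simps)
  have "(\<lambda>n. L2_norm P (\<lambda>x. F n x + G n x - (f x + g x))) \<longlonglongrightarrow> 0"
    by (rule Lim_null_comparison[OF _ lim]) (simp add: L2_norm_nonneg le)
  then show ?thesis
    using assms by (simp add: L2_lim_def L2_add)
qed

lemma L2_lim_diff:
  assumes "L2_lim P F f" "L2_lim P G g"
  shows "L2_lim P (\<lambda>n x. F n x - G n x) (\<lambda>x. f x - g x)"
  using L2_lim_add[OF assms(1) L2_lim_cmult[OF assms(2), of "-1"]] by simp

lemma L2_lim_norm: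
  assumes "L2_lim P F f"
  shows "(\<lambda>n. L2_norm P (F n)) \<longlonglongrightarrow> L2_norm P f"
proof -
  have F: "F n \<in> L2 P" and f: "f \<in> L2 P" for n
    using assms by (auto simp: L2_lim_def)
  have bound: "\<bar>L2_norm P (F n) - L2_norm P f\<bar> \<le> L2_norm P (\<lambda>x. F n x - f x)" for n
    using L2_norm_triangle[OF L2_diff[OF F f] f, of n]
      L2_norm_triangle[OF L2_diff[OF f F[of n]] F[of n]] L2_norm_minus_commute[of P f "F n"]
    by (simp add: abs_le_iff)
  have "(\<lambda>n. L2_norm P (F n) - L2_norm P f) \<longlonglongrightarrow> 0"
    by (rule Lim_null_comparison[where g = "\<lambda>n. L2_norm P (\<lambda>x. F n x - f x)"])
      (use assms bound in \<open>auto simp: L2_lim_def\<close>)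
  then show ?thesis
    by (rule LIM_zero_cancel)
qed

text \<open>Polarization expresses the inner product through norms, which are continuous by
  \<open>L2_lim_norm\<close>.\<close>

lemma L2_lim_inner:
  assumes "L2_lim P F f" "L2_lim P G g"
  shows "(\<lambda>n. \<integral>x. F n x * G n x \<partial>P) \<longlonglongrightarrow> (\<integral>x. f x * g x \<partial>P)"
proof -
  have polar: "(\<integral>x. u x * w x \<partial>P) = ((L2_norm P (\<lambda>x. u x + w x))\<^sup>2
      - (L2_norm P u)\<^sup>2 - (L2_norm P w)\<^sup>2) / 2" if "u \<in> L2 P" "w \<in> L2 P" for u w
    unfolding L2_norm_power2 L2_integral_square_add[OF that] by simp
  have mem: "F n \<in> L2 P" "G n \<in> L2 P" "f \<in> L2 P" "g \<in> L2 P" for n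
    using assms by (auto simp: L2_lim_def)
  show ?thesis
    unfolding polar[OF mem(1,2)] polar[OF mem(3,4)]
    by (intro tendsto_intros L2_lim_norm L2_lim_add assms)
      simp
qed

lemma L2_closure_lim:
  assumes "h \<in> L2_closure P S" "S \<subseteq> L2 P"
  shows "\<exists>G. (\<forall>j. G j \<in> S) \<and> L2_lim P G h"
proof -
  have "\<forall>j. \<exists>g\<in>S. L2_norm P (\<lambda>x. h x - g x) < 1 / real (Suc j)"
    using assms(1) by (simp add: L2_closure_def)
  then obtain G where G: "\<And>j. G j \<in> S" "\<And>j. L2_norm P (\<lambda>x. h x - G j x) < 1 / real (Suc j)"
    by metis
  have "(\<lambda>j. L2_norm P (\<lambda>x. G j x - h x)) \<longlonglongrightarrow> 0"
  proof (rule Lim_null_comparison)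
    show "(\<lambda>j. 1 / real (Suc j)) \<longlonglongrightarrow> 0"
      by (rule LIMSEQ_Suc) (rule lim_1_over_n)
    show "\<forall>\<^sub>F j in sequentially. norm (L2_norm P (\<lambda>x. G j x - h x)) \<le> 1 / real (Suc j)"
      using G(2) by (simp add: L2_norm_nonneg less_imp_le L2_norm_minus_commute[of P _ h])
  qed
  then show ?thesis
    using G(1) assms by (auto simp: L2_lim_def L2_closure_def)
qed

lemma L2_lim_closure:
  assumes "L2_lim P G h" "\<And>j. G j \<in> S"
  shows "h \<in> L2_closure P S"
proof -
  have "\<exists>g\<in>S. L2_norm P (\<lambda>x. h x - g x) < \<delta>" if "0 < \<delta>" for \<delta>
  proof -
    have "\<forall>\<^sub>F j in sequentially. L2_norm P (\<lambda>x. G j x - h x) < \<delta>"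
      using assms(1) that by (auto simp: L2_lim_def intro: order_tendstoD)
    then obtain j where "L2_norm P (\<lambda>x. G j x - h x) < \<delta>"
      by (auto simp: eventually_sequentially)
    then show ?thesis
      using assms(2)[of j] by (auto simp: L2_norm_minus_commute[of P h])
  qed
  then show ?thesis
    using assms(1) by (simp add: L2_closure_def L2_lim_def)
qed

section \<open>Linear spans and their closures\<close>

lemma linear_span_add:
  assumes "f \<in> linear_span S" "g \<in> linear_span S"
  shows "(\<lambda>x. f x + g x) \<in> linear_span S"
proof -
  obtain m c u where f: "\<forall>i<(m::nat). u i \<in> S" "f = (\<lambda>x. \<Sum>i<m. c i * u i x)"
    using assms(1) unfolding linear_span_def mem_Collect_eq by blast
  obtain n d w where g: "\<forall>i<(n::nat). w i \<in> S" "g = (\<lambda>x. \<Sum>i<n. d i * w i x)"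
    using assms(2) unfolding linear_span_def mem_Collect_eq by blast
  define e where "e i = (if i < m then c i else d (i - m))" for i
  define v where "v i = (if i < m then u i else w (i - m))" for i
  have split: "{..<m + n} = {..<m} \<union> (\<lambda>i. i + m) ` {..<n}"
    by (auto simp: image_iff) (metis add.commute diff_add_inverse lessThan_iff less_diff_conv2 not_less le_add_diff_inverse2)
  have "(\<Sum>i<m + n. e i * v i x) = (\<Sum>i<m. e i * v i x) + (\<Sum>i\<in>(\<lambda>i. i + m) ` {..<n}. e i * v i x)" for x
    unfolding split by (rule sum.union_disjoint) auto
  also have "\<dots> x = f x + g x" for x
    by (simp add: sum.reindex f g e_def v_def)
  finally have "(\<lambda>x. f x + g x) = (\<lambda>x. \<Sum>i<m + n. e i * v i x)"
    by simp
  moreover have "\<forall>i<m + n. v i \<in> S"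
    using f(1) g(1) by (simp add: v_def)
  ultimately show ?thesis
    unfolding linear_span_def by blast
qed

lemma linear_span_cmult:
  assumes "f \<in> linear_span S"
  shows "(\<lambda>x. a * f x) \<in> linear_span S"
proof -
  obtain m c u where f: "\<forall>i<(m::nat). u i \<in> S" "f = (\<lambda>x. \<Sum>i<m. c i * u i x)"
    using assms unfolding linear_span_def mem_Collect_eq by blast
  then have "(\<lambda>x. a * f x) = (\<lambda>x. \<Sum>i<m. (a * c i) * u i x)"
    by (simp add: sum_distrib_left mult.assoc)
  with f(1) show ?thesis
    unfolding linear_span_def mem_Collect_eq
    by (intro exI[of _ m] exI[of _ "\<lambda>i. a * c i"] exI[of _ u]) simp
qed

lemma linear_span_L2: "S \<subseteq> L2 P \<Longrightarrow> linear_span S \<subseteq> L2 P"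
  by (auto simp: linear_span_def intro!: L2_sum L2_cmult)

text \<open>Makes the tangent space a vector space, so that the components of a tangent along and
  orthogonal to the canonical gradient stay inside it.\<close>

lemma L2_closure_linear_span_lincomb:
  assumes "S \<subseteq> L2 P" "f \<in> L2_closure P (linear_span S)" "g \<in> L2_closure P (linear_span S)"
  shows "(\<lambda>x. a * f x + b * g x) \<in> L2_closure P (linear_span S)"
proof -
  obtain F G where "L2_lim P F f" "L2_lim P G g"
    and mem: "\<And>j. F j \<in> linear_span S" "\<And>j. G j \<in> linear_span S"
    using L2_closure_lim[OF assms(2) linear_span_L2[OF assms(1)]]
      L2_closure_lim[OF assms(3) linear_span_L2[OF assms(1)]] by auto
  then have "L2_lim P (\<lambda>n x. a * F n x + b * G n x) (\<lambda>x. a * f x + b * g x)"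
    by (intro L2_lim_add L2_lim_cmult)
  then show ?thesis
    by (rule L2_lim_closure) (intro linear_span_add linear_span_cmult mem)
qed

section \<open>Square integrable functions under a probability measure and their bounded
  approximants\<close>

lemma (in prob_space) L2_const: "(\<lambda>_. c) \<in> L2 M"
  by (simp add: L2_def)

lemma (in prob_space) L2_integrable:
  assumes "f \<in> L2 M"
  shows "integrable M f"
  using L2_integrable_mult[OF assms L2_const[of 1]] by simp

lemma (in prob_space) L2_bounded:
  assumes "f \<in> borel_measurable M" "\<And>x. \<bar>f x\<bar> \<le> B"
  shows "f \<in> L2 M"
proof -
  have "integrable M (\<lambda>x. (f x)\<^sup>2)"
  proof (rule integrable_const_bound[where B = "B\<^sup>2"])
    have "(f x)\<^sup>2 \<le> B\<^sup>2" for x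
      using power_mono[OF assms(2)[of x], of 2] by simp
    then show "AE x in M. norm ((f x)\<^sup>2) \<le> B\<^sup>2" by simp
  qed (use assms in simp)
  then show ?thesis
    using assms by (simp add: L2_def)
qed

lemma (in prob_space) L2_lim_integral:
  assumes "L2_lim M F f"
  shows "(\<lambda>n. \<integral>x. F n x \<partial>M) \<longlonglongrightarrow> (\<integral>x. f x \<partial>M)"
  using L2_lim_inner[OF assms L2_lim_const[OF L2_const[of 1]]] by simp

lemma (in prob_space) L2_lim_uniform:
  fixes F :: "nat \<Rightarrow> 'a \<Rightarrow> real"
  assumes "\<And>n. F n \<in> L2 M" "f \<in> L2 M" "\<And>n x. \<bar>F n x - f x\<bar> \<le> e n" "e \<longlonglongrightarrow> 0"
  shows "L2_lim M F f"
proof -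
  have le: "L2_norm M (\<lambda>x. F n x - f x) \<le> e n" for n
  proof -
    have "0 \<le> e n"
      \<comment> \<open>Any point of the type will do: the error bound dominates an absolute
        value.\<close>
      using assms(3)[of n undefined] by linarith
    have "(\<integral>x. (F n x - f x)\<^sup>2 \<partial>M) \<le> (\<integral>x. (e n)\<^sup>2 \<partial>M)"
      using power_mono[OF assms(3)[of n], where n = 2] by (intro integral_mono') auto
    then have "(\<integral>x. (F n x - f x)\<^sup>2 \<partial>M) \<le> (e n)\<^sup>2"
      by (simp add: prob_space)
    with \<open>0 \<le> e n\<close> show ?thesis
      unfolding L2_norm_def by (intro real_le_lsqrt)
  qed
  have "(\<lambda>n. L2_norm M (\<lambda>x. F n x - f x)) \<longlonglongrightarrow> 0"
    by (rule Lim_null_comparison[OF _ assms(4)]) (simp add: L2_norm_nonneg le)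
  then show ?thesis
    using assms by (simp add: L2_lim_def)
qed

lemma (in prob_space) L2_lim_const_seq: "c \<longlonglongrightarrow> d \<Longrightarrow> L2_lim M (\<lambda>n _. c n) (\<lambda>_. d)"
  using L2_lim_scale[OF _ L2_lim_const[OF L2_const[of 1]], of c d] by simp

text \<open>The bound holds at every point of the type rather than almost everywhere, so that
  exponentials of such functions can be estimated pointwise without null sets.\<close>

definition (in prob_space) bounded_centered :: "('a \<Rightarrow> real) \<Rightarrow> bool" where
  "bounded_centered g \<longleftrightarrow> g \<in> borel_measurable M \<and> (\<exists>B. \<forall>x. \<bar>g x\<bar> \<le> B) \<and> (\<integral>x. g x \<partial>M) = 0"

lemma (in prob_space) bounded_centered_L2: "bounded_centered g \<Longrightarrow> g \<in> L2_centered M"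
  by (auto simp: bounded_centered_def L2_centered_def intro: L2_bounded)

lemma (in prob_space) bounded_centered_lincomb:
  assumes "bounded_centered f" "bounded_centered g"
  shows "bounded_centered (\<lambda>x. a * f x + b * g x)"
proof -
  obtain B C where B: "\<And>x. \<bar>f x\<bar> \<le> B" and C: "\<And>x. \<bar>g x\<bar> \<le> C"
    using assms by (auto simp: bounded_centered_def)
  have "\<bar>a * f x + b * g x\<bar> \<le> \<bar>a\<bar> * B + \<bar>b\<bar> * C" for x
  proof -
    have "\<bar>a * f x + b * g x\<bar> \<le> \<bar>a\<bar> * \<bar>f x\<bar> + \<bar>b\<bar> * \<bar>g x\<bar>"
      by (metis abs_mult abs_triangle_ineq)
    also have "\<dots> \<le> \<bar>a\<bar> * B + \<bar>b\<bar> * C"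
      by (intro add_mono mult_left_mono B C) auto
    finally show ?thesis .
  qed
  moreover have "integrable M f" "integrable M g"
    using assms[THEN bounded_centered_L2] by (auto simp: L2_centered_def intro: L2_integrable)
  ultimately show ?thesis
    using assms by (auto simp: bounded_centered_def)
qed

text \<open>Truncation at height \<open>j\<close> converges by dominated convergence but spoils the
  mean; the means tend to the integral of \<open>h\<close>, which is 0, so subtracting them restores
  centering without changing the limit.\<close>

lemma (in prob_space) L2_lim_bounded_centered:
  assumes "h \<in> L2_centered M"
  shows "\<exists>G. (\<forall>j. bounded_centered (G j)) \<and> L2_lim M G h"
proof -
  have h: "h \<in> L2 M" "(\<integral>x. h x \<partial>M) = 0"
    using assms by (auto simp: L2_centered_def)
  have [measurable]: "h \<in> borel_measurable M"
    using h(1) by (rule L2_measurable)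
  define T where "T j x = (if \<bar>h x\<bar> \<le> real j then h x else 0)" for j x
  have T_meas [measurable]: "T j \<in> borel_measurable M" for j
    unfolding T_def by measurable
  have T_bound: "\<bar>T j x\<bar> \<le> real j" for j x
    by (simp add: T_def)
  have T_L2: "T j \<in> L2 M" for j
    by (rule L2_bounded[OF T_meas T_bound])
  \<comment> \<open>The difference is either 0 or \<open>- h x\<close>, so its square is dominated
    by the square of \<open>h\<close>.\<close>
  have "(\<lambda>j. \<integral>x. (T j x - h x)\<^sup>2 \<partial>M) \<longlonglongrightarrow> (\<integral>x. 0 \<partial>M)"
  proof (rule integral_dominated_convergence[where w = "\<lambda>x. (h x)\<^sup>2"])
    have "(\<lambda>j. (T j x - h x)\<^sup>2) \<longlonglongrightarrow> 0" for x
    proof (rule tendsto_eventually)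
      show "\<forall>\<^sub>F j in sequentially. (T j x - h x)\<^sup>2 = 0"
        using eventually_ge_at_top[of "nat \<lceil>\<bar>h x\<bar>\<rceil>"]
      proof eventually_elim
        case (elim j)
        then have "\<bar>h x\<bar> \<le> real j" by linarith
        then show ?case by (simp add: T_def)
      qed
    qed
    then show "AE x in M. (\<lambda>j. (T j x - h x)\<^sup>2) \<longlonglongrightarrow> 0" by simp
  qed (use h in \<open>auto simp: T_def L2_integrable_square\<close>)
  then have "(\<lambda>j. L2_norm M (\<lambda>x. T j x - h x)) \<longlonglongrightarrow> 0"
    unfolding L2_norm_def using tendsto_real_sqrt by fastforce
  then have T_lim: "L2_lim M T h"
    using T_L2 h(1) by (simp add: L2_lim_def)
  have mean: "(\<lambda>j. \<integral>x. T j x \<partial>M) \<longlonglongrightarrow> 0"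
    using L2_lim_integral[OF T_lim] h(2) by simp
  have "L2_lim M (\<lambda>j x. \<integral>x. T j x \<partial>M) (\<lambda>_. 0)"
    using tendsto_rabs_zero[OF mean] by (simp add: L2_lim_def L2_const L2_norm_def prob_space)
  from L2_lim_diff[OF T_lim this]
  have lim: "L2_lim M (\<lambda>j x. T j x - (\<integral>x. T j x \<partial>M)) h" by simp
  have "bounded_centered (\<lambda>x. T j x - (\<integral>x. T j x \<partial>M))" for j
  proof -
    have "\<bar>T j x - (\<integral>x. T j x \<partial>M)\<bar> \<le> real j + \<bar>\<integral>x. T j x \<partial>M\<bar>" for x
      using T_bound[of j x] by linarith
    moreover have "(\<integral>x. T j x - (\<integral>x. T j x \<partial>M) \<partial>M) = 0"
      using L2_integrable[OF T_L2, of j] by (simp add: prob_space)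
    ultimately show ?thesis
      unfolding bounded_centered_def using T_meas[of j] by auto
  qed
  with lim show ?thesis
    by (intro exI[of _ "\<lambda>j x. T j x - (\<integral>x. T j x \<partial>M)"]) simp
qed

section \<open>The two-sided Gaussian test\<close>

abbreviation std_normal_cdf :: "real \<Rightarrow> real" where
  "std_normal_cdf \<equiv> cdf std_normal_distribution"

interpretation std_normal: real_distribution std_normal_distribution
  by (rule real_dist_normal_dist)

text \<open>The fundamental theorem of calculus on a window around \<open>x\<close>. The finite base
  point \<open>a\<close> replaces minus infinity, and \<open>std_normal_cdf a\<close> is the
  constant of integration.\<close>

lemma DERIV_std_normal_cdf:
  "(std_normal_cdf has_real_derivative std_normal_density x) (at x)"
proof -
  define a b where "a = x - 1" and "b = x + 1"
  have cont: "continuous_on S std_normal_density" for S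
    unfolding normal_density_def by (intro continuous_intros) auto
  have incr: "std_normal_cdf y = std_normal_cdf a + integral {a..y} std_normal_density" if "a < y" for y
  proof -
    have "std_normal_cdf y - std_normal_cdf a = measure std_normal_distribution {a<..y}"
      by (rule std_normal.cdf_diff_eq[OF that])
    also have "\<dots> = (\<integral>z. indicator {a<..y} z \<partial>std_normal_distribution)"
      by simp
    also have "\<dots> = (\<integral>z. std_normal_density z *\<^sub>R indicator {a<..y} z \<partial>lborel)"
      by (rule integral_density) auto
    also have "\<dots> = (LINT z:{a..y}|lborel. std_normal_density z)"
      unfolding set_lebesgue_integral_def
      by (rule integral_cong_AE)
        (auto intro!: eventually_mono[OF AE_lborel_singleton[of a]] split: split_indicator)
    also have "\<dots> = integral {a..y} std_normal_density"
      by (rule set_borel_integral_eq_integral, rule borel_integrable_atLeastAtMost', rule cont)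
    finally show ?thesis by simp
  qed
  have "((\<lambda>y. integral {a..y} std_normal_density) has_real_derivative std_normal_density x)
      (at x within {a..b})"
    by (rule integral_has_real_derivative[OF cont]) (auto simp: a_def b_def)
  then have "((\<lambda>y. std_normal_cdf a + integral {a..y} std_normal_density)
      has_real_derivative std_normal_density x) (at x)"
    using at_within_interior[of x "{a..b}"] by (auto simp: a_def b_def intro!: derivative_eq_intros)
  then show ?thesis
    by (rule has_field_derivative_transform_within_open[where S = "{a<..}"]) (simp_all add: incr, simp add: a_def)
qed

lemma isCont_std_normal_cdf: "isCont std_normal_cdf x"
  using DERIV_std_normal_cdf by (rule DERIV_isCont)

text \<open>The sum of the distribution function at \<open>y\<close> and at \<open>- y\<close> has
  derivative 0 because the density is even, and its limit at infinity is 1.\<close>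

lemma std_normal_cdf_minus: "std_normal_cdf (- x) = 1 - std_normal_cdf x"
proof -
  define f where "f y = std_normal_cdf y + std_normal_cdf (- y)" for y
  have "(f has_real_derivative 0) (at y)" for y
    unfolding f_def
    by (rule derivative_eq_intros DERIV_std_normal_cdf DERIV_chain2[OF DERIV_std_normal_cdf] refl)+
      (simp add: normal_density_def)
  then have const: "f x = f y" for y
    by (intro DERIV_isconst_all) simp
  have "((\<lambda>y. std_normal_cdf (- y)) \<longlongrightarrow> 0) at_top"
    by (rule filterlim_compose[OF std_normal.cdf_lim_at_bot filterlim_uminus_at_bot_at_top])
  from tendsto_add[OF std_normal.cdf_lim_at_top_prob this]
  have "(f \<longlongrightarrow> 1) at_top"
    unfolding f_def by simp
  moreover have "(f \<longlongrightarrow> f x) at_top"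
    by (rule tendsto_eventually, rule always_eventually) (metis const)
  ultimately have "f x = 1"
    using tendsto_unique[of at_top f] by simp
  then show ?thesis
    by (simp add: f_def)
qed

text \<open>The quantile is defined by \<open>inv\<close>, a choice of preimage, so it is enough
  that \<open>p\<close> is attained; this is the intermediate value theorem.\<close>

lemma std_normal_cdf_quantile:
  assumes "0 < p" "p < 1"
  shows "std_normal_cdf (std_normal_quantile p) = p"
proof -
  have "\<forall>\<^sub>F x in at_bot. std_normal_cdf x < p"
    using std_normal.cdf_lim_at_bot assms(1) by (rule order_tendstoD)
  then obtain a where a: "std_normal_cdf a < p"
    by (auto simp: eventually_at_bot_linorder)
  have "\<forall>\<^sub>F x in at_top. p < std_normal_cdf x"
    using std_normal.cdf_lim_at_top_prob assms(2) by (rule order_tendstoD)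
  then obtain b where b: "p < std_normal_cdf b"
    by (auto simp: eventually_at_top_linorder)
  have "a \<le> b"
    using a b std_normal.cdf_nondecreasing[of b a] by linarith
  then obtain x where "std_normal_cdf x = p"
    using IVT'[of std_normal_cdf a p b] a b isCont_std_normal_cdf
    by (auto simp: continuous_at_imp_continuous_on)
  then have "p \<in> range std_normal_cdf" by auto
  then show ?thesis
    unfolding std_normal_quantile_def by (rule f_inv_into_f)
qed

lemma std_normal_quantile_pos:
  assumes "1 / 2 < p" "p < 1"
  shows "0 < std_normal_quantile p"
proof (rule ccontr)
  define u where "u = std_normal_quantile p"
  assume "\<not> 0 < std_normal_quantile p"
  then have "std_normal_cdf u \<le> std_normal_cdf (- u)"
    by (intro std_normal.cdf_nondecreasing) (simp add: u_def)
  moreover have "std_normal_cdf u = p"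
    unfolding u_def using assms by (intro std_normal_cdf_quantile) auto
  ultimately show False
    using assms std_normal_cdf_minus[of u] by simp
qed

text \<open>The probability that a normal variable with mean \<open>m\<close> and standard deviation
  \<sigma> exceeds \<open>v\<close> in absolute value: the limiting power of the two-sided
  test.\<close>

definition two_sided_power :: "real \<Rightarrow> real \<Rightarrow> real \<Rightarrow> real" where
  "two_sided_power v m \<sigma> = 1 - (std_normal_cdf ((v - m) / \<sigma>) - std_normal_cdf ((- v - m) / \<sigma>))"

lemma measure_two_sided:
  assumes "0 < \<sigma>" "0 < v"
  shows "measure std_normal_distribution {x. v < \<bar>\<sigma> * x + m\<bar>} = two_sided_power v m \<sigma>"
proof -
  let ?a = "(- v - m) / \<sigma>" and ?b = "(v - m) / \<sigma>"
  have less: "?a < ?b"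
    using assms by (simp add: divide_strict_right_mono)
  have sing: "measure std_normal_distribution {?a} = 0"
    using isCont_std_normal_cdf[of ?a] std_normal.isCont_cdf by blast
  have "(v < \<bar>\<sigma> * x + m\<bar>) \<longleftrightarrow> x \<notin> {?a..?b}" for x
    using assms by (auto simp: field_simps abs_if)
  then have "{x. v < \<bar>\<sigma> * x + m\<bar>} = - {?a..?b}"
    unfolding set_eq_iff Compl_iff mem_Collect_eq by blast
  moreover have "measure std_normal_distribution (- {?a..?b})
      = 1 - measure std_normal_distribution {?a..?b}"
    using std_normal.prob_compl[of "{?a..?b}"] by (simp add: Compl_eq_Diff_UNIV)
  ultimately have "measure std_normal_distribution {x. v < \<bar>\<sigma> * x + m\<bar>}
      = 1 - measure std_normal_distribution {?a..?b}"
    by (simp only:)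
  also have "{?a..?b} = {?a} \<union> {?a<..?b}"
    using less by auto
  also have "measure std_normal_distribution \<dots>
      = measure std_normal_distribution {?a} + measure std_normal_distribution {?a<..?b}"
    by (rule std_normal.finite_measure_Union) auto
  also have "measure std_normal_distribution {?a<..?b} = std_normal_cdf ?b - std_normal_cdf ?a"
    using std_normal.cdf_diff_eq[OF less] by simp
  finally show ?thesis
    using sing by (simp add: two_sided_power_def)
qed

lemma two_sided_power_minus: "two_sided_power v (- m) \<sigma> = two_sided_power v m \<sigma>"
proof -
  have "(v - - m) / \<sigma> = - ((- v - m) / \<sigma>)" "(- v - - m) / \<sigma> = - ((v - m) / \<sigma>)"
    by (simp_all add: minus_divide_left)
  then show ?thesis
    unfolding two_sided_power_def by (simp only: std_normal_cdf_minus)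
qed

lemma DERIV_two_sided_power:
  assumes "0 < \<sigma>"
  shows "((\<lambda>m. two_sided_power v m \<sigma>) has_real_derivative
     (std_normal_density ((v - m) / \<sigma>) - std_normal_density ((- v - m) / \<sigma>)) / \<sigma>) (at m)"
proof -
  have "((\<lambda>m. std_normal_cdf ((c - m) / \<sigma>)) has_real_derivative
      std_normal_density ((c - m) / \<sigma>) * (- 1 / \<sigma>)) (at m)" for c
    by (rule DERIV_chain2[OF DERIV_std_normal_cdf])
      (use assms in \<open>auto intro!: derivative_eq_intros\<close>)
  from DERIV_diff[OF DERIV_const[of 1] DERIV_diff[OF this[of v] this[of "- v"]]]
  show ?thesis
    unfolding two_sided_power_def by (simp add: diff_divide_distrib)
qed

text \<open>Unbiasedness of the Gaussian two-sided test. For \<open>m\<close> nonnegative,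
  \<open>v - m\<close> is at least as close to 0 as \<open>- v - m\<close>, so the derivative is
  nonnegative; negative \<open>m\<close> follow by symmetry.\<close>

lemma two_sided_power_ge:
  assumes "0 < \<sigma>" "0 < v"
  shows "two_sided_power v 0 \<sigma> \<le> two_sided_power v m \<sigma>"
proof -
  have pos: "two_sided_power v 0 \<sigma> \<le> two_sided_power v m \<sigma>" if "0 \<le> m" for m
  proof (rule DERIV_nonneg_imp_nondecreasing[OF that], intro exI conjI)
    fix y :: real assume y: "0 \<le> y" "y \<le> m"
    show "((\<lambda>m. two_sided_power v m \<sigma>) has_real_derivative
     (std_normal_density ((v - y) / \<sigma>) - std_normal_density ((- v - y) / \<sigma>)) / \<sigma>) (at y)"
      by (rule DERIV_two_sided_power[OF assms(1)])
    have "\<bar>v - y\<bar> \<le> \<bar>- v - y\<bar>"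
      using y assms by auto
    then have "((v - y) / \<sigma>)\<^sup>2 \<le> ((- v - y) / \<sigma>)\<^sup>2"
      by (simp add: power_divide divide_right_mono abs_le_square_iff)
    then show "0 \<le> (std_normal_density ((v - y) / \<sigma>) - std_normal_density ((- v - y) / \<sigma>)) / \<sigma>"
      using assms by (auto simp: std_normal_density_def intro!: divide_nonneg_pos divide_right_mono)
  qed
  show ?thesis
    using pos[of m] pos[of "- m"] by (cases "0 \<le> m") (auto simp: two_sided_power_minus)
qed

lemma tendsto_two_sided_power:
  assumes "(m \<longlongrightarrow> m0) F" "(\<sigma> \<longlongrightarrow> \<sigma>0) F" "0 < \<sigma>0"
  shows "((\<lambda>j. two_sided_power v (m j) (\<sigma> j)) \<longlongrightarrow> two_sided_power v m0 \<sigma>0) F"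
  unfolding two_sided_power_def
  by (intro tendsto_intros isCont_tendsto_compose[OF isCont_std_normal_cdf] assms)
    (use assms in auto)

lemma two_sided_power_level:
  assumes "0 < \<alpha>" "\<alpha> < 1" "0 < \<sigma>"
  shows "two_sided_power (std_normal_quantile (1 - \<alpha> / 2) * \<sigma>) 0 \<sigma> = \<alpha>"
  using assms std_normal_cdf_minus[of "std_normal_quantile (1 - \<alpha> / 2)"]
    std_normal_cdf_quantile[of "1 - \<alpha> / 2"]
  by (simp add: two_sided_power_def)

text \<open>The derivative of the power in \<open>m\<close> vanishes at 0 because the density is
  even, while \<open>sinh (\<delta> * v)\<close> is of exact order \<delta>. This quotient is what
  remains of the Neyman-Pearson inequality after division by its leading weight.\<close>

lemma two_sided_power_locally_flat:
  assumes "0 < \<sigma>" "v \<noteq> 0" "c \<noteq> 0"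
  shows "((\<lambda>\<delta>. (two_sided_power v (c * \<delta>) \<sigma> - two_sided_power v 0 \<sigma>) / sinh (\<delta> * v)) \<longlongrightarrow> 0)
    (at_right 0)"
proof -
  have "((\<lambda>m. two_sided_power v m \<sigma>) has_real_derivative 0) (at 0)"
    using DERIV_two_sided_power[OF assms(1), of v 0] by (simp add: std_normal_density_def)
  then have "((\<lambda>\<delta>. two_sided_power v (c * \<delta>) \<sigma>) has_real_derivative 0) (at 0)"
    using DERIV_chain2[of "\<lambda>m. two_sided_power v m \<sigma>" 0 "\<lambda>\<delta>. c * \<delta>" 0 c]
    by (auto intro!: derivative_eq_intros)
  then have 1: "((\<lambda>\<delta>. (two_sided_power v (c * \<delta>) \<sigma> - two_sided_power v 0 \<sigma>) / \<delta>) \<longlongrightarrow> 0) (at 0)"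
    by (simp add: has_field_derivative_iff)
  have "((\<lambda>\<delta>. sinh (\<delta> * v)) has_real_derivative v) (at 0)"
    by (auto intro!: derivative_eq_intros)
  then have 2: "((\<lambda>\<delta>. sinh (\<delta> * v) / \<delta>) \<longlongrightarrow> v) (at 0)"
    by (simp add: has_field_derivative_iff)
  have "((\<lambda>\<delta>. ((two_sided_power v (c * \<delta>) \<sigma> - two_sided_power v 0 \<sigma>) / \<delta>) / (sinh (\<delta> * v) / \<delta>))
      \<longlongrightarrow> 0 / v) (at 0)"
    by (rule tendsto_divide[OF 1 2 assms(2)])
  then have "((\<lambda>\<delta>. ((two_sided_power v (c * \<delta>) \<sigma> - two_sided_power v 0 \<sigma>) / \<delta>) / (sinh (\<delta> * v) / \<delta>))
      \<longlongrightarrow> 0) (at_right 0)"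
    by (simp add: filterlim_at_split)
  then show ?thesis
    by (rule Lim_transform_eventually) (auto simp: eventually_at_filter)
qed

section \<open>The pointwise Neyman-Pearson inequality for two-sided tests\<close>

text \<open>
  The function \<open>x \<mapsto> sinh (\<delta> v) exp (s x) + sinh (s v) exp (- \<delta> x)\<close> is convex; the weights are chosen so that it takes the
  same value \<open>sinh ((s + \<delta>) v)\<close> at \<open>v\<close> and at \<open>-v\<close>.
\<close>

lemma two_sided_Neyman_Pearson_pointwise:
  fixes s \<delta> v x p :: real
  assumes "0 < s" "0 < \<delta>" "0 < v" "0 \<le> p" "p \<le> 1"
  shows "0 \<le> ((if v < \<bar>x\<bar> then 1 else 0) - p) *
    (sinh (\<delta> * v) * exp (s * x) + sinh (s * v) * exp (- \<delta> * x) - sinh ((s + \<delta>) * v))"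
proof -
  define F where "F x = sinh (\<delta> * v) * exp (s * x) + sinh (s * v) * exp (- \<delta> * x)" for x
  define K where "K = sinh ((s + \<delta>) * v)"
  have pos: "0 < sinh (\<delta> * v)" "0 < sinh (s * v)"
    using assms by simp_all
  have expc: "convex_on UNIV (\<lambda>x::real. exp (c * x))" for c
    by (rule f''_ge0_imp_convex[where f' = "\<lambda>x. c * exp (c * x)" and f'' = "\<lambda>x. c * c * exp (c * x)"])
      (auto intro!: derivative_eq_intros)
  have conv: "convex_on UNIV F"
    unfolding F_def using pos by (intro convex_on_add convex_on_cmul expc) auto
  \<comment> \<open>The addition formula for \<open>sinh\<close>: the mixed terms
    \<open>exp ((s - \<delta>) v)\<close>, or their reciprocals at \<open>- v\<close>,
    cancel.\<close>
  have Fv: "F v = K" "F (- v) = K"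
    unfolding F_def K_def sinh_def
    by (auto simp: field_simps simp flip: exp_add)
  have between: "F ((1 - t) * y + t * z) \<le> (1 - t) * F y + t * F z" if "0 \<le> t" "t \<le> 1" for t y z
    using convex_onD[OF conv that, of y z] by simp
  have inside: "F x \<le> K" if "\<bar>x\<bar> \<le> v"
  proof -
    define t where "t = (x + v) / (2 * v)"
    have t: "0 \<le> t" "t \<le> 1" "(1 - t) * (- v) + t * v = x"
      using that assms by (auto simp: t_def field_simps)
    have "F x \<le> (1 - t) * K + t * K"
      using between[OF t(1,2), of "- v" v] unfolding t(3) Fv .
    then show ?thesis by (simp add: algebra_simps)
  qed
  have outside: "K \<le> F x" if "v < \<bar>x\<bar>"
  proof -
    \<comment> \<open>The endpoint \<open>w\<close> nearer to \<open>x\<close> lies between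
      \<open>- w\<close> and \<open>x\<close>, and \<open>t\<close> is the weight of
      \<open>x\<close> in that convex combination. Convexity together with equal values at both
      endpoints then forces the value at \<open>x\<close> up.\<close>
    define w where "w = (if 0 < x then v else - v)"
    define t where "t = 2 * v / (\<bar>x\<bar> + v)"
    have t: "0 < t" "t \<le> 1"
      using that assms by (auto simp: t_def)
    have tx: "t * (\<bar>x\<bar> + v) = 2 * v"
      using that assms by (simp add: t_def)
    have "(1 - t) * (- w) + t * x = w"
      using tx that by (auto simp: w_def algebra_simps abs_if split: if_splits)
    moreover have "F w = K" "F (- w) = K"
      using Fv by (auto simp: w_def)
    ultimately have "K \<le> (1 - t) * K + t * F x"
      using between[of t "- w" x] t by simp
    then have "t * K \<le> t * F x" by (simp add: algebra_simps)
    then show ?thesis using t by simp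
  qed
  have "0 \<le> ((if v < \<bar>x\<bar> then 1 else 0) - p) * (F x - K)"
    using inside outside assms
    by (cases "v < \<bar>x\<bar>") (auto intro: mult_nonneg_nonneg mult_nonneg_nonpos)
  then show ?thesis
    by (simp add: F_def K_def)
qed

section \<open>Hellinger distance of product measures\<close>

text \<open>Product measures are determined by rectangles, and on rectangles the indicator
  factorizes, so the integral splits into one factor per coordinate.\<close>

lemma PiM_density:
  assumes "finite I" "sigma_finite_measure M" "sigma_finite_measure (density M f)"
    and [measurable]: "f \<in> borel_measurable M"
  shows "PiM I (\<lambda>_. density M f) = density (PiM I (\<lambda>_. M)) (\<lambda>\<omega>. \<Prod>i\<in>I. f (\<omega> i))"
proof -
  interpret D: product_sigma_finite "\<lambda>_. density M f"
    using assms by (simp add: product_sigma_finite_def)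
  interpret product_sigma_finite "\<lambda>_. M"
    using assms by (simp add: product_sigma_finite_def)
  show ?thesis
  proof (rule D.PiM_eqI[symmetric])
    show "sets (density (PiM I (\<lambda>_. M)) (\<lambda>\<omega>. \<Prod>i\<in>I. f (\<omega> i))) = sets (PiM I (\<lambda>_. density M f))"
      unfolding sets_density by (rule sets_PiM_cong) auto
    fix A assume "\<And>i. i \<in> I \<Longrightarrow> A i \<in> sets (density M f)"
    then have A [measurable]: "\<And>i. i \<in> I \<Longrightarrow> A i \<in> sets M" by simp
    have [measurable]: "Pi\<^sub>E I A \<in> sets (PiM I (\<lambda>_. M))"
      using assms(1) A by (intro sets_PiM_I_finite) auto
    have "emeasure (density (PiM I (\<lambda>_. M)) (\<lambda>\<omega>. \<Prod>i\<in>I. f (\<omega> i))) (Pi\<^sub>E I A)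
        = (\<integral>\<^sup>+\<omega>. (\<Prod>i\<in>I. f (\<omega> i)) * indicator (Pi\<^sub>E I A) \<omega> \<partial>PiM I (\<lambda>_. M))"
      by (rule emeasure_density) measurable
    also have "\<dots> = (\<integral>\<^sup>+\<omega>. (\<Prod>i\<in>I. f (\<omega> i) * indicator (A i) (\<omega> i)) \<partial>PiM I (\<lambda>_. M))"
    proof (rule nn_integral_cong)
      fix \<omega> assume "\<omega> \<in> space (PiM I (\<lambda>_. M))"
      then have "indicator (Pi\<^sub>E I A) \<omega> = (\<Prod>i\<in>I. indicator (A i) (\<omega> i) :: ennreal)"
        using assms(1)
        by (auto simp: space_PiM PiE_iff extensional_def prod_eq_1_iff indicator_def
            intro!: prod_zero)
      then show "(\<Prod>i\<in>I. f (\<omega> i)) * indicator (Pi\<^sub>E I A) \<omega> = (\<Prod>i\<in>I. f (\<omega> i) * indicator (A i) (\<omega> i))"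
        by (simp add: prod.distrib)
    qed
    also have "\<dots> = (\<Prod>i\<in>I. \<integral>\<^sup>+x. f x * indicator (A i) x \<partial>M)"
      using assms(1) A by (intro product_nn_integral_prod) auto
    also have "\<dots> = (\<Prod>i\<in>I. emeasure (density M f) (A i))"
      by (intro prod.cong refl) (simp add: emeasure_density)
    finally show "emeasure (density (PiM I (\<lambda>_. M)) (\<lambda>\<omega>. \<Prod>i\<in>I. f (\<omega> i))) (Pi\<^sub>E I A)
        = (\<Prod>i\<in>I. emeasure (density M f) (A i))" .
  qed (use assms in simp)
qed

lemma integral_PiM_density:
  fixes f :: "'a \<Rightarrow> real" and \<psi> :: "('i \<Rightarrow> 'a) \<Rightarrow> 'b::{banach, second_countable_topology}"
  assumes "finite I" "sigma_finite_measure M" "sigma_finite_measure (density M f)"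
    and f [measurable]: "f \<in> borel_measurable M" "\<And>x. 0 \<le> f x"
    and [measurable]: "\<psi> \<in> borel_measurable (PiM I (\<lambda>_. M))"
  shows "(\<integral>\<omega>. \<psi> \<omega> \<partial>PiM I (\<lambda>_. density M f)) = (\<integral>\<omega>. (\<Prod>i\<in>I. f (\<omega> i)) *\<^sub>R \<psi> \<omega> \<partial>PiM I (\<lambda>_. M))"
proof -
  have "PiM I (\<lambda>_. density M f) = density (PiM I (\<lambda>_. M)) (\<lambda>\<omega>. \<Prod>i\<in>I. f (\<omega> i))"
    using PiM_density[OF assms(1-3)] f(2) by (simp add: prod_ennreal)
  then show ?thesis
    by (simp only:) (rule integral_density, use f in \<open>auto intro!: prod_nonneg\<close>)
qed

text \<open>On the set where \<open>L\<close> is infinite both sides vanish: the left weight is 0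
  there, and \<open>enn2real\<close> sends infinity to 0. Elsewhere this is the defining identity of
  the density quotient. It isolates the part of \<open>Q\<close> that is absolutely continuous with
  respect to \<open>P\<close>.\<close>

lemma density_quotient_finite_part:
  assumes Q: "density_quotient Q P L" and sets_eq: "sets Q = sets P"
  shows "density Q (\<lambda>x. ennreal (if L x = \<infinity> then 0 else 1)) = density P (\<lambda>x. ennreal (enn2real (L x)))"
proof (rule measure_eqI)
  have [measurable]: "L \<in> borel_measurable P" "L \<in> borel_measurable Q"
    using Q measurable_cong_sets[OF sets_eq refl] by (auto simp: density_quotient_def)
  fix A assume "A \<in> sets (density Q (\<lambda>x. ennreal (if L x = \<infinity> then 0 else 1)))"
  then have [measurable]: "A \<in> sets Q" "A \<in> sets P" by (auto simp: sets_eq)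
  define B where "B = {x \<in> A. L x \<noteq> \<infinity>}"
  have "{x \<in> space P. x \<in> A \<and> L x \<noteq> \<infinity>} \<in> sets P" by measurable
  moreover have "{x \<in> space P. x \<in> A \<and> L x \<noteq> \<infinity>} = B"
    using sets.sets_into_space[OF \<open>A \<in> sets P\<close>] by (auto simp: B_def)
  ultimately have [measurable]: "B \<in> sets P" "B \<in> sets Q" by (auto simp: sets_eq)
  have "emeasure (density Q (\<lambda>x. ennreal (if L x = \<infinity> then 0 else 1))) A
      = (\<integral>\<^sup>+x. ennreal (if L x = \<infinity> then 0 else 1) * indicator A x \<partial>Q)"
    by (rule emeasure_density) measurable
  also have "\<dots> = (\<integral>\<^sup>+x. indicator B x \<partial>Q)"
    by (intro nn_integral_cong) (auto simp: B_def split: split_indicator)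
  also have "\<dots> = emeasure Q B" by simp
  also have "\<dots> = (\<integral>\<^sup>+x\<in>B. L x \<partial>P) + emeasure Q (B \<inter> {x. L x = \<infinity>})"
    using Q \<open>B \<in> sets P\<close> by (simp add: density_quotient_def)
  also have "B \<inter> {x. L x = \<infinity>} = {}" by (auto simp: B_def)
  also have "(\<integral>\<^sup>+x\<in>B. L x \<partial>P) = (\<integral>\<^sup>+x. ennreal (enn2real (L x)) * indicator A x \<partial>P)"
    by (intro nn_integral_cong)
      (auto simp: B_def ennreal_enn2real_if top.not_eq_extremum split: split_indicator)
  also have "\<dots> = emeasure (density P (\<lambda>x. ennreal (enn2real (L x)))) A"
    by (rule emeasure_density[symmetric]) measurable
  finally show "emeasure (density Q (\<lambda>x. ennreal (if L x = \<infinity> then 0 else 1))) A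
      = emeasure (density P (\<lambda>x. ennreal (enn2real (L x)))) A"
    by simp
qed (simp add: sets_eq)

lemma (in prob_space) product_Hellinger_bound:
  fixes q r :: "'a \<Rightarrow> real"
  assumes q: "q \<in> L2 M" "\<And>x. 0 \<le> q x" "(\<integral>x. (q x)\<^sup>2 \<partial>M) \<le> 1"
    and r: "r \<in> L2 M" "\<And>x. 0 \<le> r x" "(\<integral>x. (r x)\<^sup>2 \<partial>M) \<le> 1"
    and \<psi> [measurable]: "\<psi> \<in> borel_measurable (PiM {..<n} (\<lambda>_. M))"
    and \<psi>01: "\<And>\<omega>. \<omega> \<in> space (PiM {..<n} (\<lambda>_. M)) \<Longrightarrow> 0 \<le> \<psi> \<omega> \<and> \<psi> \<omega> \<le> 1"
  shows "\<bar>(\<integral>\<omega>. (\<Prod>i<n. (q (\<omega> i))\<^sup>2) * \<psi> \<omega> \<partial>PiM {..<n} (\<lambda>_. M))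
      - (\<integral>\<omega>. (\<Prod>i<n. (r (\<omega> i))\<^sup>2) * \<psi> \<omega> \<partial>PiM {..<n} (\<lambda>_. M))\<bar>
    \<le> 2 * sqrt (2 * real n * (1 - (\<integral>x. q x * r x \<partial>M)))"
proof -
  interpret product_prob_space "\<lambda>_. M" "{..<n}" ..
  let ?P = "PiM {..<n} (\<lambda>_. M)"
  define Q where "Q \<omega> = (\<Prod>i<n. q (\<omega> i))" for \<omega>
  define R where "R \<omega> = (\<Prod>i<n. r (\<omega> i))" for \<omega>
  define A where "A = (\<integral>x. q x * r x \<partial>M)"
  have [measurable]: "q \<in> borel_measurable M" "r \<in> borel_measurable M"
    using q r by (auto intro: L2_measurable)
  have meas [measurable]: "Q \<in> borel_measurable ?P" "R \<in> borel_measurable ?P"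
    unfolding Q_def R_def by measurable
  have Q2: "(Q \<omega>)\<^sup>2 = (\<Prod>i<n. (q (\<omega> i))\<^sup>2)" and R2: "(R \<omega>)\<^sup>2 = (\<Prod>i<n. (r (\<omega> i))\<^sup>2)"
    and QR: "Q \<omega> * R \<omega> = (\<Prod>i<n. q (\<omega> i) * r (\<omega> i))" for \<omega>
    by (simp_all add: Q_def R_def prod_power_distrib prod.distrib)
  have intQ: "integrable ?P (\<lambda>\<omega>. (Q \<omega>)\<^sup>2)" "(\<integral>\<omega>. (Q \<omega>)\<^sup>2 \<partial>?P) = (\<integral>x. (q x)\<^sup>2 \<partial>M) ^ n"
    unfolding Q2 using q
    by (subst product_integrable_prod product_integral_prod; simp add: L2_def)+
  have intR: "integrable ?P (\<lambda>\<omega>. (R \<omega>)\<^sup>2)" "(\<integral>\<omega>. (R \<omega>)\<^sup>2 \<partial>?P) = (\<integral>x. (r x)\<^sup>2 \<partial>M) ^ n"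
    unfolding R2 using r
    by (subst product_integrable_prod product_integral_prod; simp add: L2_def)+
  have intQR: "(\<integral>\<omega>. Q \<omega> * R \<omega> \<partial>?P) = A ^ n"
    unfolding QR A_def using L2_integrable_mult[OF q(1) r(1)]
    by (subst product_integral_prod) simp_all
  have L2Q: "Q \<in> L2 ?P" and L2R: "R \<in> L2 ?P"
    using intQ intR meas by (simp_all add: L2_def)
  have nonneg: "0 \<le> Q \<omega>" "0 \<le> R \<omega>" for \<omega>
    using q r by (auto simp: Q_def R_def intro: prod_nonneg)
  have A0: "0 \<le> A"
    unfolding A_def using q r by simp
  have le1: "(\<integral>\<omega>. (Q \<omega>)\<^sup>2 \<partial>?P) \<le> 1" "(\<integral>\<omega>. (R \<omega>)\<^sup>2 \<partial>?P) \<le> 1"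
    unfolding intQ intR using q r by (auto intro!: power_le_one)
  have diff: "(L2_norm ?P (\<lambda>\<omega>. \<bar>Q \<omega> - R \<omega>\<bar>))\<^sup>2 \<le> 2 * real n * (1 - A)"
  proof -
    have "(L2_norm ?P (\<lambda>\<omega>. \<bar>Q \<omega> - R \<omega>\<bar>))\<^sup>2 = (\<integral>\<omega>. (Q \<omega> + (- R \<omega>))\<^sup>2 \<partial>?P)"
      unfolding L2_norm_power2 by simp
    also have "\<dots> = (\<integral>\<omega>. (Q \<omega>)\<^sup>2 \<partial>?P) + 2 * (\<integral>\<omega>. Q \<omega> * (- R \<omega>) \<partial>?P) + (\<integral>\<omega>. (- R \<omega>)\<^sup>2 \<partial>?P)"
      by (rule L2_integral_square_add) (use L2Q L2_cmult[OF L2R, of "-1"] in auto)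
    also have "\<dots> \<le> 2 - 2 * A ^ n"
      using le1 intQR by simp
    also have "\<dots> \<le> 2 * real n * (1 - A)"
      using Bernoulli_inequality[of "A - 1" n] A0 by (simp add: algebra_simps)
    finally show ?thesis .
  qed
  \<comment> \<open>The square of \<open>Q + R\<close> is at most twice the sum of the two squares,
    each of integral at most 1.\<close>
  have sum: "(L2_norm ?P (\<lambda>\<omega>. (Q \<omega> + R \<omega>) * \<psi> \<omega>))\<^sup>2 \<le> 4"
  proof -
    have "(L2_norm ?P (\<lambda>\<omega>. (Q \<omega> + R \<omega>) * \<psi> \<omega>))\<^sup>2 \<le> (\<integral>\<omega>. 2 * (Q \<omega>)\<^sup>2 + 2 * (R \<omega>)\<^sup>2 \<partial>?P)"
      unfolding L2_norm_power2
    proof (rule integral_mono')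
      show "integrable ?P (\<lambda>\<omega>. 2 * (Q \<omega>)\<^sup>2 + 2 * (R \<omega>)\<^sup>2)"
        using intQ intR by simp
      fix \<omega> assume "\<omega> \<in> space ?P"
      then have "(\<psi> \<omega>)\<^sup>2 \<le> 1"
        using \<psi>01 by (simp add: power_le_one)
      then have "((Q \<omega> + R \<omega>) * \<psi> \<omega>)\<^sup>2 \<le> (Q \<omega> + R \<omega>)\<^sup>2"
        unfolding power_mult_distrib by (intro mult_left_le) auto
      also have "\<dots> \<le> 2 * (Q \<omega>)\<^sup>2 + 2 * (R \<omega>)\<^sup>2"
        using sum_squares_bound[of "Q \<omega>" "R \<omega>"] by (simp add: power2_sum)
      finally show "((Q \<omega> + R \<omega>) * \<psi> \<omega>)\<^sup>2 \<le> 2 * (Q \<omega>)\<^sup>2 + 2 * (R \<omega>)\<^sup>2" .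
    qed simp
    also have "\<dots> \<le> 4"
      using intQ(1) intR(1) le1 by simp
    finally show ?thesis .
  qed
  have bounded_mult: "integrable ?P (\<lambda>\<omega>. f \<omega> * \<psi> \<omega>)" if "integrable ?P f" for f
  proof (rule Bochner_Integration.integrable_bound[OF that])
    show "(\<lambda>\<omega>. f \<omega> * \<psi> \<omega>) \<in> borel_measurable ?P"
      using that by measurable
    show "AE \<omega> in ?P. norm (f \<omega> * \<psi> \<omega>) \<le> norm (f \<omega>)"
      using \<psi>01 by (auto simp: abs_mult intro!: mult_left_le)
  qed
  have L2D: "(\<lambda>\<omega>. \<bar>Q \<omega> - R \<omega>\<bar>) \<in> L2 ?P"
    using L2_diff[OF L2Q L2R] by (auto simp: L2_def)
  have L2S: "(\<lambda>\<omega>. (Q \<omega> + R \<omega>) * \<psi> \<omega>) \<in> L2 ?P"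
  proof -
    have "integrable ?P (\<lambda>\<omega>. ((Q \<omega> + R \<omega>)\<^sup>2 * \<psi> \<omega>) * \<psi> \<omega>)"
      using L2_add[OF L2Q L2R] by (intro bounded_mult) (simp add: L2_def)
    then show ?thesis
      using meas by (auto simp: L2_def power_mult_distrib power2_eq_square[of "\<psi> _"] mult.assoc)
  qed
  have "\<bar>(\<integral>\<omega>. (Q \<omega>)\<^sup>2 * \<psi> \<omega> \<partial>?P) - (\<integral>\<omega>. (R \<omega>)\<^sup>2 * \<psi> \<omega> \<partial>?P)\<bar>
      = \<bar>\<integral>\<omega>. (Q \<omega> - R \<omega>) * ((Q \<omega> + R \<omega>) * \<psi> \<omega>) \<partial>?P\<bar>"
    using bounded_mult[OF intQ(1)] bounded_mult[OF intR(1)]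
    by (simp flip: Bochner_Integration.integral_diff add: power2_eq_square algebra_simps)
  also have "\<dots> \<le> (\<integral>\<omega>. \<bar>(Q \<omega> - R \<omega>) * ((Q \<omega> + R \<omega>) * \<psi> \<omega>)\<bar> \<partial>?P)"
    using integral_norm_bound[of ?P "\<lambda>\<omega>. (Q \<omega> - R \<omega>) * ((Q \<omega> + R \<omega>) * \<psi> \<omega>)"] by simp
  also have "\<dots> = (\<integral>\<omega>. \<bar>Q \<omega> - R \<omega>\<bar> * ((Q \<omega> + R \<omega>) * \<psi> \<omega>) \<partial>?P)"
    using nonneg \<psi>01 by (intro Bochner_Integration.integral_cong) (auto simp: abs_mult)
  also have "\<dots> \<le> \<bar>\<integral>\<omega>. \<bar>Q \<omega> - R \<omega>\<bar> * ((Q \<omega> + R \<omega>) * \<psi> \<omega>) \<partial>?P\<bar>" by simp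
  also have "\<dots> \<le> L2_norm ?P (\<lambda>\<omega>. \<bar>Q \<omega> - R \<omega>\<bar>) * L2_norm ?P (\<lambda>\<omega>. (Q \<omega> + R \<omega>) * \<psi> \<omega>)"
    by (rule L2_Cauchy_Schwarz[OF L2D L2S])
  also have "\<dots> \<le> sqrt (2 * real n * (1 - A)) * 2"
  proof (rule mult_mono)
    show "L2_norm ?P (\<lambda>\<omega>. \<bar>Q \<omega> - R \<omega>\<bar>) \<le> sqrt (2 * real n * (1 - A))"
      using diff by (rule real_le_rsqrt)
    then show "0 \<le> sqrt (2 * real n * (1 - A))"
      using L2_norm_nonneg by (rule order_trans[rotated])
    show "L2_norm ?P (\<lambda>\<omega>. (Q \<omega> + R \<omega>) * \<psi> \<omega>) \<le> 2"
      by (rule power2_le_imp_le) (use sum in simp_all)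
  qed (rule L2_norm_nonneg)
  finally show ?thesis
    unfolding Q2 R2 A_def by linarith
qed

lemma integral_finite_part:
  assumes "prob_space Q" and [measurable]: "L \<in> borel_measurable Q"
  shows "(\<integral>x. (if L x = (\<infinity>::ennreal) then 0 else 1 :: real) \<partial>Q) = 1 - measure Q {x \<in> space Q. L x = \<infinity>}"
proof -
  interpret prob_space Q by fact
  have "(\<integral>x. (if L x = \<infinity> then 0 else 1 :: real) \<partial>Q) = (\<integral>x. indicator (space Q - {x \<in> space Q. L x = \<infinity>}) x \<partial>Q)"
    by (intro Bochner_Integration.integral_cong) auto
  also have "\<dots> = 1 - measure Q {x \<in> space Q. L x = \<infinity>}"
    by (simp add: prob_compl)
  finally show ?thesis .
qed

lemma density_quotient_root:
  assumes P: "prob_space P" and Q: "prob_space Q" and sets_eq: "sets Q = sets P"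
    and L: "density_quotient Q P L"
  shows "(\<lambda>x. sqrt (enn2real (L x))) \<in> L2 P"
    and "(\<integral>x. (sqrt (enn2real (L x)))\<^sup>2 \<partial>P) = 1 - measure Q {x \<in> space Q. L x = \<infinity>}"
proof -
  interpret P: prob_space P by fact
  interpret Q: prob_space Q by fact
  define s where "s = measure Q {x \<in> space Q. L x = \<infinity>}"
  define q where "q x = sqrt (enn2real (L x))" for x
  define e where "e x = (if L x = \<infinity> then 0 else 1 :: real)" for x
  have q2: "(q x)\<^sup>2 = enn2real (L x)" for x by (simp add: q_def)
  have [measurable]: "L \<in> borel_measurable P" "L \<in> borel_measurable Q"
    using L measurable_cong_sets[OF sets_eq refl] by (auto simp: density_quotient_def)
  have [measurable]: "e \<in> borel_measurable Q"
    unfolding e_def by measurable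
  have dens: "density Q e = density P (\<lambda>x. (q x)\<^sup>2)"
    using density_quotient_finite_part[OF L sets_eq] by (simp add: e_def q2)
  have nn: "(\<integral>\<^sup>+x. ennreal ((q x)\<^sup>2) \<partial>P) = ennreal (1 - s)"
  proof -
    have "(\<integral>\<^sup>+x. ennreal ((q x)\<^sup>2) \<partial>P) = emeasure (density P (\<lambda>x. (q x)\<^sup>2)) (space P)"
      by (subst emeasure_density) (auto simp: q2 intro!: nn_integral_cong)
    also have "\<dots> = emeasure (density Q e) (space Q)"
      by (simp add: dens sets_eq_imp_space_eq[OF sets_eq])
    also have "\<dots> = (\<integral>\<^sup>+x. ennreal (e x) \<partial>Q)"
      by (subst emeasure_density) (auto intro!: nn_integral_cong)
    also have "\<dots> = ennreal (\<integral>x. e x \<partial>Q)"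
      by (rule nn_integral_eq_integral) (auto intro!: Q.integrable_const_bound[where B = 1] simp: e_def)
    also have "(\<integral>x. e x \<partial>Q) = 1 - s"
      unfolding e_def s_def by (rule integral_finite_part[OF Q]) measurable
    finally show ?thesis .
  qed
  have s1: "s \<le> 1" by (simp add: s_def)
  have int_q: "integrable P (\<lambda>x. (q x)\<^sup>2)"
    using nn by (intro integrableI_nonneg) (auto simp: q_def)
  then show "(\<lambda>x. sqrt (enn2real (L x))) \<in> L2 P"
    unfolding L2_def q_def by simp
  have "(\<integral>x. (q x)\<^sup>2 \<partial>P) = 1 - s"
    using nn s1 by (subst integral_eq_nn_integral) (auto simp: q_def)
  then show "(\<integral>x. (sqrt (enn2real (L x)))\<^sup>2 \<partial>P) = 1 - measure Q {x \<in> space Q. L x = \<infinity>}"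
    unfolding q_def s_def .
qed

text \<open>Two errors add up. Discarding the singular part costs at most the probability that some
  coordinate falls into it, hence \<open>n s\<close>; the remaining absolutely continuous product is
  compared with the target by the Hellinger bound.\<close>

lemma test_power_diff_le:
  fixes r :: "'a \<Rightarrow> real"
  assumes P: "prob_space P" and Q: "prob_space Q" and sets_eq: "sets Q = sets P"
    and L: "density_quotient Q P L"
    and r: "r \<in> L2 P" "\<And>x. 0 \<le> r x" "(\<integral>x. (r x)\<^sup>2 \<partial>P) = 1"
    and \<psi>: "\<psi> \<in> borel_measurable (PiM {..<n} (\<lambda>_. P))"
    and \<psi>01: "\<And>\<omega>. \<omega> \<in> space (PiM {..<n} (\<lambda>_. P)) \<Longrightarrow> 0 \<le> \<psi> \<omega> \<and> \<psi> \<omega> \<le> 1"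
  defines "s \<equiv> measure Q {x \<in> space Q. L x = \<infinity>}"
  shows "\<bar>(\<integral>\<omega>. \<psi> \<omega> \<partial>PiM {..<n} (\<lambda>_. Q)) - (\<integral>\<omega>. \<psi> \<omega> \<partial>PiM {..<n} (\<lambda>_. density P (\<lambda>x. (r x)\<^sup>2)))\<bar>
    \<le> real n * s + 2 * sqrt (real n * (s + (\<integral>x. (sqrt (enn2real (L x)) - r x)\<^sup>2 \<partial>P)))"
proof -
  interpret P: prob_space P by fact
  interpret Q: prob_space Q by fact
  interpret PP: product_prob_space "\<lambda>_. P" "{..<n}" ..
  interpret QQ: product_prob_space "\<lambda>_. Q" "{..<n}" ..
  define q where "q x = sqrt (enn2real (L x))" for x
  define e where "e x = (if L x = \<infinity> then 0 else 1 :: real)" for x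
  have e01: "0 \<le> e x" "e x \<le> 1" for x by (auto simp: e_def)
  have q_nonneg: "0 \<le> q x" for x by (simp add: q_def)
  have q2: "(q x)\<^sup>2 = enn2real (L x)" for x by (simp add: q_def)
  have [measurable]: "L \<in> borel_measurable P" "L \<in> borel_measurable Q"
    using L measurable_cong_sets[OF sets_eq refl] by (auto simp: density_quotient_def)
  have [measurable]: "e \<in> borel_measurable Q"
    unfolding e_def by measurable
  have sets_prod: "sets (PiM {..<n} (\<lambda>_. Q)) = sets (PiM {..<n} (\<lambda>_. P))"
    by (intro sets_PiM_cong refl sets_eq)
  note space_prod = sets_eq_imp_space_eq[OF sets_prod]
  note [measurable] = \<psi>
  have \<psi>Q [measurable]: "\<psi> \<in> borel_measurable (PiM {..<n} (\<lambda>_. Q))"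
    using \<psi> measurable_cong_sets[OF sets_prod refl] by blast
  have dens: "density Q e = density P (\<lambda>x. (q x)\<^sup>2)"
    using density_quotient_finite_part[OF L sets_eq] by (simp add: e_def q2)
  have sf: "sigma_finite_measure (density Q e)"
  proof -
    have "emeasure (density Q e) (space Q) = (\<integral>\<^sup>+x. ennreal (e x) \<partial>Q)"
      by (subst emeasure_density) (auto intro!: nn_integral_cong)
    also have "\<dots> \<le> (\<integral>\<^sup>+x. 1 \<partial>Q)"
      by (rule nn_integral_mono) (auto simp: e_def)
    finally have "finite_measure (density Q e)"
      by (intro finite_measureI) (auto simp: Q.emeasure_space_1 top_unique)
    then show ?thesis by (rule finite_measure.axioms)
  qed
  have int_e: "(\<integral>x. e x \<partial>Q) = 1 - s"
    unfolding e_def s_def by (rule integral_finite_part[OF Q]) measurable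
  have s1: "0 \<le> s" "s \<le> 1" by (auto simp: s_def)
  have qL2: "q \<in> L2 P" and q_eq: "(\<integral>x. (q x)\<^sup>2 \<partial>P) = 1 - s"
    using density_quotient_root[OF P Q sets_eq L] unfolding q_def[abs_def] s_def .
  have 1: "(\<integral>\<omega>. (\<Prod>i<n. (q (\<omega> i))\<^sup>2) * \<psi> \<omega> \<partial>PiM {..<n} (\<lambda>_. P))
      = (\<integral>\<omega>. (\<Prod>i<n. e (\<omega> i)) * \<psi> \<omega> \<partial>PiM {..<n} (\<lambda>_. Q))"
  proof -
    have "(\<integral>\<omega>. (\<Prod>i<n. (q (\<omega> i))\<^sup>2) *\<^sub>R \<psi> \<omega> \<partial>PiM {..<n} (\<lambda>_. P))
      = (\<integral>\<omega>. \<psi> \<omega> \<partial>PiM {..<n} (\<lambda>_. density P (\<lambda>x. (q x)\<^sup>2)))"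
      by (rule integral_PiM_density[symmetric, OF _ P.sigma_finite_measure_axioms sf[unfolded dens]])
        (simp_all add: q2)
    also have "\<dots> = (\<integral>\<omega>. (\<Prod>i<n. e (\<omega> i)) *\<^sub>R \<psi> \<omega> \<partial>PiM {..<n} (\<lambda>_. Q))"
      unfolding dens[symmetric]
      by (rule integral_PiM_density[OF _ Q.sigma_finite_measure_axioms sf]) (simp_all add: e01)
    finally show ?thesis by simp
  qed
  have e_prod: "0 \<le> (\<Prod>i<n. e (\<omega> i))" "(\<Prod>i<n. e (\<omega> i)) \<le> 1" for \<omega>
    by (auto intro!: prod_nonneg prod_le_1 simp: e01)
  have int_\<psi>: "integrable (PiM {..<n} (\<lambda>_. Q)) \<psi>"
    using \<psi>01 by (intro QQ.P.integrable_const_bound[where B = 1]) (auto simp: space_prod)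
  have int_eprod: "integrable (PiM {..<n} (\<lambda>_. Q)) (\<lambda>\<omega>. \<Prod>i<n. e (\<omega> i))"
    using e_prod by (intro QQ.P.integrable_const_bound[where B = 1]) auto
  have int_e\<psi>: "integrable (PiM {..<n} (\<lambda>_. Q)) (\<lambda>\<omega>. (\<Prod>i<n. e (\<omega> i)) * \<psi> \<omega>)"
    using e_prod \<psi>01 by (intro QQ.P.integrable_const_bound[where B = 1])
      (auto simp: space_prod abs_mult intro!: mult_le_one)
  \<comment> \<open>The product of the \<open>e (\<omega> i)\<close> indicates that no coordinate
    meets the singular set; its expectation is \<open>(1 - s) ^ n\<close>.\<close>
  have 2: "\<bar>(\<integral>\<omega>. \<psi> \<omega> \<partial>PiM {..<n} (\<lambda>_. Q)) - (\<integral>\<omega>. (\<Prod>i<n. e (\<omega> i)) * \<psi> \<omega> \<partial>PiM {..<n} (\<lambda>_. Q))\<bar>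
      \<le> real n * s"
  proof -
    have eq: "(\<integral>\<omega>. \<psi> \<omega> \<partial>PiM {..<n} (\<lambda>_. Q)) - (\<integral>\<omega>. (\<Prod>i<n. e (\<omega> i)) * \<psi> \<omega> \<partial>PiM {..<n} (\<lambda>_. Q))
      = (\<integral>\<omega>. (1 - (\<Prod>i<n. e (\<omega> i))) * \<psi> \<omega> \<partial>PiM {..<n} (\<lambda>_. Q))"
      using int_\<psi> int_e\<psi> by (simp flip: Bochner_Integration.integral_diff add: algebra_simps)
    have "0 \<le> (\<integral>\<omega>. (1 - (\<Prod>i<n. e (\<omega> i))) * \<psi> \<omega> \<partial>PiM {..<n} (\<lambda>_. Q))"
      using e_prod \<psi>01 by (intro Bochner_Integration.integral_nonneg_AE) (auto simp: space_prod)
    moreover have "(\<integral>\<omega>. (1 - (\<Prod>i<n. e (\<omega> i))) * \<psi> \<omega> \<partial>PiM {..<n} (\<lambda>_. Q))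
        \<le> (\<integral>\<omega>. 1 - (\<Prod>i<n. e (\<omega> i)) \<partial>PiM {..<n} (\<lambda>_. Q))"
      using e_prod \<psi>01 int_eprod
      by (intro integral_mono') (auto simp: space_prod intro!: mult_left_le)
    moreover have "(\<integral>\<omega>. 1 - (\<Prod>i<n. e (\<omega> i)) \<partial>PiM {..<n} (\<lambda>_. Q)) = 1 - (1 - s) ^ n"
    proof -
      have "(\<integral>\<omega>. (\<Prod>i<n. e (\<omega> i)) \<partial>PiM {..<n} (\<lambda>_. Q)) = (1 - s) ^ n"
        by (subst QQ.product_integral_prod)
          (auto intro!: Q.integrable_const_bound[where B = 1] simp: e01 int_e)
      then show ?thesis
        using int_eprod by (simp add: QQ.P.prob_space)
    qed
    moreover have "1 - (1 - s) ^ n \<le> real n * s"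
      using Bernoulli_inequality[of "- s" n] s1 by simp
    ultimately show ?thesis unfolding eq by linarith
  qed
  have [measurable]: "r \<in> borel_measurable P"
    using r(1) by (rule L2_measurable)
  have 3: "(\<integral>\<omega>. \<psi> \<omega> \<partial>PiM {..<n} (\<lambda>_. density P (\<lambda>x. (r x)\<^sup>2)))
      = (\<integral>\<omega>. (\<Prod>i<n. (r (\<omega> i))\<^sup>2) * \<psi> \<omega> \<partial>PiM {..<n} (\<lambda>_. P))"
  proof -
    have "emeasure (density P (\<lambda>x. (r x)\<^sup>2)) (space P) = (\<integral>\<^sup>+x. ennreal ((r x)\<^sup>2) \<partial>P)"
      by (subst emeasure_density) (auto intro!: nn_integral_cong)
    also have "\<dots> = 1"
      using r by (subst nn_integral_eq_integral) (auto simp: L2_def)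
    finally have "prob_space (density P (\<lambda>x. (r x)\<^sup>2))"
      by (intro prob_spaceI) simp
    then have "sigma_finite_measure (density P (\<lambda>x. (r x)\<^sup>2))"
      by (simp add: prob_space_imp_sigma_finite)
    then show ?thesis
      by (subst integral_PiM_density) (auto simp: P.sigma_finite_measure_axioms)
  qed
  \<comment> \<open>Converts the affinity into a squared distance of roots; the extra
    \<open>s\<close> appears because the square of \<open>q\<close> integrates only to
    \<open>1 - s\<close>.\<close>
  have 4: "2 * (1 - (\<integral>x. q x * r x \<partial>P)) = s + (\<integral>x. (q x - r x)\<^sup>2 \<partial>P)"
    using L2_integral_square_add[of q P "\<lambda>x. - r x"] qL2 L2_cmult[OF r(1), of "-1"] q_eq r(3)
    by simp
  have 5: "\<bar>(\<integral>\<omega>. (\<Prod>i<n. (q (\<omega> i))\<^sup>2) * \<psi> \<omega> \<partial>PiM {..<n} (\<lambda>_. P))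
      - (\<integral>\<omega>. (\<Prod>i<n. (r (\<omega> i))\<^sup>2) * \<psi> \<omega> \<partial>PiM {..<n} (\<lambda>_. P))\<bar>
    \<le> 2 * sqrt (2 * real n * (1 - (\<integral>x. q x * r x \<partial>P)))"
    using qL2 q_eq s1 r \<psi>01 by (intro P.product_Hellinger_bound) (simp_all add: q_nonneg)
  have "2 * real n * (1 - (\<integral>x. q x * r x \<partial>P)) = real n * (s + (\<integral>x. (q x - r x)\<^sup>2 \<partial>P))"
    by (simp only: 4[symmetric] ac_simps)
  note 5 = 5[unfolded this]
  have "\<bar>(\<integral>\<omega>. \<psi> \<omega> \<partial>PiM {..<n} (\<lambda>_. Q)) - (\<integral>\<omega>. \<psi> \<omega> \<partial>PiM {..<n} (\<lambda>_. density P (\<lambda>x. (r x)\<^sup>2)))\<bar>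
    \<le> real n * s + 2 * sqrt (real n * (s + (\<integral>x. (q x - r x)\<^sup>2 \<partial>P)))"
    using 2 5 unfolding 1 3 by linarith
  then show "\<bar>(\<integral>\<omega>. \<psi> \<omega> \<partial>PiM {..<n} (\<lambda>_. Q)) - (\<integral>\<omega>. \<psi> \<omega> \<partial>PiM {..<n} (\<lambda>_. density P (\<lambda>x. (r x)\<^sup>2)))\<bar>
    \<le> real n * s + 2 * sqrt (real n * (s + (\<integral>x. (sqrt (enn2real (L x)) - r x)\<^sup>2 \<partial>P)))"
    unfolding q_def .
qed

section \<open>Exponential tilts\<close>

lemma inverse_sqrt_tendsto_0: "(\<lambda>n. 1 / sqrt (real n)) \<longlonglongrightarrow> 0"
  by (intro tendsto_divide_0[OF tendsto_const] filterlim_at_top_imp_at_infinity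
      filterlim_compose[OF sqrt_at_top filterlim_real_sequentially])

text \<open>Complex logarithms are needed because the lemma is applied to characteristic functions.
  The Caratheodory form of the derivative of \<open>Ln\<close> at 1 gives
  \<open>Ln z = h z * (z - 1)\<close> with \<open>h\<close> continuous at 1 and equal to 1 there, so
  \<open>n * Ln (a n)\<close> has the limit \<open>L\<close>.\<close>

lemma tendsto_power_exp:
  fixes a :: "nat \<Rightarrow> complex"
  assumes "(\<lambda>n. of_nat n * (a n - 1)) \<longlonglongrightarrow> L"
  shows "(\<lambda>n. a n ^ n) \<longlonglongrightarrow> exp L"
proof -
  have "(\<lambda>n. of_nat n * (a n - 1) * (1 / of_nat n)) \<longlonglongrightarrow> L * 0"
    by (intro tendsto_mult assms lim_1_over_n)
  then have "(\<lambda>n. a n - 1) \<longlonglongrightarrow> 0"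
    unfolding mult_zero_right
    by (rule Lim_transform_eventually, intro eventually_mono[OF eventually_gt_at_top[of 0]]) simp
  then have a1: "a \<longlonglongrightarrow> 1"
    by (rule LIM_zero_cancel)
  have "(Ln has_field_derivative 1) (at 1)"
    using has_field_derivative_Ln[of 1] by simp
  then obtain h where h: "\<And>z. Ln z - Ln 1 = h z * (z - 1)" "isCont h 1" "h 1 = 1"
    unfolding CARAT_DERIV by blast
  have "(\<lambda>n. h (a n) * (of_nat n * (a n - 1))) \<longlonglongrightarrow> h 1 * L"
    using h(2) a1 by (intro tendsto_mult assms isCont_tendsto_compose[of 1 h])
  moreover have "h (a n) * (of_nat n * (a n - 1)) = of_nat n * Ln (a n)" for n
    using h(1)[of "a n"] by (simp add: ac_simps)
  ultimately have "(\<lambda>n. exp (of_nat n * Ln (a n))) \<longlonglongrightarrow> exp L"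
    using h(3) by (simp add: tendsto_exp)
  moreover have "\<forall>\<^sub>F n in sequentially. exp (of_nat n * Ln (a n)) = a n ^ n"
    using tendsto_imp_eventually_ne[OF a1 one_neq_zero]
    by eventually_elim (simp add: exp_of_nat_mult)
  ultimately show ?thesis
    by (rule Lim_transform_eventually)
qed

text \<open>Second-order Taylor expansion under the integral. Only the real part of \<open>z\<close>
  has to be bounded, since it alone determines the modulus of the exponential. So the lemma covers
  both the normalizing constant, \<open>z = g\<close>, and the characteristic function,
  \<open>z = g + \<i> u w\<close> with \<open>w\<close> possibly unbounded.\<close>

lemma (in prob_space) exp_root_expansion:
  fixes z :: "'a \<Rightarrow> complex"
  assumes [measurable]: "z \<in> borel_measurable M"
    and B: "\<And>x. \<bar>Re (z x)\<bar> \<le> B"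
    and z2: "integrable M (\<lambda>x. (norm (z x))\<^sup>2)"
    and z0: "(\<integral>x. z x \<partial>M) = 0"
  shows "(\<lambda>n. of_nat n * ((\<integral>x. exp (z x / sqrt (real n)) \<partial>M) - 1)) \<longlonglongrightarrow> (\<integral>x. (z x)\<^sup>2 \<partial>M) / 2"
proof -
  define f where "f n x = of_nat n * (exp (z x / sqrt (real n)) - 1 - z x / sqrt (real n))" for n :: nat and x
  have zint: "integrable M z"
    using L2_integrable[of "\<lambda>x. norm (z x)"] z2
    by (auto simp: L2_def integrable_norm_iff)
  have Re_le: "exp \<bar>Re (z x / sqrt (real n))\<bar> \<le> exp B" if "0 < n" for n x
  proof -
    have "\<bar>Re (z x / sqrt (real n))\<bar> = \<bar>Re (z x)\<bar> / sqrt (real n)"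
      by (simp add: abs_divide)
    also have "\<dots> \<le> \<bar>Re (z x)\<bar>"
      using that mult_left_mono[of 1 "sqrt (real n)" "\<bar>Re (z x)\<bar>"] by (simp add: divide_le_eq)
    finally show ?thesis using B[of x] by simp
  qed
  have eint: "integrable M (\<lambda>x. exp (z x / sqrt (real n)))" if "0 < n" for n
  proof (rule integrable_const_bound[where B = "exp B"])
    have "norm (exp (z x / sqrt (real n))) \<le> exp B" for x
    proof -
      have "norm (exp (z x / sqrt (real n))) \<le> exp \<bar>Re (z x / sqrt (real n))\<bar>"
        unfolding norm_exp_eq_Re exp_le_cancel_iff by (rule abs_ge_self)
      then show ?thesis using Re_le[OF that, of x] by (rule order_trans)
    qed
    then show "AE x in M. norm (exp (z x / sqrt (real n))) \<le> exp B" by simp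
  qed measurable
  have norm_div: "norm (z x / sqrt (real n)) = norm (z x) / sqrt (real n)" for n x
    by (simp add: norm_divide)
  have bound: "norm (f n x) \<le> exp B * (norm (z x))\<^sup>2" if "0 < n" for n x
  proof -
    have "norm (exp (z x / sqrt (real n)) - 1 - z x / sqrt (real n))
        \<le> exp \<bar>Re (z x / sqrt (real n))\<bar> * (norm (z x / sqrt (real n)))\<^sup>2"
      using Taylor_exp[of "z x / sqrt (real n)" 1] by (simp add: numeral_2_eq_2 diff_diff_eq)
    also have "\<dots> \<le> exp B * (norm (z x / sqrt (real n)))\<^sup>2"
      by (intro mult_right_mono Re_le that) simp
    finally have "real n * norm (exp (z x / sqrt (real n)) - 1 - z x / sqrt (real n))
        \<le> real n * (exp B * (norm (z x / sqrt (real n)))\<^sup>2)"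
      by (rule mult_left_mono) simp
    then show ?thesis
      using that unfolding f_def norm_div norm_mult by (simp add: power_divide)
  qed
  have pointwise: "(\<lambda>n. f n x) \<longlonglongrightarrow> (z x)\<^sup>2 / 2" for x
  proof -
    have le: "norm (f n x - (z x)\<^sup>2 / 2) \<le> exp B * norm (z x) ^ 3 / sqrt (real n)" if "0 < n" for n
    proof -
      let ?w = "z x / sqrt (real n)"
      have "norm (exp ?w - 1 - ?w - ?w\<^sup>2 / 2) \<le> exp \<bar>Re ?w\<bar> * norm ?w ^ 3 / 2"
        using Taylor_exp[of ?w 2] by (simp add: numeral_3_eq_3 numeral_2_eq_2 diff_diff_eq add.assoc)
      also have "\<dots> \<le> exp B * norm ?w ^ 3"
        using mult_right_mono[OF Re_le[OF that, of x], of "norm ?w ^ 3"]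
          zero_le_power[OF norm_ge_zero[of ?w], of 3]
        by (smt (verit, best) exp_ge_zero field_sum_of_halves mult_nonneg_nonneg)
      finally have "real n * norm (exp ?w - 1 - ?w - ?w\<^sup>2 / 2) \<le> real n * (exp B * norm ?w ^ 3)"
        by (rule mult_left_mono) simp
      also have "real n * (exp B * norm ?w ^ 3) = exp B * norm (z x) ^ 3 / sqrt (real n)"
        using that unfolding norm_div by (simp add: power_divide power3_eq_cube field_simps)
      also have "real n * norm (exp ?w - 1 - ?w - ?w\<^sup>2 / 2) = norm (of_nat n * (exp ?w - 1 - ?w - ?w\<^sup>2 / 2))"
        by (simp add: norm_mult)
      also have "of_nat n * (exp ?w - 1 - ?w - ?w\<^sup>2 / 2) = f n x - (z x)\<^sup>2 / 2"
        using that by (simp add: f_def algebra_simps power_divide flip: of_real_power)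
      finally show ?thesis .
    qed
    have "(\<lambda>n. exp B * norm (z x) ^ 3 / sqrt (real n)) \<longlonglongrightarrow> 0"
      by (intro tendsto_divide_0[OF tendsto_const] filterlim_at_top_imp_at_infinity
          filterlim_compose[OF sqrt_at_top filterlim_real_sequentially])
    then have "(\<lambda>n. f n x - (z x)\<^sup>2 / 2) \<longlonglongrightarrow> 0"
      by (rule Lim_null_comparison[rotated])
        (auto intro!: eventually_mono[OF eventually_gt_at_top[of 0]] le)
    then show ?thesis by (rule LIM_zero_cancel)
  qed
  have [measurable]: "f n \<in> borel_measurable M" for n
    unfolding f_def by measurable
  \<comment> \<open>The dominating bound was derived for positive \<open>n\<close>, where
    \<open>sqrt (real n)\<close> is at least 1; hence the shift of the index.\<close>
  have "(\<lambda>n. \<integral>x. f (Suc n) x \<partial>M) \<longlonglongrightarrow> (\<integral>x. (z x)\<^sup>2 / 2 \<partial>M)"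
  proof (rule integral_dominated_convergence[where w = "\<lambda>x. exp B * (norm (z x))\<^sup>2"])
    show "AE x in M. (\<lambda>n. f (Suc n) x) \<longlonglongrightarrow> (z x)\<^sup>2 / 2"
      by (intro AE_I2 LIMSEQ_Suc pointwise)
    show "AE x in M. norm (f (Suc n) x) \<le> exp B * (norm (z x))\<^sup>2" for n
      using bound[of "Suc n"] by simp
  qed (use z2 in auto)
  then have "(\<lambda>n. \<integral>x. f n x \<partial>M) \<longlonglongrightarrow> (\<integral>x. (z x)\<^sup>2 / 2 \<partial>M)"
    by (rule LIMSEQ_imp_Suc)
  moreover have "(\<integral>x. f n x \<partial>M) = of_nat n * ((\<integral>x. exp (z x / sqrt (real n)) \<partial>M) - 1)" for n
  proof (cases "n = 0")
    case False
    then show ?thesis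
      using eint[of n] zint z0 by (simp add: f_def prob_space)
  qed (simp add: f_def)
  ultimately show ?thesis by simp
qed

context prob_space begin

text \<open>
  The density of \<open>tilt g n\<close> is proportional to \<open>exp (g / \<surd>n)\<close>; its square root is the object that
  enters the Hellinger distance.
\<close>

definition tilt_mass :: "('a \<Rightarrow> real) \<Rightarrow> nat \<Rightarrow> real" where
  "tilt_mass g n = (\<integral>x. exp (g x / sqrt (real n)) \<partial>M)"

definition tilt_root :: "('a \<Rightarrow> real) \<Rightarrow> nat \<Rightarrow> 'a \<Rightarrow> real" where
  "tilt_root g n x = exp (g x / (2 * sqrt (real n))) / sqrt (tilt_mass g n)"

definition tilt :: "('a \<Rightarrow> real) \<Rightarrow> nat \<Rightarrow> 'a measure" where
  "tilt g n = density M (\<lambda>x. (tilt_root g n x)\<^sup>2)"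

lemma bounded_centered_measurable: "bounded_centered g \<Longrightarrow> g \<in> borel_measurable M"
  by (simp add: bounded_centered_def)

lemma integrable_exp_bounded_centered:
  assumes "bounded_centered g"
  shows "integrable M (\<lambda>x. exp (c * g x))"
proof -
  obtain B where B: "\<And>x. \<bar>g x\<bar> \<le> B"
    using assms by (auto simp: bounded_centered_def)
  have "norm (exp (c * g x)) \<le> exp (\<bar>c\<bar> * B)" for x
  proof -
    have "c * g x \<le> \<bar>c\<bar> * \<bar>g x\<bar>"
      by (metis abs_ge_self abs_mult)
    also have "\<dots> \<le> \<bar>c\<bar> * B"
      by (rule mult_left_mono[OF B]) simp
    finally show ?thesis by simp
  qed
  then show ?thesis
    using bounded_centered_measurable[OF assms]
    by (intro integrable_const_bound[where B = "exp (\<bar>c\<bar> * B)"]) auto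
qed

lemma tilt_mass_pos:
  assumes "bounded_centered g"
  shows "0 < tilt_mass g n"
proof -
  have int: "integrable M (\<lambda>x. exp (g x / sqrt (real n)))"
    using integrable_exp_bounded_centered[OF assms, of "1 / sqrt (real n)"] by simp
  have "tilt_mass g n \<noteq> 0"
    unfolding tilt_mass_def
    by (subst integral_nonneg_eq_0_iff_AE[OF int]) (auto simp: AE_False)
  moreover have "0 \<le> tilt_mass g n"
    unfolding tilt_mass_def by simp
  ultimately show ?thesis by simp
qed

lemma tilt_root_power2:
  assumes "bounded_centered g"
  shows "(tilt_root g n x)\<^sup>2 = exp (g x / sqrt (real n)) / tilt_mass g n"
  using tilt_mass_pos[OF assms, of n]
  by (simp add: tilt_root_def power_divide flip: exp_double)

lemma tilt_root_L2:
  assumes "bounded_centered g"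
  shows "tilt_root g n \<in> L2 M" "(\<integral>x. (tilt_root g n x)\<^sup>2 \<partial>M) = 1"
proof -
  have [measurable]: "g \<in> borel_measurable M"
    using assms by (rule bounded_centered_measurable)
  have "tilt_root g n \<in> borel_measurable M"
    unfolding tilt_root_def by measurable
  moreover have "integrable M (\<lambda>x. (tilt_root g n x)\<^sup>2)"
    unfolding tilt_root_power2[OF assms]
    using integrable_exp_bounded_centered[OF assms, of "1 / sqrt (real n)"] by simp
  ultimately show "tilt_root g n \<in> L2 M"
    by (simp add: L2_def)
  show "(\<integral>x. (tilt_root g n x)\<^sup>2 \<partial>M) = 1"
    unfolding tilt_root_power2[OF assms]
    using tilt_mass_pos[OF assms, of n] by (simp add: tilt_mass_def)
qed

lemma tilt_root_nonneg: "0 \<le> tilt_root g n x"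
  by (simp add: tilt_root_def tilt_mass_def)

lemma sets_tilt [measurable_cong, simp]: "sets (tilt g n) = sets M"
  by (simp add: tilt_def)

lemma prob_space_tilt:
  assumes "bounded_centered g"
  shows "prob_space (tilt g n)"
proof (rule prob_spaceI)
  have [measurable]: "tilt_root g n \<in> borel_measurable M"
    using tilt_root_L2(1)[OF assms] by (rule L2_measurable)
  have "emeasure (tilt g n) (space (tilt g n)) = (\<integral>\<^sup>+x. ennreal ((tilt_root g n x)\<^sup>2) \<partial>M)"
    unfolding tilt_def by (subst emeasure_density) (auto intro!: nn_integral_cong)
  also have "\<dots> = 1"
    using tilt_root_L2[OF assms, of n] by (subst nn_integral_eq_integral) (auto simp: L2_def)
  finally show "emeasure (tilt g n) (space (tilt g n)) = 1" .
qed

text \<open>The case of real \<open>z = g\<close> in the complex expansion. The second limit is the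
  normalizing constant of the \<open>n\<close>-fold product tilt.\<close>

lemma tilt_mass_expansion:
  assumes "bounded_centered g"
  shows "(\<lambda>n. real n * (tilt_mass g n - 1)) \<longlonglongrightarrow> (\<integral>x. (g x)\<^sup>2 \<partial>M) / 2"
    and "(\<lambda>n. tilt_mass g n ^ n) \<longlonglongrightarrow> exp ((\<integral>x. (g x)\<^sup>2 \<partial>M) / 2)"
proof -
  have [measurable]: "g \<in> borel_measurable M"
    using assms by (rule bounded_centered_measurable)
  obtain B where B: "\<And>x. \<bar>g x\<bar> \<le> B"
    using assms by (auto simp: bounded_centered_def)
  have "integrable M (\<lambda>x. (g x)\<^sup>2)"
    using bounded_centered_L2[OF assms] by (simp add: L2_centered_def L2_def)
  then have "(\<lambda>n. of_nat n * ((\<integral>x. exp (complex_of_real (g x) / sqrt (real n)) \<partial>M) - 1))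
      \<longlonglongrightarrow> (\<integral>x. (complex_of_real (g x))\<^sup>2 \<partial>M) / 2"
    using B assms by (intro exp_root_expansion[where B = B]) (auto simp: bounded_centered_def)
  also have "(\<integral>x. (complex_of_real (g x))\<^sup>2 \<partial>M) / 2 = complex_of_real ((\<integral>x. (g x)\<^sup>2 \<partial>M) / 2)"
    by (simp flip: of_real_power)
  also have "(\<lambda>n. of_nat n * ((\<integral>x. exp (complex_of_real (g x) / sqrt (real n)) \<partial>M) - 1))
      = (\<lambda>n. of_nat n * (complex_of_real (tilt_mass g n) - 1))"
    unfolding tilt_mass_def by (simp flip: of_real_divide add: exp_of_real)
  finally have *: "(\<lambda>n. of_nat n * (complex_of_real (tilt_mass g n) - 1))
      \<longlonglongrightarrow> complex_of_real ((\<integral>x. (g x)\<^sup>2 \<partial>M) / 2)" .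
  from tendsto_Re[OF this] show "(\<lambda>n. real n * (tilt_mass g n - 1)) \<longlonglongrightarrow> (\<integral>x. (g x)\<^sup>2 \<partial>M) / 2"
    by simp
  from tendsto_Re[OF tendsto_power_exp[OF *]]
  show "(\<lambda>n. tilt_mass g n ^ n) \<longlonglongrightarrow> exp ((\<integral>x. (g x)\<^sup>2 \<partial>M) / 2)"
    by (simp only: exp_of_real Re_complex_of_real flip: of_real_power)
qed

text \<open>Tilts satisfy the same root expansion as a differentiable sequence with tangent
  \<open>g\<close>, which makes the two comparable in Hellinger distance. The exponential factor
  contributes \<open>g / 2\<close>; the normalizing factor \<open>a n\<close> deviates from 1 by
  less than order \<open>1 / sqrt n\<close>.\<close>

lemma tilt_root_L2_lim:
  assumes "bounded_centered g"
  shows "L2_lim M (\<lambda>n x. sqrt (real n) * (tilt_root g n x - 1)) (\<lambda>x. g x / 2)"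
proof -
  have [measurable]: "g \<in> borel_measurable M"
    using assms by (rule bounded_centered_measurable)
  obtain B where B: "\<And>x. \<bar>g x\<bar> \<le> B"
    using assms by (auto simp: bounded_centered_def)
  have gL2: "g \<in> L2 M"
    using bounded_centered_L2[OF assms] by (simp add: L2_centered_def)
  have root: "(\<lambda>n. sqrt (real n) * (tilt_mass g n - 1)) \<longlonglongrightarrow> 0"
  proof -
    have "(\<lambda>n. 1 / sqrt (real n) * (real n * (tilt_mass g n - 1))) \<longlonglongrightarrow> 0 * ((\<integral>x. (g x)\<^sup>2 \<partial>M) / 2)"
      by (intro tendsto_mult inverse_sqrt_tendsto_0 tilt_mass_expansion assms)
    moreover have "1 / sqrt (real n) * (real n * (tilt_mass g n - 1)) = sqrt (real n) * (tilt_mass g n - 1)" for n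
      by (cases "n = 0") (simp_all add: field_simps)
    ultimately show ?thesis by simp
  qed
  have "(\<lambda>n. 1 / sqrt (real n) * (sqrt (real n) * (tilt_mass g n - 1))) \<longlonglongrightarrow> 0 * 0"
    by (intro tendsto_mult inverse_sqrt_tendsto_0 root)
  then have "(\<lambda>n. tilt_mass g n - 1) \<longlonglongrightarrow> 0"
    unfolding mult_zero_right
    by (rule Lim_transform_eventually, intro eventually_mono[OF eventually_gt_at_top[of 0]]) simp
  then have mass1: "tilt_mass g \<longlonglongrightarrow> 1"
    by (rule LIM_zero_cancel)
  define a where "a n = 1 / sqrt (tilt_mass g n)" for n
  have a: "a \<longlonglongrightarrow> 1"
    unfolding a_def using mass1 by (auto intro!: tendsto_eq_intros)
  have "(\<lambda>n. sqrt (real n) * (tilt_mass g n - 1) * (- 1 / (sqrt (tilt_mass g n) * (1 + sqrt (tilt_mass g n)))))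
      \<longlonglongrightarrow> 0 * (- 1 / (sqrt 1 * (1 + sqrt 1)))"
    by (intro tendsto_intros root mass1) auto
  moreover have "sqrt (real n) * (tilt_mass g n - 1) * (- 1 / (sqrt (tilt_mass g n) * (1 + sqrt (tilt_mass g n))))
      = sqrt (real n) * (a n - 1)" for n
  proof -
    define c where "c = sqrt (tilt_mass g n)"
    have c: "0 < c" "tilt_mass g n = c\<^sup>2"
      using tilt_mass_pos[OF assms, of n] by (auto simp: c_def)
    \<comment> \<open>Rationalizes \<open>1 / c - 1\<close>, so that the deviation of
      \<open>a n\<close> is controlled by that of the mass itself.\<close>
    have "(c\<^sup>2 - 1) * (- 1 / (c * (1 + c))) = 1 / c - 1"
      using c(1) by (simp add: divide_simps power2_eq_square) (simp add: algebra_simps)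
    then show ?thesis
      unfolding c(2) a_def c_def[symmetric] by (simp only: mult.assoc) (use c in simp)
  qed
  ultimately have a': "(\<lambda>n. sqrt (real n) * (a n - 1)) \<longlonglongrightarrow> 0"
    by simp
  define G where "G n x = sqrt (real n) * (exp (g x / (2 * sqrt (real n))) - 1)" for n x
  have G_lim: "L2_lim M (\<lambda>n. G (Suc n)) (\<lambda>x. g x / 2)"
  proof (rule L2_lim_uniform)
    have "integrable M (\<lambda>x. (exp (g x / (2 * sqrt (real n))) - 1)\<^sup>2)" for n
      using integrable_exp_bounded_centered[OF assms, of "1 / (2 * sqrt (real n))"]
        integrable_exp_bounded_centered[OF assms, of "1 / sqrt (real n)"]
      by (simp add: power2_diff prob_space flip: exp_double)
    then have "(\<lambda>x. exp (g x / (2 * sqrt (real n))) - 1) \<in> L2 M" for n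
      by (simp add: L2_def)
    then show "G (Suc n) \<in> L2 M" for n
      unfolding G_def by (rule L2_cmult)
    show "(\<lambda>x. g x / 2) \<in> L2 M"
      using L2_cmult[OF gL2, of "1 / 2"] by simp
    show "(\<lambda>n. (exp B * B\<^sup>2) * (1 / sqrt (real (Suc n)))) \<longlonglongrightarrow> 0"
      using LIMSEQ_Suc[OF inverse_sqrt_tendsto_0] by (rule tendsto_mult_right_zero)
    show "\<bar>G (Suc n) x - g x / 2\<bar> \<le> (exp B * B\<^sup>2) * (1 / sqrt (real (Suc n)))" for n x
    proof -
      define m where "m = sqrt (real (Suc n))"
      define w where "w = g x / (2 * m)"
      have m: "1 \<le> m" by (simp add: m_def)
      have w: "\<bar>w\<bar> \<le> B / m"
        using B[of x] m by (simp add: w_def abs_mult field_simps)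
      also have "\<dots> \<le> B"
        using B[of x] m by (simp add: divide_le_eq mult_le_cancel_left1)
      finally have wB: "\<bar>w\<bar> \<le> B" .
      have "\<bar>exp w - 1 - w\<bar> \<le> exp \<bar>w\<bar> * w\<^sup>2"
        using Taylor_exp_field[of w 1] by (simp add: numeral_2_eq_2 diff_diff_eq)
      also have "\<dots> \<le> exp B * (B / m)\<^sup>2"
        using wB power_mono[OF w, of 2] by (intro mult_mono) auto
      finally have "m * \<bar>exp w - 1 - w\<bar> \<le> m * (exp B * (B / m)\<^sup>2)"
        using m by (intro mult_left_mono) auto
      also have "m * (exp B * (B / m)\<^sup>2) = (exp B * B\<^sup>2) * (1 / m)"
        using m by (simp add: power_divide power2_eq_square)
      also have "m * \<bar>exp w - 1 - w\<bar> = \<bar>m * (exp w - 1 - w)\<bar>"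
        using m by (simp add: abs_mult)
      also have "m * (exp w - 1 - w) = G (Suc n) x - g x / 2"
        unfolding G_def w_def m_def[symmetric] using m by (simp add: field_simps)
      finally show ?thesis by (simp add: m_def)
    qed
  qed
  have "L2_lim M (\<lambda>n x. a (Suc n) * G (Suc n) x + sqrt (real (Suc n)) * (a (Suc n) - 1)) (\<lambda>x. 1 * (g x / 2) + 0)"
    by (intro L2_lim_add L2_lim_scale L2_lim_const_seq G_lim LIMSEQ_Suc[OF a] LIMSEQ_Suc[OF a'])
  moreover have "a n * G n x + sqrt (real n) * (a n - 1) = sqrt (real n) * (tilt_root g n x - 1)" for n x
    by (simp add: a_def G_def tilt_root_def algebra_simps)
  ultimately have "L2_lim M (\<lambda>n x. sqrt (real (Suc n)) * (tilt_root g (Suc n) x - 1)) (\<lambda>x. g x / 2)"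
    by (simp only: mult_1 add_0_right)
  then have "(\<lambda>n. L2_norm M (\<lambda>x. sqrt (real n) * (tilt_root g n x - 1) - g x / 2)) \<longlonglongrightarrow> 0" "(\<lambda>x. g x / 2) \<in> L2 M"
    unfolding L2_lim_def by (auto intro: LIMSEQ_imp_Suc simp del: of_nat_Suc)
  then show ?thesis
    unfolding L2_lim_def by (auto intro!: L2_cmult L2_diff tilt_root_L2 assms L2_const)
qed

end

section \<open>Asymptotic normality and local sequences\<close>

context prob_space begin

text \<open>The coordinates are independent, so the integral is an \<open>n\<close>-th power, and
  the tilt merely adds the real exponent \<open>g\<close> to the imaginary one.\<close>

lemma char_tilt_sum:
  assumes g: "bounded_centered g" and w [measurable]: "w \<in> borel_measurable M"
  shows "(\<integral>\<omega>. exp (\<i> * (u * (1 / sqrt (real n) * (\<Sum>i<n. w (\<omega> i))))) \<partial>PiM {..<n} (\<lambda>_. tilt g n))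
    = (\<integral>x. exp ((g x + \<i> * (u * w x)) / sqrt (real n)) \<partial>M) ^ n / (tilt_mass g n) ^ n"
proof -
  interpret T: prob_space "tilt g n" by (rule prob_space_tilt[OF g])
  interpret TT: product_prob_space "\<lambda>_. tilt g n" "{..<n}" ..
  have [measurable]: "g \<in> borel_measurable M"
    using g by (rule bounded_centered_measurable)
  have [measurable]: "tilt_root g n \<in> borel_measurable M"
    using tilt_root_L2(1)[OF g] by (rule L2_measurable)
  define h where "h x = exp (\<i> * (u * (1 / sqrt (real n) * w x)))" for x
  have [measurable]: "h \<in> borel_measurable M" "h \<in> borel_measurable (tilt g n)"
    unfolding h_def by measurable
  have norm_h: "norm (h x) = 1" for x
    unfolding h_def by (simp flip: of_real_mult of_real_divide)
  have "exp (\<i> * (u * (1 / sqrt (real n) * (\<Sum>i<n. w (\<omega> i))))) = (\<Prod>i<n. h (\<omega> i))" for \<omega>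
    unfolding h_def by (simp add: exp_sum[symmetric] sum_distrib_left)
  then have "(\<integral>\<omega>. exp (\<i> * (u * (1 / sqrt (real n) * (\<Sum>i<n. w (\<omega> i))))) \<partial>PiM {..<n} (\<lambda>_. tilt g n))
      = (\<Prod>i<n. \<integral>x. h x \<partial>tilt g n)"
    by (simp only:) (rule TT.product_integral_prod,
        auto intro!: T.integrable_const_bound[where B = 1] simp: norm_h)
  also have "\<dots> = (\<integral>x. h x \<partial>tilt g n) ^ n"
    by simp
  also have "(\<integral>x. h x \<partial>tilt g n) = (\<integral>x. (tilt_root g n x)\<^sup>2 *\<^sub>R h x \<partial>M)"
    unfolding tilt_def by (rule integral_density) auto
  also have "\<dots> = (\<integral>x. exp ((g x + \<i> * (u * w x)) / sqrt (real n)) / tilt_mass g n \<partial>M)"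
    unfolding tilt_root_power2[OF g] h_def scaleR_conv_of_real of_real_divide of_real_mult exp_of_real[symmetric]
    by (intro Bochner_Integration.integral_cong refl)
      (simp add: add_divide_distrib exp_add field_simps)
  finally show ?thesis
    by (simp add: power_divide)
qed

text \<open>Levy continuity. The mean shift is the cross term of the square of
  \<open>g + \<i> u w\<close>; computing the characteristic function directly under the tilt takes
  the place of a contiguity argument.\<close>

theorem tilt_central_limit:
  assumes g: "bounded_centered g" and w: "w \<in> L2_centered M" and \<sigma>: "0 < L2_norm M w" and v: "0 < v"
  shows "(\<lambda>n. \<integral>\<omega>. (if v < \<bar>1 / sqrt (real n) * (\<Sum>i<n. w (\<omega> i))\<bar> then 1 else 0 :: real)
      \<partial>PiM {..<n} (\<lambda>_. tilt g n)) \<longlonglongrightarrow> two_sided_power v (\<integral>x. g x * w x \<partial>M) (L2_norm M w)"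
proof -
  define m where "m = (\<integral>x. g x * w x \<partial>M)"
  define \<sigma> where "\<sigma> = L2_norm M w"
  have \<sigma>0: "0 < \<sigma>" using assms(3) by (simp add: \<sigma>_def)
  have wL2: "w \<in> L2 M" and w0: "(\<integral>x. w x \<partial>M) = 0"
    using w by (auto simp: L2_centered_def)
  have gL2: "g \<in> L2 M" and g0: "(\<integral>x. g x \<partial>M) = 0"
    using bounded_centered_L2[OF g] by (auto simp: L2_centered_def)
  note [measurable] = L2_measurable[OF wL2] L2_measurable[OF gL2]
  define Z where "Z n \<omega> = 1 / sqrt (real n) * (\<Sum>i<n. w (\<omega> i))" for n :: nat and \<omega>
  have [measurable]: "Z n \<in> borel_measurable (PiM {..<n} (\<lambda>_. tilt g n))" for n
    unfolding Z_def by measurable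
  define X where "X n \<omega> = (Z n \<omega> - m) / \<sigma>" for n \<omega>
  have X_meas [measurable]: "X n \<in> borel_measurable (PiM {..<n} (\<lambda>_. tilt g n))" for n
    unfolding X_def by measurable
  define \<mu> where "\<mu> n = distr (PiM {..<n} (\<lambda>_. tilt g n)) borel (X n)" for n
  have prob: "prob_space (PiM {..<n} (\<lambda>_. tilt g n))" for n
  proof -
    interpret T: prob_space "tilt g n" by (rule prob_space_tilt[OF g])
    interpret TT: product_prob_space "\<lambda>_. tilt g n" "{..<n}" ..
    show ?thesis by (rule TT.P.prob_space_axioms)
  qed
  have \<mu>: "real_distribution (\<mu> n)" for n
    unfolding \<mu>_def by (rule prob_space.real_distribution_distr[OF prob X_meas])
  have char_lim: "(\<lambda>n. char (\<mu> n) t) \<longlonglongrightarrow> char std_normal_distribution t" for t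
  proof -
    define u where "u = t / \<sigma>"
    define z where "z x = g x + \<i> * (u * w x)" for x
    obtain B where B: "\<And>x. \<bar>g x\<bar> \<le> B"
      using g by (auto simp: bounded_centered_def)
    have ints: "integrable M (\<lambda>x. (g x)\<^sup>2)" "integrable M (\<lambda>x. (w x)\<^sup>2)" "integrable M (\<lambda>x. g x * w x)"
      "integrable M g" "integrable M w"
      using gL2 wL2 by (auto intro: L2_integrable_mult L2_integrable_square L2_integrable)
    have zmeas: "z \<in> borel_measurable M"
      unfolding z_def by measurable
    have zRe: "\<bar>Re (z x)\<bar> \<le> B" for x
      using B by (simp add: z_def)
    have znorm: "integrable M (\<lambda>x. (norm (z x))\<^sup>2)"
      using ints by (simp add: z_def cmod_power2 power_mult_distrib)
    have z0: "(\<integral>x. z x \<partial>M) = 0"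
      unfolding z_def using ints g0 w0 by simp
    have z2: "(\<integral>x. (z x)\<^sup>2 \<partial>M)
        = of_real (\<integral>x. (g x)\<^sup>2 \<partial>M) + 2 * \<i> * u * m - of_real (u\<^sup>2 * \<sigma>\<^sup>2)"
    proof -
      have "(z x)\<^sup>2 = of_real ((g x)\<^sup>2) + 2 * \<i> * u * of_real (g x * w x) - of_real (u\<^sup>2) * of_real ((w x)\<^sup>2)" for x
        by (simp add: z_def power2_eq_square algebra_simps)
      then have "(\<integral>x. (z x)\<^sup>2 \<partial>M) = (\<integral>x. of_real ((g x)\<^sup>2) + 2 * \<i> * u * of_real (g x * w x)
          - of_real (u\<^sup>2) * of_real ((w x)\<^sup>2) \<partial>M)"
        by (simp only:)
      also have "\<dots> = of_real (\<integral>x. (g x)\<^sup>2 \<partial>M) + 2 * \<i> * u * of_real (\<integral>x. g x * w x \<partial>M)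
          - of_real (u\<^sup>2) * of_real (\<integral>x. (w x)\<^sup>2 \<partial>M)"
        using ints by (subst Bochner_Integration.integral_diff Bochner_Integration.integral_add;
            (simp add: integrable_of_real del: of_real_mult of_real_power)?)+
      finally show ?thesis
        by (simp add: m_def \<sigma>_def L2_norm_power2)
    qed
    have "(\<lambda>n. (\<integral>x. exp (z x / sqrt (real n)) \<partial>M) ^ n) \<longlonglongrightarrow> exp ((\<integral>x. (z x)\<^sup>2 \<partial>M) / 2)"
      by (rule tendsto_power_exp, rule exp_root_expansion[OF zmeas zRe znorm z0])
    then have "(\<lambda>n. exp (- (\<i> * (u * m))) * ((\<integral>x. exp (z x / sqrt (real n)) \<partial>M) ^ n / of_real (tilt_mass g n ^ n)))
        \<longlonglongrightarrow> exp (- (\<i> * (u * m))) * (exp ((\<integral>x. (z x)\<^sup>2 \<partial>M) / 2) / of_real (exp ((\<integral>x. (g x)\<^sup>2 \<partial>M) / 2)))"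
      by (intro tendsto_intros tilt_mass_expansion g) auto
    \<comment> \<open>The normalizing constant cancels the \<open>g\<close> term, the centering
      cancels the cross term, and the choice \<open>u = t / \<sigma>\<close> standardizes the
      variance.\<close>
    also have "exp (- (\<i> * (u * m))) * (exp ((\<integral>x. (z x)\<^sup>2 \<partial>M) / 2) / of_real (exp ((\<integral>x. (g x)\<^sup>2 \<partial>M) / 2)))
        = exp (complex_of_real (- (t\<^sup>2) / 2))"
    proof -
      have "- (\<i> * (u * m)) + ((\<integral>x. (z x)\<^sup>2 \<partial>M) / 2 - of_real ((\<integral>x. (g x)\<^sup>2 \<partial>M) / 2))
          = complex_of_real (- (u\<^sup>2 * \<sigma>\<^sup>2) / 2)"
        unfolding z2 by (simp add: field_simps)
      also have "u\<^sup>2 * \<sigma>\<^sup>2 = t\<^sup>2"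
        using \<sigma>0 by (simp add: u_def power_divide)
      finally show ?thesis
        by (simp only: exp_of_real[symmetric] exp_diff[symmetric] exp_add[symmetric])
    qed
    also have "\<dots> = char std_normal_distribution t"
      by (simp only: char_std_normal_distribution exp_of_real)
    also have "(\<lambda>n. exp (- (\<i> * (u * m))) * ((\<integral>x. exp (z x / sqrt (real n)) \<partial>M) ^ n / of_real (tilt_mass g n ^ n)))
        = (\<lambda>n. char (\<mu> n) t)"
    proof
      fix n
      have "char (\<mu> n) t = (\<integral>\<omega>. exp (\<i> * (t * X n \<omega>)) \<partial>PiM {..<n} (\<lambda>_. tilt g n))"
        unfolding char_def \<mu>_def by (subst integral_distr) auto
      also have "\<dots> = (\<integral>\<omega>. exp (- (\<i> * (u * m))) * exp (\<i> * (u * Z n \<omega>)) \<partial>PiM {..<n} (\<lambda>_. tilt g n))"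
        by (simp add: X_def u_def exp_add[symmetric] diff_divide_distrib algebra_simps)
      also have "\<dots> = exp (- (\<i> * (u * m))) * (\<integral>\<omega>. exp (\<i> * (u * Z n \<omega>)) \<partial>PiM {..<n} (\<lambda>_. tilt g n))"
        by (rule integral_mult_right_zero)
      also have "(\<integral>\<omega>. exp (\<i> * (u * Z n \<omega>)) \<partial>PiM {..<n} (\<lambda>_. tilt g n))
          = (\<integral>x. exp (z x / sqrt (real n)) \<partial>M) ^ n / of_real (tilt_mass g n ^ n)"
        using char_tilt_sum[OF g L2_measurable[OF wL2], of n u]
        by (simp add: Z_def z_def)
      finally show "exp (- (\<i> * (u * m))) * ((\<integral>x. exp (z x / sqrt (real n)) \<partial>M) ^ n / of_real (tilt_mass g n ^ n))
          = char (\<mu> n) t" by simp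
    qed
    finally show ?thesis .
  qed
  have weak: "weak_conv_m \<mu> std_normal_distribution"
    by (rule levy_continuity[OF \<mu> real_dist_normal_dist char_lim])
  define A where "A = {x. v < \<bar>\<sigma> * x + m\<bar>}"
  have A_sets [measurable]: "A \<in> sets borel"
    unfolding A_def by measurable
  have A_eq: "A = - {(- v - m) / \<sigma>..(v - m) / \<sigma>}"
    using \<sigma>0 by (auto simp: A_def field_simps abs_if)
  \<comment> \<open>The boundary consists of at most two points, which the normal law does not
    charge; weak convergence therefore yields convergence of the probabilities of
    \<open>A\<close>.\<close>
  have "frontier A \<subseteq> {(- v - m) / \<sigma>, (v - m) / \<sigma>}"
    unfolding A_eq frontier_complement
    by (auto simp: frontier_def interior_atLeastAtMost_real)
  then have "frontier A \<in> null_sets lborel"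
    by (intro finite_imp_null_set_lborel) (rule finite_subset, auto)
  then have "frontier A \<in> null_sets std_normal_distribution"
    using absolutely_continuousI_density[of "\<lambda>x. ennreal (std_normal_density x)" lborel]
    unfolding absolutely_continuous_def by auto
  then have "emeasure std_normal_distribution (frontier A) = 0"
    by (rule null_setsD1)
  from weak_conv_imp_continuity_set_conv[OF \<mu> real_dist_normal_dist weak A_sets this]
  have "(\<lambda>n. measure (\<mu> n) A) \<longlonglongrightarrow> two_sided_power v m \<sigma>"
    using measure_two_sided[OF \<sigma>0 v] by (simp add: A_def)
  moreover have "measure (\<mu> n) A = (\<integral>\<omega>. (if v < \<bar>Z n \<omega>\<bar> then 1 else 0 :: real) \<partial>PiM {..<n} (\<lambda>_. tilt g n))" for n
  proof -
    have "measure (\<mu> n) A = (\<integral>x. indicator A x \<partial>\<mu> n)"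
      by (simp add: \<mu>_def)
    also have "\<dots> = (\<integral>\<omega>. indicator A (X n \<omega>) \<partial>PiM {..<n} (\<lambda>_. tilt g n))"
      unfolding \<mu>_def by (rule integral_distr) auto
    also have "\<dots> = (\<integral>\<omega>. (if v < \<bar>Z n \<omega>\<bar> then 1 else 0) \<partial>PiM {..<n} (\<lambda>_. tilt g n))"
      using \<sigma>0 by (intro Bochner_Integration.integral_cong) (auto simp: A_def X_def indicator_def)
    finally show ?thesis .
  qed
  ultimately show ?thesis
    by (simp add: m_def \<sigma>_def Z_def)
qed

section \<open>Local tangents of sequences of measures\<close>

text \<open>
  In \<open>local_tangent Q w\<close> the factor \<open>c = lim t\<^sub>n \<surd>n\<close> is absorbed into the tangent: a sequence
  \<open>f (t\<^sub>n)\<close> along a curve with tangent \<open>g\<close> has the local tangent \<open>c g\<close>.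
\<close>

definition local_tangent :: "(nat \<Rightarrow> 'a measure) \<Rightarrow> ('a \<Rightarrow> real) \<Rightarrow> bool" where
  "local_tangent Q w \<longleftrightarrow> (\<forall>n. prob_space (Q n) \<and> sets (Q n) = sets M) \<and> w \<in> L2 M \<and>
     (\<exists>L. (\<forall>n. density_quotient (Q n) M (L n)) \<and>
        L2_lim M (\<lambda>n x. sqrt (real n) * (sqrt (enn2real (L n x)) - 1)) (\<lambda>x. w x / 2) \<and>
        (\<lambda>n. real n * measure (Q n) {x \<in> space (Q n). L n x = \<infinity>}) \<longlonglongrightarrow> 0)"

text \<open>The rescaled roots differ in the limit by \<open>(w - g) / 2\<close>, and the factor 2
  of the Hellinger bound cancels the 2. The bound \<open>b\<close> constructed here does not involve
  the test.\<close>

lemma local_tangent_test_power: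
  assumes Q: "local_tangent Q w" and g: "bounded_centered g" and \<psi>: "\<psi> \<in> test_sequences M"
  shows "\<exists>b. b \<longlonglongrightarrow> L2_norm M (\<lambda>x. w x - g x) \<and> (\<forall>n. \<bar>test_power \<psi> Q n - test_power \<psi> (tilt g) n\<bar> \<le> b n)"
proof -
  obtain L where pQ: "\<And>n. prob_space (Q n)" and sQ: "\<And>n. sets (Q n) = sets M"
    and L: "\<And>n. density_quotient (Q n) M (L n)"
    and lim: "L2_lim M (\<lambda>n x. sqrt (real n) * (sqrt (enn2real (L n x)) - 1)) (\<lambda>x. w x / 2)"
    and sing: "(\<lambda>n. real n * measure (Q n) {x \<in> space (Q n). L n x = \<infinity>}) \<longlonglongrightarrow> 0"
    using Q by (auto simp: local_tangent_def)
  define s where "s n = measure (Q n) {x \<in> space (Q n). L n x = \<infinity>}" for n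
  define q where "q n x = sqrt (enn2real (L n x))" for n x
  define b where "b n = real n * s n + 2 * sqrt (real n * (s n + (\<integral>x. (q n x - tilt_root g n x)\<^sup>2 \<partial>M)))" for n
  have "\<bar>test_power \<psi> Q n - test_power \<psi> (tilt g) n\<bar> \<le> b n" for n
    unfolding test_power_def b_def s_def q_def tilt_def
    using \<psi> by (intro test_power_diff_le prob_space_axioms pQ sQ L tilt_root_L2 g tilt_root_nonneg)
      (auto simp: test_sequences_def)
  moreover have "b \<longlonglongrightarrow> L2_norm M (\<lambda>x. w x - g x)"
  proof -
    let ?D = "\<lambda>n x. sqrt (real n) * (q n x - 1) - sqrt (real n) * (tilt_root g n x - 1)"
    have "(\<lambda>n. L2_norm M (?D n)) \<longlonglongrightarrow> L2_norm M (\<lambda>x. w x / 2 - g x / 2)"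
      unfolding q_def by (intro L2_lim_norm L2_lim_diff lim tilt_root_L2_lim g)
    also have "(\<lambda>x. w x / 2 - g x / 2) = (\<lambda>x. 1 / 2 * (w x - g x))"
      by (simp add: diff_divide_distrib)
    finally have D: "(\<lambda>n. L2_norm M (?D n)) \<longlonglongrightarrow> L2_norm M (\<lambda>x. w x - g x) / 2"
      unfolding L2_norm_cmult by simp
    have scaled: "real n * (\<integral>x. (q n x - tilt_root g n x)\<^sup>2 \<partial>M) = (L2_norm M (?D n))\<^sup>2" for n
    proof -
      have "?D n x = sqrt (real n) * (q n x - tilt_root g n x)" for x
        by (simp add: algebra_simps)
      then show ?thesis
        unfolding L2_norm_power2 by (simp only:) (simp add: power_mult_distrib)
    qed
    have b_eq: "b = (\<lambda>n. real n * s n + 2 * sqrt (real n * s n + (L2_norm M (?D n))\<^sup>2))"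
      by (rule ext) (simp only: b_def distrib_left scaled)
    have "(\<lambda>n. real n * s n + 2 * sqrt (real n * s n + (L2_norm M (?D n))\<^sup>2))
        \<longlonglongrightarrow> 0 + 2 * sqrt (0 + (L2_norm M (\<lambda>x. w x - g x) / 2)\<^sup>2)"
      by (intro tendsto_intros D sing[folded s_def])
    then show ?thesis
      unfolding b_eq by (simp add: L2_norm_nonneg)
  qed
  ultimately show ?thesis by blast
qed

text \<open>Centering of tangents is derived, as curves only ask for a tangent in \<open>L2\<close>.
  From \<open>q\<^sup>2 - 1 = 2 (q - 1) + (q - 1)\<^sup>2\<close>, whose integral is minus the
  singular mass, the mean of \<open>sqrt n (q - 1)\<close> is of order \<open>1 / sqrt n\<close> and
  tends to 0.\<close>

lemma local_tangent_centered:
  assumes Q: "local_tangent Q w"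
  shows "w \<in> L2_centered M"
proof -
  obtain L where pQ: "\<And>n. prob_space (Q n)" and sQ: "\<And>n. sets (Q n) = sets M"
    and L: "\<And>n. density_quotient (Q n) M (L n)" and w: "w \<in> L2 M"
    and lim: "L2_lim M (\<lambda>n x. sqrt (real n) * (sqrt (enn2real (L n x)) - 1)) (\<lambda>x. w x / 2)"
    and sing: "(\<lambda>n. real n * measure (Q n) {x \<in> space (Q n). L n x = \<infinity>}) \<longlonglongrightarrow> 0"
    using Q by (auto simp: local_tangent_def)
  define s where "s n = measure (Q n) {x \<in> space (Q n). L n x = \<infinity>}" for n
  define q where "q n x = sqrt (enn2real (L n x))" for n x
  let ?D = "\<lambda>n x. sqrt (real n) * (q n x - 1)"
  have qL2: "q n \<in> L2 M" and q2: "(\<integral>x. (q n x)\<^sup>2 \<partial>M) = 1 - s n" for n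
    using density_quotient_root[OF prob_space_axioms pQ sQ L] unfolding q_def[abs_def] s_def by blast+
  have "(\<lambda>n. 1 / sqrt (real n) * (- (real n * s n) - (L2_norm M (?D n))\<^sup>2))
      \<longlonglongrightarrow> 0 * (- 0 - (L2_norm M (\<lambda>x. w x / 2))\<^sup>2)"
    unfolding q_def by (intro tendsto_intros inverse_sqrt_tendsto_0 sing[folded s_def] L2_lim_norm lim)
  then have "(\<lambda>n. 1 / sqrt (real n) * (- (real n * s n) - (L2_norm M (?D n))\<^sup>2)) \<longlonglongrightarrow> 0"
    by simp
  moreover have "1 / sqrt (real n) * (- (real n * s n) - (L2_norm M (?D n))\<^sup>2) = 2 * (\<integral>x. ?D n x \<partial>M)" for n
  proof (cases "n = 0")
    case False
    have ints: "integrable M (q n)" "integrable M (\<lambda>x. (q n x)\<^sup>2)"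
      using qL2 by (auto intro: L2_integrable L2_integrable_square)
    have "(L2_norm M (?D n))\<^sup>2 = real n * (\<integral>x. (q n x - 1)\<^sup>2 \<partial>M)"
      unfolding L2_norm_power2 by (simp add: power_mult_distrib)
    also have "(\<integral>x. (q n x - 1)\<^sup>2 \<partial>M) = - s n - 2 * (\<integral>x. q n x - 1 \<partial>M)"
      using ints q2[of n] by (simp add: power2_diff prob_space)
    finally have "- (real n * s n) - (L2_norm M (?D n))\<^sup>2 = real n * (2 * (\<integral>x. q n x - 1 \<partial>M))"
      by (simp add: algebra_simps)
    moreover have "(\<integral>x. ?D n x \<partial>M) = sqrt (real n) * (\<integral>x. q n x - 1 \<partial>M)"
      by (rule integral_mult_right_zero)
    moreover have "1 / sqrt (real n) * (real n * y) = sqrt (real n) * y" for y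
    proof -
      have "1 / sqrt (real n) * (real n * y) = real n / sqrt (real n) * y" by simp
      then show ?thesis by (simp only: real_div_sqrt of_nat_0_le_iff)
    qed
    ultimately show ?thesis
      by simp
  qed simp
  ultimately have "(\<lambda>n. 2 * (\<integral>x. ?D n x \<partial>M)) \<longlonglongrightarrow> 0" by simp
  moreover have "(\<lambda>n. 2 * (\<integral>x. ?D n x \<partial>M)) \<longlonglongrightarrow> 2 * (\<integral>x. w x / 2 \<partial>M)"
    unfolding q_def by (intro tendsto_intros L2_lim_integral lim)
  ultimately have "2 * (\<integral>x. w x / 2 \<partial>M) = 0"
    by (rule LIMSEQ_unique[rotated])
  then show ?thesis
    using w by (simp add: L2_centered_def)
qed

lemma differentiable_curve_local_tangent:
  assumes f: "differentiable_curve \<P> M \<epsilon> f g"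
    and \<P>: "\<And>P. P \<in> \<P> \<Longrightarrow> prob_space P \<and> sets P = sets M"
    and t: "t \<longlonglongrightarrow> 0" "(\<lambda>n. t n * sqrt (real n)) \<longlonglongrightarrow> c" "0 < c" "\<And>n. \<bar>t n\<bar> < \<epsilon>"
  shows "local_tangent (\<lambda>n. f (t n)) (\<lambda>x. c * g x)"
proof -
  obtain L where gL2: "g \<in> L2 M" and L: "\<And>t. \<bar>t\<bar> < \<epsilon> \<Longrightarrow> density_quotient (f t) M (L t)"
    and deriv: "(\<lambda>t. L2_norm M (\<lambda>x. 2 * (sqrt (enn2real (L t x)) - 1) - t * g x)) \<in> o[at 0](\<lambda>t. \<bar>t\<bar>)"
    and sing: "(\<lambda>t. measure (f t) {x \<in> space (f t). L t x = \<infinity>}) \<in> o[at 0](\<lambda>t. t\<^sup>2)"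
    using f by (auto simp: differentiable_curve_def)
  have mem: "prob_space (f (t n))" "sets (f (t n)) = sets M" for n
    using f \<P> t(4) by (auto simp: differentiable_curve_def)
  define q where "q n x = sqrt (enn2real (L (t n) x))" for n x
  have qL2: "q n \<in> L2 M" for n
    using density_quotient_root(1)[OF prob_space_axioms mem L[OF t(4)]] unfolding q_def[abs_def] .
  have "\<forall>\<^sub>F n in sequentially. 0 < t n * sqrt (real n)"
    using t(2,3) by (rule order_tendstoD)
  then have tpos: "\<forall>\<^sub>F n in sequentially. 0 < t n"
    by eventually_elim (simp add: zero_less_mult_iff)
  \<comment> \<open>The filter \<open>at 0\<close> excludes 0 itself; positivity of \<open>c\<close>
    keeps \<open>t n\<close> away from 0 eventually.\<close>
  have t0: "filterlim t (at 0) sequentially"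
    using t(1) tpos by (auto simp: filterlim_at elim: eventually_mono)
  define N where "N n = L2_norm M (\<lambda>x. 2 * (q n x - 1) - t n * g x)" for n
  have N: "(\<lambda>n. sqrt (real n) * N n) \<longlonglongrightarrow> 0"
  proof -
    have "(\<lambda>n. N n / \<bar>t n\<bar>) \<longlonglongrightarrow> 0"
      using filterlim_compose[OF smalloD_tendsto[OF deriv] t0] by (simp add: N_def q_def)
    then have "(\<lambda>n. t n * sqrt (real n) * (N n / \<bar>t n\<bar>)) \<longlonglongrightarrow> c * 0"
      by (intro tendsto_mult t)
    then have "(\<lambda>n. t n * sqrt (real n) * (N n / \<bar>t n\<bar>)) \<longlonglongrightarrow> 0" by simp
    then show ?thesis
      by (rule Lim_transform_eventually) (use tpos in \<open>auto elim: eventually_mono\<close>)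
  qed
  have lim: "L2_lim M (\<lambda>n x. sqrt (real n) * (q n x - 1)) (\<lambda>x. c * g x / 2)"
  proof -
    let ?e = "\<lambda>n. (sqrt (real n) * N n + \<bar>t n * sqrt (real n) - c\<bar> * L2_norm M g) / 2"
    have "?e \<longlonglongrightarrow> (0 + \<bar>c - c\<bar> * L2_norm M g) / 2"
      by (intro tendsto_intros N t) simp
    then have e0: "?e \<longlonglongrightarrow> 0" by simp
    have DL2: "(\<lambda>x. 2 * (q n x - 1) - t n * g x) \<in> L2 M" for n
      by (intro L2_diff L2_cmult gL2 qL2 L2_const)
    have le: "L2_norm M (\<lambda>x. sqrt (real n) * (q n x - 1) - c * g x / 2) \<le> ?e n" for n
    proof -
      have eq: "(\<lambda>x. sqrt (real n) * (q n x - 1) - c * g x / 2)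
          = (\<lambda>x. sqrt (real n) / 2 * (2 * (q n x - 1) - t n * g x) + (t n * sqrt (real n) - c) / 2 * g x)"
        by (rule ext) (simp add: algebra_simps diff_divide_distrib)
      have "L2_norm M (\<lambda>x. sqrt (real n) * (q n x - 1) - c * g x / 2)
          \<le> \<bar>sqrt (real n) / 2\<bar> * N n + \<bar>(t n * sqrt (real n) - c) / 2\<bar> * L2_norm M g"
        unfolding N_def L2_norm_cmult[symmetric] eq
        by (intro L2_norm_triangle L2_cmult DL2 gL2)
      also have "\<dots> = ?e n"
        by (simp add: add_divide_distrib)
      finally show ?thesis .
    qed
    have "(\<lambda>n. L2_norm M (\<lambda>x. sqrt (real n) * (q n x - 1) - c * g x / 2)) \<longlonglongrightarrow> 0"
      by (rule Lim_null_comparison[OF _ e0], intro always_eventually allI)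
        (simp only: real_norm_def abs_of_nonneg[OF L2_norm_nonneg] le)
    moreover have "(\<lambda>x. c * g x / 2) \<in> L2 M"
      using L2_cmult[OF gL2, of "c / 2"] by simp
    moreover have "(\<lambda>x. sqrt (real n) * (q n x - 1)) \<in> L2 M" for n
      by (intro L2_diff L2_cmult qL2 L2_const)
    ultimately show ?thesis
      by (simp add: L2_lim_def)
  qed
  have s: "(\<lambda>n. real n * measure (f (t n)) {x \<in> space (f (t n)). L (t n) x = \<infinity>}) \<longlonglongrightarrow> 0"
  proof -
    define S where "S n = measure (f (t n)) {x \<in> space (f (t n)). L (t n) x = \<infinity>}" for n
    have "(\<lambda>n. S n / (t n)\<^sup>2) \<longlonglongrightarrow> 0"
      using filterlim_compose[OF smalloD_tendsto[OF sing] t0] by (simp add: S_def)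
    then have "(\<lambda>n. (t n * sqrt (real n))\<^sup>2 * (S n / (t n)\<^sup>2)) \<longlonglongrightarrow> c\<^sup>2 * 0"
      by (intro tendsto_intros t)
    then have "(\<lambda>n. (t n * sqrt (real n))\<^sup>2 * (S n / (t n)\<^sup>2)) \<longlonglongrightarrow> 0" by simp
    then have "(\<lambda>n. real n * S n) \<longlonglongrightarrow> 0"
      by (rule Lim_transform_eventually)
        (use tpos in \<open>auto elim!: eventually_mono simp: power_mult_distrib\<close>)
    then show ?thesis by (simp add: S_def)
  qed
  show ?thesis
    unfolding local_tangent_def
    using mem L2_cmult[OF gL2, of c] L[OF t(4)] lim[unfolded q_def] s
    by (intro conjI allI exI[of _ "\<lambda>n. L (t n)"]) auto
qed

text \<open>The gradient is defined by a limit from the right, and it applies because the positive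
  limit \<open>c\<close> makes \<open>t n\<close> eventually positive.\<close>

lemma has_gradient_local:
  assumes k: "has_gradient k M \<P> k'" and f: "differentiable_curve \<P> M \<epsilon> f g"
    and t: "t \<longlonglongrightarrow> 0" "(\<lambda>n. t n * sqrt (real n)) \<longlonglongrightarrow> c" "0 < c"
  shows "(\<lambda>n. sqrt (real n) * (k (f (t n)) - k M)) \<longlonglongrightarrow> c * (\<integral>x. k' x * g x \<partial>M)"
proof -
  have "\<forall>\<^sub>F n in sequentially. 0 < t n * sqrt (real n)"
    using t(2,3) by (rule order_tendstoD)
  then have tpos: "\<forall>\<^sub>F n in sequentially. 0 < t n"
    by eventually_elim (simp add: zero_less_mult_iff)
  have "((\<lambda>t. (k (f t) - k M) / t) \<longlongrightarrow> (\<integral>x. k' x * g x \<partial>M)) (at_right 0)"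
    using k f by (auto simp: has_gradient_def)
  moreover have "filterlim t (at_right 0) sequentially"
    using t(1) tpos by (auto simp: filterlim_at elim: eventually_mono)
  ultimately have "(\<lambda>n. (k (f (t n)) - k M) / t n) \<longlonglongrightarrow> (\<integral>x. k' x * g x \<partial>M)"
    by (rule filterlim_compose)
  then have "(\<lambda>n. t n * sqrt (real n) * ((k (f (t n)) - k M) / t n)) \<longlonglongrightarrow> c * (\<integral>x. k' x * g x \<partial>M)"
    by (intro tendsto_mult t)
  then show ?thesis
    by (rule Lim_transform_eventually) (use tpos in \<open>auto elim: eventually_mono\<close>)
qed

end

section \<open>The envelope of the power of unbiased tests\<close>

lemma integrable_test:
  assumes "prob_space (Q n)" "sets (Q n) = sets M" "\<psi> \<in> test_sequences M"
  shows "integrable (PiM {..<n} (\<lambda>_. Q n)) (\<psi> n)"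
proof -
  interpret prob_space "Q n" by fact
  interpret product_prob_space "\<lambda>_. Q n" "{..<n}" ..
  have sets_eq: "sets (PiM {..<n} (\<lambda>_. Q n)) = sets (PiM {..<n} (\<lambda>_. M))"
    by (intro sets_PiM_cong refl assms)
  have meas: "\<psi> n \<in> borel_measurable (PiM {..<n} (\<lambda>_. Q n))"
    using assms(3) measurable_cong_sets[OF sets_eq refl] by (auto simp: test_sequences_def)
  have bounds: "0 \<le> \<psi> n \<omega>" "\<psi> n \<omega> \<le> 1" if "\<omega> \<in> space (PiM {..<n} (\<lambda>_. Q n))" for \<omega>
    using assms(3) that sets_eq_imp_space_eq[OF sets_eq] by (auto simp: test_sequences_def)
  show ?thesis
    using meas bounds by (intro P.integrable_const_bound[where B = 1]) auto
qed

text \<open>Threshold and score are free parameters, since arbitrary tests are also compared with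
  tests built from bounded approximants of the gradient.\<close>

definition two_sided_test :: "real \<Rightarrow> ('a \<Rightarrow> real) \<Rightarrow> nat \<Rightarrow> (nat \<Rightarrow> 'a) \<Rightarrow> real" where
  "two_sided_test v w n \<omega> = (if v < \<bar>1 / sqrt (real n) * (\<Sum>i<n. w (\<omega> i))\<bar> then 1 else 0)"

lemma two_sided_test_in_test_sequences:
  assumes [measurable]: "w \<in> borel_measurable M"
  shows "two_sided_test v w \<in> test_sequences M"
  unfolding test_sequences_def two_sided_test_def by auto

section \<open>Comparison of tests under exponential tilts\<close>

context prob_space begin

text \<open>With the normalizing constant on the left, the likelihood on the right is the
  exponential of a statistic linear in \<open>g\<close>. Tilts by \<open>h + c e\<close> then differ
  only through a factor depending on the statistic of \<open>e\<close>.\<close>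

lemma tilt_expectation:
  fixes \<psi> :: "(nat \<Rightarrow> 'a) \<Rightarrow> real"
  assumes g: "bounded_centered g" and [measurable]: "\<psi> \<in> borel_measurable (PiM {..<n} (\<lambda>_. M))"
  shows "(\<integral>\<omega>. \<psi> \<omega> \<partial>PiM {..<n} (\<lambda>_. tilt g n)) * tilt_mass g n ^ n
    = (\<integral>\<omega>. exp (1 / sqrt (real n) * (\<Sum>i<n. g (\<omega> i))) * \<psi> \<omega> \<partial>PiM {..<n} (\<lambda>_. M))"
proof -
  have [measurable]: "tilt_root g n \<in> borel_measurable M"
    using tilt_root_L2(1)[OF g] by (rule L2_measurable)
  have "sigma_finite_measure (density M (\<lambda>x. ennreal ((tilt_root g n x)\<^sup>2)))"
    using prob_space_tilt[OF g, of n] by (simp add: tilt_def prob_space_imp_sigma_finite)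
  then have "(\<integral>\<omega>. \<psi> \<omega> \<partial>PiM {..<n} (\<lambda>_. tilt g n))
      = (\<integral>\<omega>. (\<Prod>i<n. (tilt_root g n (\<omega> i))\<^sup>2) *\<^sub>R \<psi> \<omega> \<partial>PiM {..<n} (\<lambda>_. M))"
    unfolding tilt_def
    by (intro integral_PiM_density) (auto simp: sigma_finite_measure_axioms)
  also have "\<dots> = (\<integral>\<omega>. exp (1 / sqrt (real n) * (\<Sum>i<n. g (\<omega> i))) * \<psi> \<omega> / tilt_mass g n ^ n \<partial>PiM {..<n} (\<lambda>_. M))"
    by (simp add: tilt_root_power2[OF g] prod_dividef exp_sum[symmetric] sum_divide_distrib)
  finally show ?thesis
    using tilt_mass_pos[OF g, of n] by simp
qed

lemma integrable_exp_sum: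
  assumes g: "bounded_centered g"
  shows "integrable (PiM {..<n} (\<lambda>_. M)) (\<lambda>\<omega>. exp (1 / sqrt (real n) * (\<Sum>i<n. g (\<omega> i))))"
proof -
  have int: "integrable M (\<lambda>x. exp (1 / sqrt (real n) * g x))"
    by (rule integrable_exp_bounded_centered[OF g])
  interpret product_prob_space "\<lambda>_. M" "{..<n}" ..
  have "exp (1 / sqrt (real n) * (\<Sum>i<n. g (\<omega> i))) = (\<Prod>i<n. exp (1 / sqrt (real n) * g (\<omega> i)))" for \<omega>
    by (simp add: exp_sum[symmetric] sum_distrib_left)
  then show ?thesis
    by (simp only:) (intro product_integrable_prod int finite_lessThan)
qed

lemma bounded_centered_add:
  "bounded_centered f \<Longrightarrow> bounded_centered g \<Longrightarrow> bounded_centered (\<lambda>x. f x + c * g x)"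
  using bounded_centered_lincomb[of f g 1 c] by simp

lemma two_sided_Neyman_Pearson_tilt:
  fixes n :: nat
  assumes h: "bounded_centered h" and e: "bounded_centered e" and pos: "0 < s" "0 < \<delta>" "0 < v"
    and \<psi>: "\<psi> \<in> test_sequences M"
  defines "\<Delta> \<equiv> \<lambda>g. tilt_mass g n ^ n * (test_power (two_sided_test v e) (tilt g) n - test_power \<psi> (tilt g) n)"
  shows "0 \<le> sinh (\<delta> * v) * \<Delta> (\<lambda>x. h x + s * e x) + sinh (s * v) * \<Delta> (\<lambda>x. h x + (- \<delta>) * e x)
    - sinh ((s + \<delta>) * v) * \<Delta> (\<lambda>x. h x + 0 * e x)"
proof -
  define Z where "Z g \<omega> = 1 / sqrt (real n) * (\<Sum>i<n. g (\<omega> i))" for g :: "'a \<Rightarrow> real" and \<omega>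
  define \<kappa> where "\<kappa> \<omega> = two_sided_test v e n \<omega> - \<psi> n \<omega>" for \<omega>
  let ?P = "PiM {..<n} (\<lambda>_. M)"
  have e_meas: "e \<in> borel_measurable M"
    using e by (rule bounded_centered_measurable)
  note \<phi> = two_sided_test_in_test_sequences[OF e_meas, of v]
  have [measurable]: "two_sided_test v e n \<in> borel_measurable ?P" "\<psi> n \<in> borel_measurable ?P"
    using \<phi> \<psi> by (auto simp: test_sequences_def)
  have \<kappa>_meas [measurable]: "\<kappa> \<in> borel_measurable ?P"
    unfolding \<kappa>_def by measurable
  have \<psi>01: "0 \<le> \<psi> n \<omega>" "\<psi> n \<omega> \<le> 1" if "\<omega> \<in> space ?P" for \<omega>
    using \<psi> that by (auto simp: test_sequences_def)
  have bc: "bounded_centered (\<lambda>x. h x + c * e x)" for c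
    by (rule bounded_centered_add[OF h e])
  have Z_add: "Z (\<lambda>x. h x + c * e x) \<omega> = Z h \<omega> + c * Z e \<omega>" for c \<omega>
    by (simp add: Z_def sum.distrib sum_distrib_left algebra_simps)
  have \<Delta>_eq: "\<Delta> (\<lambda>x. h x + c * e x) = (\<integral>\<omega>. exp (Z h \<omega> + c * Z e \<omega>) * \<kappa> \<omega> \<partial>?P)" for c
  proof -
    let ?g = "\<lambda>x. h x + c * e x"
    have "test_power (two_sided_test v e) (tilt ?g) n - test_power \<psi> (tilt ?g) n
        = (\<integral>\<omega>. \<kappa> \<omega> \<partial>PiM {..<n} (\<lambda>_. tilt ?g n))"
      unfolding test_power_def \<kappa>_def
      by (intro Bochner_Integration.integral_diff[symmetric] integrable_test[where M = M]
          prob_space_tilt bc sets_tilt \<phi> \<psi>)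
    then show ?thesis
      using tilt_expectation[OF bc \<kappa>_meas, of c]
      unfolding \<Delta>_def Z_add[symmetric] unfolding Z_def by (simp only: mult.commute)
  qed
  have int: "integrable ?P (\<lambda>\<omega>. exp (Z h \<omega> + c * Z e \<omega>) * \<kappa> \<omega>)" for c
  proof (rule Bochner_Integration.integrable_bound)
    show int: "integrable ?P (\<lambda>\<omega>. exp (Z h \<omega> + c * Z e \<omega>))"
      unfolding Z_add[symmetric] unfolding Z_def by (rule integrable_exp_sum[OF bc])
    show "(\<lambda>\<omega>. exp (Z h \<omega> + c * Z e \<omega>) * \<kappa> \<omega>) \<in> borel_measurable ?P"
      using int by measurable
    show "AE \<omega> in ?P. norm (exp (Z h \<omega> + c * Z e \<omega>) * \<kappa> \<omega>) \<le> norm (exp (Z h \<omega> + c * Z e \<omega>))"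
    proof (rule AE_I2)
      fix \<omega> assume "\<omega> \<in> space ?P"
      then have "\<bar>\<kappa> \<omega>\<bar> \<le> 1"
        using \<psi>01[of \<omega>] by (auto simp: \<kappa>_def two_sided_test_def abs_le_iff)
      then show "norm (exp (Z h \<omega> + c * Z e \<omega>) * \<kappa> \<omega>) \<le> norm (exp (Z h \<omega> + c * Z e \<omega>))"
        by (simp add: abs_mult)
    qed
  qed
  have "0 \<le> (\<integral>\<omega>. exp (Z h \<omega>) * (\<kappa> \<omega> * (sinh (\<delta> * v) * exp (s * Z e \<omega>)
      + sinh (s * v) * exp (- \<delta> * Z e \<omega>) - sinh ((s + \<delta>) * v))) \<partial>?P)"
  proof (rule Bochner_Integration.integral_nonneg)
    fix \<omega> assume "\<omega> \<in> space ?P"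
    then have "0 \<le> \<kappa> \<omega> * (sinh (\<delta> * v) * exp (s * Z e \<omega>)
      + sinh (s * v) * exp (- \<delta> * Z e \<omega>) - sinh ((s + \<delta>) * v))"
      using two_sided_Neyman_Pearson_pointwise[OF pos, of "\<psi> n \<omega>" "Z e \<omega>"] \<psi>01
      by (simp add: \<kappa>_def two_sided_test_def Z_def)
    then show "0 \<le> exp (Z h \<omega>) * (\<kappa> \<omega> * (sinh (\<delta> * v) * exp (s * Z e \<omega>)
      + sinh (s * v) * exp (- \<delta> * Z e \<omega>) - sinh ((s + \<delta>) * v)))"
      by simp
  qed
  also have "\<dots> = (\<integral>\<omega>. sinh (\<delta> * v) * (exp (Z h \<omega> + s * Z e \<omega>) * \<kappa> \<omega>)
      + sinh (s * v) * (exp (Z h \<omega> + (- \<delta>) * Z e \<omega>) * \<kappa> \<omega>)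
      - sinh ((s + \<delta>) * v) * (exp (Z h \<omega> + 0 * Z e \<omega>) * \<kappa> \<omega>) \<partial>?P)"
    by (intro Bochner_Integration.integral_cong refl) (simp add: exp_add exp_diff exp_minus field_simps)
  also have "\<dots> = sinh (\<delta> * v) * \<Delta> (\<lambda>x. h x + s * e x) + sinh (s * v) * \<Delta> (\<lambda>x. h x + (- \<delta>) * e x)
    - sinh ((s + \<delta>) * v) * \<Delta> (\<lambda>x. h x + 0 * e x)"
    unfolding \<Delta>_eq
    by (subst Bochner_Integration.integral_diff Bochner_Integration.integral_add integral_mult_right_zero;
        (intro Bochner_Integration.integrable_add integrable_mult_right int)?)+ simp
  finally show ?thesis .
qed

lemma test_power_tilt_two_sided:
  assumes "bounded_centered g" "w \<in> L2_centered M" "0 < L2_norm M w" "0 < v"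
  shows "(\<lambda>n. test_power (two_sided_test v w) (tilt g) n) \<longlonglongrightarrow> two_sided_power v (\<integral>x. g x * w x \<partial>M) (L2_norm M w)"
  unfolding test_power_def two_sided_test_def by (rule tilt_central_limit[OF assms])

text \<open>Three errors of size \<open>\<eta> / 4\<close> are combined: replacing \<open>Q\<close>
  by the tilt of a bounded approximant, the central limit theorem under that tilt, and the
  continuity of the limiting power in the tangent.\<close>

lemma test_power_local_two_sided:
  assumes Q: "local_tangent Q g" and w: "w \<in> L2_centered M" and pos: "0 < L2_norm M w" "0 < v"
  shows "test_power (two_sided_test v w) Q \<longlonglongrightarrow> two_sided_power v (\<integral>x. g x * w x \<partial>M) (L2_norm M w)"
proof (rule tendstoI)
  fix \<eta> :: real assume \<eta>: "0 < \<eta>"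
  let ?\<phi> = "two_sided_test v w" and ?\<beta> = "\<lambda>g. two_sided_power v (\<integral>x. g x * w x \<partial>M) (L2_norm M w)"
  have wL2: "w \<in> L2 M" using w by (simp add: L2_centered_def)
  obtain G where G: "\<And>j. bounded_centered (G j)" and lim: "L2_lim M G g"
    using L2_lim_bounded_centered[OF local_tangent_centered[OF Q]] by auto
  have "(\<lambda>j. ?\<beta> (G j)) \<longlonglongrightarrow> ?\<beta> g"
    by (intro tendsto_two_sided_power L2_lim_inner lim L2_lim_const wL2 tendsto_const pos)
  then have "\<forall>\<^sub>F j in sequentially. dist (?\<beta> (G j)) (?\<beta> g) < \<eta> / 4"
    using \<eta> by (intro tendstoD) auto
  moreover have "\<forall>\<^sub>F j in sequentially. L2_norm M (\<lambda>x. G j x - g x) < \<eta> / 4"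
    using lim \<eta> by (intro order_tendstoD(2)[of _ 0]) (auto simp: L2_lim_def)
  ultimately have "\<forall>\<^sub>F j in sequentially. dist (?\<beta> (G j)) (?\<beta> g) < \<eta> / 4 \<and> L2_norm M (\<lambda>x. G j x - g x) < \<eta> / 4"
    by (rule eventually_conj)
  then obtain j where j: "dist (?\<beta> (G j)) (?\<beta> g) < \<eta> / 4" "L2_norm M (\<lambda>x. G j x - g x) < \<eta> / 4"
    by (auto simp: eventually_sequentially)
  obtain b where b: "b \<longlonglongrightarrow> L2_norm M (\<lambda>x. g x - G j x)"
    "\<And>n. \<bar>test_power ?\<phi> Q n - test_power ?\<phi> (tilt (G j)) n\<bar> \<le> b n"
    using local_tangent_test_power[OF Q G two_sided_test_in_test_sequences[OF L2_measurable[OF wL2]]] by blast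
  have "\<forall>\<^sub>F n in sequentially. b n < \<eta> / 4"
    using b(1) j(2) by (intro order_tendstoD) (auto simp: L2_norm_minus_commute[of M g])
  moreover have "\<forall>\<^sub>F n in sequentially. dist (test_power ?\<phi> (tilt (G j)) n) (?\<beta> (G j)) < \<eta> / 4"
    using \<eta> by (intro tendstoD test_power_tilt_two_sided G w pos) simp
  ultimately show "\<forall>\<^sub>F n in sequentially. dist (test_power ?\<phi> Q n) (?\<beta> g) < \<eta>"
  proof eventually_elim
    case (elim n)
    then show ?case
      using b(2)[of n] j(1) unfolding dist_real_def abs_less_iff abs_le_iff by linarith
  qed
qed

text \<open>
  Integrating the pointwise inequality against tilts with tangents near \<open>h + s e\<close>, \<open>h - \<delta> e\<close> and
  \<open>h\<close> bounds the power of \<open>\<psi>\<close> at \<open>h + s e\<close> from above by its power at \<open>h\<close> (at most \<open>\<alpha>\<close>) and at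
  \<open>h - \<delta> e\<close> (at least \<open>\<alpha>\<close>).  The excess \<open>(\<beta>(\<delta>) - \<alpha>) / sinh (\<delta> v)\<close> vanishes as \<open>\<delta>\<close> tends to \<open>0\<close>,
  because the derivative of the two-sided power function at \<open>0\<close> is \<open>0\<close>.
\<close>

theorem two_sided_power_envelope:
  assumes \<psi>: "\<psi> \<in> test_sequences M"
    and h: "h \<in> L2_centered M" and e: "e \<in> L2_centered M" and orth: "(\<integral>x. h x * e x \<partial>M) = 0"
    and \<sigma>: "0 < L2_norm M e" and s: "0 < s" and v: "0 < v"
    and Q: "local_tangent Q (\<lambda>x. h x + s * e x)"
    and null: "L2_lim M w0 h" "\<And>j. local_tangent (Q0 j) (w0 j)"
      "\<And>j. limsup (\<lambda>n. ereal (test_power \<psi> (Q0 j) n)) \<le> two_sided_power v 0 (L2_norm M e)"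
    and alt: "\<And>\<delta>. 0 < \<delta> \<Longrightarrow> L2_lim M (w1 \<delta>) (\<lambda>x. h x + (- \<delta>) * e x)"
      "\<And>\<delta> j. 0 < \<delta> \<Longrightarrow> local_tangent (Q1 \<delta> j) (w1 \<delta> j)"
      "\<And>\<delta> j. 0 < \<delta> \<Longrightarrow>
        two_sided_power v 0 (L2_norm M e) \<le> liminf (\<lambda>n. ereal (test_power \<psi> (Q1 \<delta> j) n))"
  shows "limsup (\<lambda>n. ereal (test_power \<psi> Q n)) \<le> two_sided_power v (s * (\<integral>x. (e x)\<^sup>2 \<partial>M)) (L2_norm M e)"
proof (rule ccontr)
  define \<sigma> where "\<sigma> = L2_norm M e"
  define \<alpha> where "\<alpha> = two_sided_power v 0 \<sigma>"
  define \<beta> where "\<beta> m = two_sided_power v m \<sigma>" for m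
  have \<sigma>0: "0 < \<sigma>" using \<sigma> by (simp add: \<sigma>_def)
  have hL2: "h \<in> L2 M" and eL2: "e \<in> L2 M"
    using h e by (auto simp: L2_centered_def)
  have inner_e: "(\<integral>x. (h x + c * e x) * e x \<partial>M) = c * \<sigma>\<^sup>2" for c
  proof -
    have "(\<integral>x. (h x + c * e x) * e x \<partial>M) = (\<integral>x. h x * e x + c * (e x)\<^sup>2 \<partial>M)"
      by (simp add: algebra_simps power2_eq_square)
    also have "\<dots> = c * \<sigma>\<^sup>2"
      using L2_integrable_mult[OF hL2 eL2] L2_integrable_square[OF eL2] orth
      by (simp add: \<sigma>_def L2_norm_power2)
    finally show ?thesis .
  qed
  define N2 where "N2 c = (\<integral>x. (h x + c * e x)\<^sup>2 \<partial>M)" for c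
  have N2_eq: "N2 c = (\<integral>x. (h x)\<^sup>2 \<partial>M) + c\<^sup>2 * \<sigma>\<^sup>2" for c
  proof -
    have "(\<integral>x. h x * (c * e x) \<partial>M) = c * (\<integral>x. h x * e x \<partial>M)"
      by (simp flip: integral_mult_right_zero add: algebra_simps)
    then show ?thesis
      unfolding N2_def L2_integral_square_add[OF hL2 L2_cmult[OF eL2]]
      by (simp add: orth power_mult_distrib \<sigma>_def L2_norm_power2)
  qed
  assume "\<not> ?thesis"
  then have "ereal (\<beta> (s * \<sigma>\<^sup>2)) < limsup (\<lambda>n. ereal (test_power \<psi> Q n))"
    by (simp add: \<beta>_def \<sigma>_def L2_norm_power2)
  from ereal_dense2[OF this] obtain y where
    y: "\<beta> (s * \<sigma>\<^sup>2) < y" "ereal y < limsup (\<lambda>n. ereal (test_power \<psi> Q n))"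
    by auto
  \<comment> \<open>A filter of indices along which the power of \<open>\<psi>\<close> exceeds \<open>y\<close>, in place of a subsequence.\<close>
  define F where "F = inf sequentially (principal {n. y < test_power \<psi> Q n})"
  have F_le: "F \<le> sequentially" by (simp add: F_def)
  have F_ev: "\<forall>\<^sub>F n in F. y < test_power \<psi> Q n"
    by (simp add: F_def eventually_inf_principal)
  \<comment> \<open>Properness of the filter says that the power exceeds \<open>y\<close> infinitely
    often; inequalities can then be passed to the limit along \<open>F\<close>.\<close>
  have F_bot: "F \<noteq> bot"
  proof
    assume "F = bot"
    then have "\<forall>\<^sub>F n in sequentially. test_power \<psi> Q n \<le> y"
      unfolding F_def trivial_limit_def eventually_inf_principal by (simp add: not_less)
    then have "limsup (\<lambda>n. ereal (test_power \<psi> Q n)) \<le> ereal y"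
      by (intro Limsup_bounded) simp
    with y(2) show False by simp
  qed
  obtain H where H: "\<And>j. bounded_centered (H j)" and H_lim: "L2_lim M H h"
    using L2_lim_bounded_centered[OF h] by auto
  obtain E where E: "\<And>j. bounded_centered (E j)" and E_lim: "L2_lim M E e"
    using L2_lim_bounded_centered[OF e] by auto
  define G where "G c j x = H j x + c * E j x" for c j x
  have G: "bounded_centered (G c j)" for c j
    unfolding G_def by (rule bounded_centered_add[OF H E])
  have G_lim: "L2_lim M (G c) (\<lambda>x. h x + c * e x)" for c
    unfolding G_def by (intro L2_lim_add L2_lim_cmult H_lim E_lim)
  \<comment> \<open>For fixed \<open>j\<close>, \<open>B\<close> and \<open>C\<close> are the limits
    in \<open>n\<close> of the power of the comparison test and of the normalizing constant under
    the tilt by \<open>G c j\<close>.\<close>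
  define B where "B c j = two_sided_power v (\<integral>x. G c j x * E j x \<partial>M) (L2_norm M (E j))" for c j
  define C where "C c j = exp ((\<integral>x. (G c j x)\<^sup>2 \<partial>M) / 2)" for c j
  have B_lim: "B c \<longlonglongrightarrow> \<beta> (c * \<sigma>\<^sup>2)" for c
    unfolding B_def \<beta>_def inner_e[of c, symmetric] unfolding \<sigma>_def
    by (intro tendsto_two_sided_power L2_lim_inner L2_lim_norm G_lim E_lim \<sigma>)
  have C_lim: "C c \<longlonglongrightarrow> exp (N2 c / 2)" for c
  proof -
    have "(\<lambda>j. \<integral>x. (G c j x)\<^sup>2 \<partial>M) \<longlonglongrightarrow> N2 c"
      unfolding N2_def power2_eq_square by (intro L2_lim_inner G_lim)
    then show ?thesis
      unfolding C_def by (intro tendsto_intros) auto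
  qed
  have E_pos: "\<forall>\<^sub>F j in sequentially. 0 < L2_norm M (E j)"
    using L2_lim_norm[OF E_lim] \<sigma> by (rule order_tendstoD)
  have at_\<delta>: "0 \<le> exp (N2 s / 2) * (\<beta> (s * \<sigma>\<^sup>2) - y)
      + sinh (s * v) * exp (N2 (- \<delta>) / 2) * ((\<beta> ((- \<sigma>\<^sup>2) * \<delta>) - \<beta> 0) / sinh (\<delta> * v))"
    if \<delta>: "0 < \<delta>" for \<delta>
  proof -
    define d where "d j = L2_norm M (\<lambda>x. (h x + s * e x) - G s j x)" for j
    define d0 where "d0 j = L2_norm M (\<lambda>x. w0 j x - G 0 j x)" for j
    define d1 where "d1 j = L2_norm M (\<lambda>x. w1 \<delta> j x - G (- \<delta>) j x)" for j
    \<comment> \<open>A slack vanishing with \<open>j\<close>, which turns the limsup and liminf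
      conditions into inequalities for all large \<open>n\<close>.\<close>
    define \<epsilon> where "\<epsilon> j = 1 / real (Suc j)" for j
    have \<epsilon>0: "\<epsilon> \<longlonglongrightarrow> 0"
      unfolding \<epsilon>_def by (rule LIMSEQ_Suc) (rule lim_1_over_n)
    have zero: "(\<lambda>j. L2_norm M (\<lambda>x. F1 j x - F2 j x)) \<longlonglongrightarrow> 0" if "L2_lim M F1 f" "L2_lim M F2 f" for F1 F2 f
      using L2_lim_norm[OF L2_lim_diff[OF that]] by (simp add: L2_norm_def)
    have d_lim: "d \<longlonglongrightarrow> 0"
      unfolding d_def
      by (rule zero[OF L2_lim_const G_lim]) (use Q in \<open>simp add: local_tangent_def\<close>)
    have d0_lim: "d0 \<longlonglongrightarrow> 0"
      unfolding d0_def using zero[OF null(1), of "G 0"] G_lim[of 0] by simp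
    have d1_lim: "d1 \<longlonglongrightarrow> 0"
      unfolding d1_def by (intro zero[OF alt(1)[OF \<delta>]] G_lim)
    have step: "0 \<le> sinh (\<delta> * v) * (C s j * (B s j - (y - d j)))
        + sinh (s * v) * (C (- \<delta>) j * (B (- \<delta>) j - (\<alpha> - \<epsilon> j - d1 j)))
        - sinh ((s + \<delta>) * v) * (C 0 j * (B 0 j - (\<alpha> + \<epsilon> j + d0 j)))"
      if Ej: "0 < L2_norm M (E j)" for j
    proof -
      obtain b where b: "b \<longlonglongrightarrow> d j" "\<And>n. \<bar>test_power \<psi> Q n - test_power \<psi> (tilt (G s j)) n\<bar> \<le> b n"
        using local_tangent_test_power[OF Q G \<psi>] unfolding d_def by blast
      obtain b0 where b0: "b0 \<longlonglongrightarrow> d0 j" "\<And>n. \<bar>test_power \<psi> (Q0 j) n - test_power \<psi> (tilt (G 0 j)) n\<bar> \<le> b0 n"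
        using local_tangent_test_power[OF null(2) G \<psi>] unfolding d0_def by blast
      obtain b1 where b1: "b1 \<longlonglongrightarrow> d1 j"
        "\<And>n. \<bar>test_power \<psi> (Q1 \<delta> j) n - test_power \<psi> (tilt (G (- \<delta>) j)) n\<bar> \<le> b1 n"
        using local_tangent_test_power[OF alt(2)[OF \<delta>] G \<psi>] unfolding d1_def by blast
      have "\<epsilon> j > 0" by (simp add: \<epsilon>_def)
      have "limsup (\<lambda>n. ereal (test_power \<psi> (Q0 j) n)) < ereal (\<alpha> + \<epsilon> j)"
        using null(3)[of j] \<open>\<epsilon> j > 0\<close> by (auto simp: \<alpha>_def \<sigma>_def intro: le_less_trans)
      then have ev0: "\<forall>\<^sub>F n in sequentially. test_power \<psi> (Q0 j) n < \<alpha> + \<epsilon> j"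
        using Limsup_lessD by fastforce
      have "ereal (\<alpha> - \<epsilon> j) < liminf (\<lambda>n. ereal (test_power \<psi> (Q1 \<delta> j) n))"
        using \<open>\<epsilon> j > 0\<close> by (intro less_le_trans[OF _ alt(3)[OF \<delta>]]) (simp add: \<alpha>_def \<sigma>_def)
      then have ev1: "\<forall>\<^sub>F n in sequentially. \<alpha> - \<epsilon> j < test_power \<psi> (Q1 \<delta> j) n"
        using less_LiminfD by fastforce
      let ?m = "\<lambda>c n. tilt_mass (G c j) n ^ n" and ?\<phi> = "\<lambda>c n. test_power (two_sided_test v (E j)) (tilt (G c j)) n"
      have m_lim: "(?m c \<longlongrightarrow> C c j) F" for c
        unfolding C_def using F_le by (rule tendsto_mono) (rule tilt_mass_expansion[OF G])
      have \<phi>_lim: "(?\<phi> c \<longlongrightarrow> B c j) F" for c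
        unfolding B_def using F_le
        by (rule tendsto_mono) (intro test_power_tilt_two_sided G bounded_centered_L2 E Ej v)
      have lim: "((\<lambda>n. sinh (\<delta> * v) * (?m s n * (?\<phi> s n - (y - b n)))
        + sinh (s * v) * (?m (- \<delta>) n * (?\<phi> (- \<delta>) n - (\<alpha> - \<epsilon> j - b1 n)))
        - sinh ((s + \<delta>) * v) * (?m 0 n * (?\<phi> 0 n - (\<alpha> + \<epsilon> j + b0 n))))
        \<longlongrightarrow> sinh (\<delta> * v) * (C s j * (B s j - (y - d j)))
        + sinh (s * v) * (C (- \<delta>) j * (B (- \<delta>) j - (\<alpha> - \<epsilon> j - d1 j)))
        - sinh ((s + \<delta>) * v) * (C 0 j * (B 0 j - (\<alpha> + \<epsilon> j + d0 j)))) F"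
        by (intro tendsto_intros m_lim \<phi>_lim tendsto_mono[OF F_le b(1)] tendsto_mono[OF F_le b0(1)]
            tendsto_mono[OF F_le b1(1)])
      show ?thesis
      proof (rule tendsto_lowerbound[OF lim _ F_bot])
        show "\<forall>\<^sub>F n in F. 0 \<le> sinh (\<delta> * v) * (?m s n * (?\<phi> s n - (y - b n)))
          + sinh (s * v) * (?m (- \<delta>) n * (?\<phi> (- \<delta>) n - (\<alpha> - \<epsilon> j - b1 n)))
          - sinh ((s + \<delta>) * v) * (?m 0 n * (?\<phi> 0 n - (\<alpha> + \<epsilon> j + b0 n)))"
          using F_ev filter_leD[OF F_le ev0] filter_leD[OF F_le ev1]
        proof eventually_elim
          case (elim n)
          let ?\<psi> = "\<lambda>c. test_power \<psi> (tilt (G c j)) n"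
          have sinh_pos: "0 \<le> sinh (\<delta> * v)" "0 \<le> sinh (s * v)" "0 \<le> sinh ((s + \<delta>) * v)"
            using \<delta> s v by simp_all
          have m_pos: "0 \<le> ?m c n" for c
            using tilt_mass_pos[OF G, of c j n] by simp
          have "0 \<le> sinh (\<delta> * v) * (?m s n * (?\<phi> s n - ?\<psi> s))
            + sinh (s * v) * (?m (- \<delta>) n * (?\<phi> (- \<delta>) n - ?\<psi> (- \<delta>)))
            - sinh ((s + \<delta>) * v) * (?m 0 n * (?\<phi> 0 n - ?\<psi> 0))"
            unfolding G_def by (rule two_sided_Neyman_Pearson_tilt[OF H E s \<delta> v \<psi>])
          \<comment> \<open>The signs of the weights match the available bounds: \<psi> is bounded
            below at \<open>s\<close> by the choice of \<open>F\<close> and at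
            \<open>- \<delta>\<close> by unbiasedness, and above at 0, where the weight is negative,
            by the level.\<close>
          also have "\<dots> \<le> sinh (\<delta> * v) * (?m s n * (?\<phi> s n - (y - b n)))
            + sinh (s * v) * (?m (- \<delta>) n * (?\<phi> (- \<delta>) n - (\<alpha> - \<epsilon> j - b1 n)))
            - sinh ((s + \<delta>) * v) * (?m 0 n * (?\<phi> 0 n - (\<alpha> + \<epsilon> j + b0 n)))"
            using elim b(2)[of n] b0(2)[of n] b1(2)[of n]
            by (intro add_mono diff_mono mult_left_mono sinh_pos m_pos) auto
          finally show ?case .
        qed
      qed
    qed
    have "0 \<le> sinh (\<delta> * v) * (exp (N2 s / 2) * (\<beta> (s * \<sigma>\<^sup>2) - (y - 0)))
        + sinh (s * v) * (exp (N2 (- \<delta>) / 2) * (\<beta> ((- \<delta>) * \<sigma>\<^sup>2) - (\<alpha> - 0 - 0)))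
        - sinh ((s + \<delta>) * v) * (exp (N2 0 / 2) * (\<beta> (0 * \<sigma>\<^sup>2) - (\<alpha> + 0 + 0)))"
    proof (rule tendsto_lowerbound)
      show "(\<lambda>j. sinh (\<delta> * v) * (C s j * (B s j - (y - d j)))
        + sinh (s * v) * (C (- \<delta>) j * (B (- \<delta>) j - (\<alpha> - \<epsilon> j - d1 j)))
        - sinh ((s + \<delta>) * v) * (C 0 j * (B 0 j - (\<alpha> + \<epsilon> j + d0 j))))
        \<longlonglongrightarrow> sinh (\<delta> * v) * (exp (N2 s / 2) * (\<beta> (s * \<sigma>\<^sup>2) - (y - 0)))
        + sinh (s * v) * (exp (N2 (- \<delta>) / 2) * (\<beta> ((- \<delta>) * \<sigma>\<^sup>2) - (\<alpha> - 0 - 0)))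
        - sinh ((s + \<delta>) * v) * (exp (N2 0 / 2) * (\<beta> (0 * \<sigma>\<^sup>2) - (\<alpha> + 0 + 0)))"
        by (intro tendsto_intros B_lim C_lim d_lim d0_lim d1_lim \<epsilon>0)
    qed (use E_pos step in \<open>auto elim: eventually_mono\<close>)
    \<comment> \<open>The third term has disappeared because the limiting two-sided power at mean 0
      is exactly \<alpha>.\<close>
    then have "0 \<le> sinh (\<delta> * v) * (exp (N2 s / 2) * (\<beta> (s * \<sigma>\<^sup>2) - y))
        + sinh (s * v) * exp (N2 (- \<delta>) / 2) * (\<beta> ((- \<sigma>\<^sup>2) * \<delta>) - \<beta> 0)"
      by (simp add: \<alpha>_def \<beta>_def mult.commute[of \<delta>] mult.assoc)
    moreover have "0 < sinh (\<delta> * v)" using \<delta> v by simp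
    ultimately have "0 \<le> (sinh (\<delta> * v) * (exp (N2 s / 2) * (\<beta> (s * \<sigma>\<^sup>2) - y))
        + sinh (s * v) * exp (N2 (- \<delta>) / 2) * (\<beta> ((- \<sigma>\<^sup>2) * \<delta>) - \<beta> 0)) / sinh (\<delta> * v)"
      by (intro divide_nonneg_pos)
    also have "\<dots> = exp (N2 s / 2) * (\<beta> (s * \<sigma>\<^sup>2) - y)
        + sinh (s * v) * exp (N2 (- \<delta>) / 2) * ((\<beta> ((- \<sigma>\<^sup>2) * \<delta>) - \<beta> 0) / sinh (\<delta> * v))"
      using \<delta> v by (simp add: add_divide_distrib)
    finally show ?thesis .
  qed
  have "((\<lambda>\<delta>. N2 (- \<delta>)) \<longlongrightarrow> N2 (- 0)) (at_right 0)"
    unfolding N2_eq by (intro tendsto_intros)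
  then have "((\<lambda>\<delta>. exp (N2 s / 2) * (\<beta> (s * \<sigma>\<^sup>2) - y)
      + sinh (s * v) * exp (N2 (- \<delta>) / 2) * ((\<beta> ((- \<sigma>\<^sup>2) * \<delta>) - \<beta> 0) / sinh (\<delta> * v)))
      \<longlongrightarrow> exp (N2 s / 2) * (\<beta> (s * \<sigma>\<^sup>2) - y) + sinh (s * v) * exp (N2 (- 0) / 2) * 0) (at_right 0)"
    unfolding \<beta>_def using \<sigma>0 v
    by (intro tendsto_intros two_sided_power_locally_flat) auto
  then have "0 \<le> exp (N2 s / 2) * (\<beta> (s * \<sigma>\<^sup>2) - y) + sinh (s * v) * exp (N2 (- 0) / 2) * 0"
    by (rule tendsto_lowerbound)
      (use at_\<delta> in \<open>auto intro: eventually_at_right_less[THEN eventually_mono]\<close>)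
  then have "0 \<le> \<beta> (s * \<sigma>\<^sup>2) - y"
    by (simp add: zero_le_mult_iff)
  with y(1) show False by simp
qed

end

section \<open>Curves, local sequences and the optimality proof\<close>

lemma test_sequences_cong:
  assumes "sets M = sets N"
  shows "test_sequences M = test_sequences N"
proof -
  have sets_eq: "sets (PiM {..<n} (\<lambda>_. M)) = sets (PiM {..<n} (\<lambda>_. N))" for n
    by (intro sets_PiM_cong refl assms)
  show ?thesis
    unfolding test_sequences_def sets_eq_imp_space_eq[OF sets_eq] measurable_cong_sets[OF sets_eq refl] ..
qed

context prob_space begin

lemma local_sequences_local_tangent:
  assumes Q: "Q \<in> local_sequences M \<P>" and k: "has_gradient k M \<P> k'"
    and \<P>: "\<And>P. P \<in> \<P> \<Longrightarrow> prob_space P \<and> sets P = sets M"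
  shows "\<exists>c g. g \<in> tangent_cone M \<P> \<and> local_tangent Q (\<lambda>x. c * g x) \<and>
    (\<lambda>n. sqrt (real n) * (k (Q n) - k M)) \<longlonglongrightarrow> c * (\<integral>x. k' x * g x \<partial>M)"
proof -
  obtain t \<epsilon> f g c where t: "t \<longlonglongrightarrow> 0" "(\<lambda>n. t n * sqrt (real n)) \<longlonglongrightarrow> c" "0 < c"
    and f: "differentiable_curve \<P> M \<epsilon> f g" and Q_eq: "\<forall>n. \<bar>t n\<bar> < \<epsilon> \<and> Q n = f (t n)"
    using Q unfolding local_sequences_def mem_Collect_eq by blast
  from Q_eq have t_less: "\<And>n. \<bar>t n\<bar> < \<epsilon>" and "Q = (\<lambda>n. f (t n))" by auto
  note this(2)
  moreover have "g \<in> tangent_cone M \<P>"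
    using f by (auto simp: tangent_cone_def)
  ultimately show ?thesis
    using differentiable_curve_local_tangent[OF f \<P> t t_less] has_gradient_local[OF k f t] by blast
qed

lemma tangent_cone_local_sequence:
  assumes g: "g \<in> tangent_cone M \<P>" and k: "has_gradient k M \<P> k'"
    and \<P>: "\<And>P. P \<in> \<P> \<Longrightarrow> prob_space P \<and> sets P = sets M"
  shows "\<exists>Q \<in> local_sequences M \<P>. local_tangent Q g \<and>
    (\<lambda>n. sqrt (real n) * (k (Q n) - k M)) \<longlonglongrightarrow> (\<integral>x. k' x * g x \<partial>M)"
proof -
  obtain \<epsilon> f where f: "differentiable_curve \<P> M \<epsilon> f g"
    using g by (auto simp: tangent_cone_def)
  have \<epsilon>: "0 < \<epsilon>" using f by (simp add: differentiable_curve_def)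
  \<comment> \<open>The cap \<open>\<epsilon> / 2\<close> keeps every \<open>t n\<close> in the
    domain of the curve. It is eventually inactive, so \<open>t n * sqrt n\<close> tends to 1 and
    the local tangent is \<open>g\<close> itself without a factor.\<close>
  define t where "t n = min (1 / sqrt (real n)) (\<epsilon> / 2)" for n :: nat
  have "\<forall>\<^sub>F n in sequentially. 1 / sqrt (real n) < \<epsilon> / 2"
    using inverse_sqrt_tendsto_0 \<epsilon> by (intro order_tendstoD) auto
  then have ev: "\<forall>\<^sub>F n in sequentially. 1 / sqrt (real n) = t n"
    by eventually_elim (simp add: t_def)
  have t0: "t \<longlonglongrightarrow> 0"
    using inverse_sqrt_tendsto_0 ev by (rule Lim_transform_eventually)
  have t1: "(\<lambda>n. t n * sqrt (real n)) \<longlonglongrightarrow> 1"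
  proof (rule tendsto_eventually)
    show "\<forall>\<^sub>F n in sequentially. t n * sqrt (real n) = 1"
      using ev eventually_gt_at_top[of 0]
    proof eventually_elim
      case (elim n)
      then show ?case by (simp flip: elim(1))
    qed
  qed
  have t_less: "\<bar>t n\<bar> < \<epsilon>" for n
    using \<epsilon> by (simp add: t_def min_def)
  have "(\<lambda>n. f (t n)) \<in> local_sequences M \<P>"
    unfolding local_sequences_def using t0 t1 f t_less zero_less_one[where 'a = real] by blast
  moreover have "local_tangent (\<lambda>n. f (t n)) g"
    using differentiable_curve_local_tangent[OF f \<P> t0 t1 _ t_less] by simp
  moreover have "(\<lambda>n. sqrt (real n) * (k (f (t n)) - k M)) \<longlonglongrightarrow> (\<integral>x. k' x * g x \<partial>M)"
    using has_gradient_local[OF k f t0 t1] by simp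
  ultimately show ?thesis by blast
qed

end

theorem mainTheorem10:
  fixes M :: "'a measure" and \<P> :: "'a measure set" and P\<^sub>0 :: "'a measure"
    and k :: "'a measure \<Rightarrow> real" and k' :: "'a \<Rightarrow> real" and \<alpha> :: real
  assumes "\<P> \<subseteq> space (prob_algebra M)"
    and "P\<^sub>0 \<in> \<P>"
    and "canonical_gradient k P\<^sub>0 \<P> k'"
    and "(\<integral>x. (k' x)\<^sup>2 \<partial>P\<^sub>0) \<noteq> 0"
    and "0 < \<alpha>" and "\<alpha> < 1"
    and "L2_dense P\<^sub>0 (tangent_cone P\<^sub>0 \<P>) (tangent_space P\<^sub>0 \<P>)"
    and "L2_dense P\<^sub>0 (tangent_cone P\<^sub>0 \<P> \<inter> gradient_complement k' P\<^sub>0 \<P>)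
           (gradient_complement k' P\<^sub>0 \<P>)"
  shows "asymptotically_optimal (local_sequences P\<^sub>0 \<P>)
           (asymptotically_unbiased_tests M \<alpha>
              (implicit_hypotheses k P\<^sub>0 \<P>) (implicit_alternatives k P\<^sub>0 \<P>))
           (two_sided_gradient_test \<alpha> P\<^sub>0 k')"
proof -
  have \<P>M: "prob_space P \<and> sets P = sets M" if "P \<in> \<P>" for P
    using assms(1) that by (auto simp: space_prob_algebra)
  interpret P0: prob_space P\<^sub>0
    using \<P>M assms(2) by blast
  have \<P>: "prob_space P \<and> sets P = sets P\<^sub>0" if "P \<in> \<P>" for P
    using \<P>M[OF that] \<P>M[OF assms(2)] by simp
  have tests: "test_sequences M = test_sequences P\<^sub>0"
    using \<P>M[OF assms(2)] by (intro test_sequences_cong) simp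
  have k: "has_gradient k P\<^sub>0 \<P> k'" and k'_T: "k' \<in> tangent_space P\<^sub>0 \<P>"
    using assms(3) by (auto simp: canonical_gradient_def)
  have k'_centered: "k' \<in> L2_centered P\<^sub>0"
    using k by (simp add: has_gradient_def)
  then have k'L2: "k' \<in> L2 P\<^sub>0" by (simp add: L2_centered_def)
  define \<sigma> where "\<sigma> = L2_norm P\<^sub>0 k'"
  have \<sigma>2: "(\<integral>x. (k' x)\<^sup>2 \<partial>P\<^sub>0) = \<sigma>\<^sup>2"
    by (simp add: \<sigma>_def L2_norm_power2)
  have \<sigma>: "0 < \<sigma>"
    using assms(4) L2_norm_nonneg[of P\<^sub>0 k'] unfolding \<sigma>2 by (simp add: \<sigma>_def)
  define v where "v = std_normal_quantile (1 - \<alpha> / 2) * \<sigma>"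
  have v: "0 < v"
    unfolding v_def using \<sigma> assms(5,6) by (intro mult_pos_pos std_normal_quantile_pos) auto
  have level: "two_sided_power v 0 \<sigma> = \<alpha>"
    unfolding v_def using assms(5,6) \<sigma> by (rule two_sided_power_level)
  define \<phi> where "\<phi> = two_sided_gradient_test \<alpha> P\<^sub>0 k'"
  have \<phi>_eq: "\<phi> = two_sided_test v k'"
    by (intro ext) (simp add: \<phi>_def two_sided_gradient_test_def two_sided_test_def v_def \<sigma>_def)
  have \<phi>_lim: "test_power \<phi> Q \<longlonglongrightarrow> two_sided_power v (\<integral>x. k' x * w x \<partial>P\<^sub>0) \<sigma>"
    if "P0.local_tangent Q w" for Q w
    using P0.test_power_local_two_sided[OF that k'_centered _ v] \<sigma>
    by (simp add: \<phi>_eq \<sigma>_def mult.commute)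
  let ?\<H> = "implicit_hypotheses k P\<^sub>0 \<P>" and ?\<K> = "implicit_alternatives k P\<^sub>0 \<P>"
  let ?\<Psi> = "asymptotically_unbiased_tests M \<alpha> ?\<H> ?\<K>"
  have local: "\<exists>c g. g \<in> tangent_cone P\<^sub>0 \<P> \<and> P0.local_tangent Q (\<lambda>x. c * g x) \<and>
      (\<lambda>n. sqrt (real n) * (k (Q n) - k P\<^sub>0)) \<longlonglongrightarrow> (\<integral>x. k' x * (c * g x) \<partial>P\<^sub>0)"
    if "Q \<in> local_sequences P\<^sub>0 \<P>" for Q
    using P0.local_sequences_local_tangent[OF that k \<P>]
    by (simp add: mult.left_commute[of "k' _"])
  have cone_L2: "tangent_cone P\<^sub>0 \<P> \<subseteq> L2 P\<^sub>0"
    by (auto simp: tangent_cone_def differentiable_curve_def)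
  have cone_T: "tangent_cone P\<^sub>0 \<P> \<subseteq> tangent_space P\<^sub>0 \<P>"
    using assms(7) by (simp add: L2_dense_def)
  have T_lincomb: "(\<lambda>x. a * f x + b * g x) \<in> tangent_space P\<^sub>0 \<P>"
    if "f \<in> tangent_space P\<^sub>0 \<P>" "g \<in> tangent_space P\<^sub>0 \<P>" for a b f g
    using that unfolding tangent_space_def by (rule L2_closure_linear_span_lincomb[OF cone_L2])
  have null_level: "limsup (\<lambda>n. ereal (test_power \<psi> Q n)) \<le> \<alpha>"
    if "\<psi> \<in> ?\<Psi>" "Q \<in> ?\<H>" for \<psi> Q
    using that by (auto simp: asymptotically_unbiased_tests_def)
  have alt_level: "\<alpha> \<le> liminf (\<lambda>n. ereal (test_power \<psi> Q n))"
    if "\<psi> \<in> ?\<Psi>" "Q \<in> ?\<K>" for \<psi> Q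
    using that by (auto simp: asymptotically_unbiased_tests_def)
  have \<phi>_in: "\<phi> \<in> ?\<Psi>"
  proof -
    have "\<phi> \<in> test_sequences M"
      unfolding tests \<phi>_eq by (rule two_sided_test_in_test_sequences[OF L2_measurable[OF k'L2]])
    moreover have "limsup (\<lambda>n. ereal (test_power \<phi> Q n)) \<le> \<alpha>" if "Q \<in> ?\<H>" for Q
    proof -
      have Q: "Q \<in> local_sequences P\<^sub>0 \<P>" "(\<lambda>n. sqrt (real n) * (k (Q n) - k P\<^sub>0)) \<longlonglongrightarrow> 0"
        using that by (auto simp: implicit_hypotheses_def)
      obtain c g where cg: "P0.local_tangent Q (\<lambda>x. c * g x)"
        "(\<lambda>n. sqrt (real n) * (k (Q n) - k P\<^sub>0)) \<longlonglongrightarrow> (\<integral>x. k' x * (c * g x) \<partial>P\<^sub>0)"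
        using local[OF Q(1)] by blast
      have "(\<integral>x. k' x * (c * g x) \<partial>P\<^sub>0) = 0"
        using LIMSEQ_unique[OF cg(2) Q(2)] .
      with \<phi>_lim[OF cg(1)] have "test_power \<phi> Q \<longlonglongrightarrow> \<alpha>"
        using level by simp
      then have "(\<lambda>n. ereal (test_power \<phi> Q n)) \<longlonglongrightarrow> ereal \<alpha>" by simp
      from lim_imp_Limsup[OF trivial_limit_sequentially this] show ?thesis by simp
    qed
    moreover have "\<alpha> \<le> liminf (\<lambda>n. ereal (test_power \<phi> Q n))" if "Q \<in> ?\<K>" for Q
    proof -
      have Q: "Q \<in> local_sequences P\<^sub>0 \<P>"
        using that by (auto simp: implicit_alternatives_def)
      obtain c g where cg: "P0.local_tangent Q (\<lambda>x. c * g x)"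
        using local[OF Q] by blast
      have "(\<lambda>n. ereal (test_power \<phi> Q n)) \<longlonglongrightarrow> ereal (two_sided_power v (\<integral>x. k' x * (c * g x) \<partial>P\<^sub>0) \<sigma>)"
        using \<phi>_lim[OF cg] by simp
      from lim_imp_Liminf[OF trivial_limit_sequentially this] show ?thesis
        using two_sided_power_ge[OF \<sigma> v] by (simp add: level)
    qed
    ultimately show ?thesis
      by (simp add: asymptotically_unbiased_tests_def)
  qed
  have envelope: "limsup (\<lambda>n. ereal (test_power \<psi> Q n)) \<le> two_sided_power v (\<integral>x. k' x * w x \<partial>P\<^sub>0) \<sigma>"
    if \<psi>: "\<psi> \<in> ?\<Psi>" and Q: "P0.local_tangent Q w" and w: "w \<in> tangent_space P\<^sub>0 \<P>"
      and ne: "(\<integral>x. k' x * w x \<partial>P\<^sub>0) \<noteq> 0" for \<psi> Q w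
  proof -
    define m where "m = (\<integral>x. k' x * w x \<partial>P\<^sub>0)"
    \<comment> \<open>Splits \<open>w = h + s e\<close> with \<open>h\<close> orthogonal to the gradient; the sign \<open>r\<close> makes \<open>s\<close> positive.\<close>
    define r where "r = sgn m"
    define e where "e x = r * k' x" for x
    \<comment> \<open>The coefficient of the projection of \<open>w\<close> onto \<open>k'\<close>,
      made positive by moving its sign into \<open>e\<close>.\<close>
    define s where "s = \<bar>m\<bar> / \<sigma>\<^sup>2"
    define h where "h x = 1 * w x + (- (s * r)) * k' x" for x
    have r: "r * r = 1" "r * \<bar>m\<bar> = m" "\<bar>r\<bar> = 1"
      using ne by (auto simp: r_def m_def sgn_if)
    have s: "0 < s" using ne \<sigma> by (simp add: s_def m_def)
    have h_T: "h \<in> tangent_space P\<^sub>0 \<P>"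
      unfolding h_def by (rule T_lincomb[OF w k'_T])
    have wL2: "w \<in> L2 P\<^sub>0" and w_c: "w \<in> L2_centered P\<^sub>0"
      using P0.local_tangent_centered[OF Q] by (auto simp: L2_centered_def)
    have inner_lin: "(\<integral>x. k' x * (a * w x + b * k' x) \<partial>P\<^sub>0) = a * m + b * \<sigma>\<^sup>2" for a b
    proof -
      have "(\<integral>x. k' x * (a * w x + b * k' x) \<partial>P\<^sub>0) = (\<integral>x. a * (k' x * w x) + b * (k' x)\<^sup>2 \<partial>P\<^sub>0)"
        by (simp add: algebra_simps power2_eq_square)
      also have "\<dots> = a * m + b * \<sigma>\<^sup>2"
        using L2_integrable_mult[OF k'L2 wL2] L2_integrable_square[OF k'L2]
        by (simp add: m_def \<sigma>2)
      finally show ?thesis .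
    qed
    have k'h: "(\<integral>x. k' x * h x \<partial>P\<^sub>0) = 0"
      unfolding h_def inner_lin using \<sigma> r by (simp add: s_def field_simps)
    have h_c: "h \<in> L2_centered P\<^sub>0"
    proof -
      have "h \<in> L2 P\<^sub>0"
        unfolding h_def[abs_def] by (intro L2_add L2_cmult wL2 k'L2)
      moreover have "(\<integral>x. h x \<partial>P\<^sub>0) = 0"
        using w_c k'_centered P0.L2_integrable[OF wL2] P0.L2_integrable[OF k'L2]
        by (simp add: L2_centered_def h_def)
      ultimately show ?thesis by (simp add: L2_centered_def)
    qed
    have e_c: "e \<in> L2_centered P\<^sub>0"
      using k'_centered by (simp add: L2_centered_def e_def[abs_def] L2_cmult)
    have e_norm: "L2_norm P\<^sub>0 e = \<sigma>"
      unfolding e_def[abs_def] L2_norm_cmult using r by (simp add: \<sigma>_def)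
    have he: "(\<integral>x. h x * e x \<partial>P\<^sub>0) = 0"
    proof -
      have "(\<integral>x. h x * e x \<partial>P\<^sub>0) = (\<integral>x. r * (k' x * h x) \<partial>P\<^sub>0)"
        by (simp add: e_def ac_simps)
      then show ?thesis using k'h by simp
    qed
    have w_eq: "w = (\<lambda>x. h x + s * e x)"
      by (rule ext) (simp add: h_def e_def)
    have "h \<in> gradient_complement k' P\<^sub>0 \<P>"
      using h_T k'h by (simp add: gradient_complement_def)
    then have "h \<in> L2_closure P\<^sub>0 (tangent_cone P\<^sub>0 \<P> \<inter> gradient_complement k' P\<^sub>0 \<P>)"
      using assms(8) by (auto simp: L2_dense_def)
    then obtain w0 where w0: "\<And>j. w0 j \<in> tangent_cone P\<^sub>0 \<P> \<inter> gradient_complement k' P\<^sub>0 \<P>"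
      "L2_lim P\<^sub>0 w0 h"
      using L2_closure_lim[of h P\<^sub>0 "tangent_cone P\<^sub>0 \<P> \<inter> gradient_complement k' P\<^sub>0 \<P>"] cone_L2 by blast
    have "\<exists>Q. Q \<in> ?\<H> \<and> P0.local_tangent Q (w0 j)" for j
    proof -
      obtain R where "R \<in> local_sequences P\<^sub>0 \<P>" "P0.local_tangent R (w0 j)"
        "(\<lambda>n. sqrt (real n) * (k (R n) - k P\<^sub>0)) \<longlonglongrightarrow> (\<integral>x. k' x * w0 j x \<partial>P\<^sub>0)"
        using P0.tangent_cone_local_sequence[OF _ k \<P>, of "w0 j"] w0(1)[of j] by blast
      then show ?thesis
        using w0(1)[of j] by (auto simp: implicit_hypotheses_def gradient_complement_def)
    qed
    then obtain Q0 where Q0: "\<And>j. Q0 j \<in> ?\<H>" "\<And>j. P0.local_tangent (Q0 j) (w0 j)"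
      by metis
    have "\<exists>W R. L2_lim P\<^sub>0 W (\<lambda>x. h x + (- \<delta>) * e x) \<and> (\<forall>j. P0.local_tangent (R j) (W j) \<and> R j \<in> ?\<K>)"
      if \<delta>: "0 < \<delta>" for \<delta>
    proof -
      have "(\<lambda>x. 1 * h x + (- \<delta> * r) * k' x) \<in> tangent_space P\<^sub>0 \<P>"
        by (rule T_lincomb[OF h_T k'_T])
      also have "(\<lambda>x. 1 * h x + (- \<delta> * r) * k' x) = (\<lambda>x. h x + (- \<delta>) * e x)"
        by (simp add: e_def mult.assoc)
      finally have "(\<lambda>x. h x + (- \<delta>) * e x) \<in> L2_closure P\<^sub>0 (tangent_cone P\<^sub>0 \<P>)"
        using assms(7) by (auto simp: L2_dense_def)
      then obtain W where W: "\<And>j. W j \<in> tangent_cone P\<^sub>0 \<P>" "L2_lim P\<^sub>0 W (\<lambda>x. h x + (- \<delta>) * e x)"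
        using L2_closure_lim[OF _ cone_L2] by blast
      have "(\<lambda>j. \<integral>x. k' x * W j x \<partial>P\<^sub>0) \<longlonglongrightarrow> (\<integral>x. k' x * (h x + (- \<delta>) * e x) \<partial>P\<^sub>0)"
        by (intro L2_lim_inner L2_lim_const k'L2 W(2))
      moreover have "(\<integral>x. k' x * (h x + (- \<delta>) * e x) \<partial>P\<^sub>0) \<noteq> 0"
      proof -
        have "(\<lambda>x. k' x * (h x + (- \<delta>) * e x)) = (\<lambda>x. k' x * (1 * w x + (- (s * r) - \<delta> * r) * k' x))"
          by (rule ext) (simp add: h_def e_def algebra_simps)
        then have "(\<integral>x. k' x * (h x + (- \<delta>) * e x) \<partial>P\<^sub>0) = 1 * m + (- (s * r) - \<delta> * r) * \<sigma>\<^sup>2"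
          by (simp only: inner_lin)
        also have "\<dots> = - \<delta> * r * \<sigma>\<^sup>2"
          using \<sigma> r by (simp add: s_def field_simps)
        finally show ?thesis
          using \<delta> \<sigma> r by auto
      qed
      \<comment> \<open>Being nonzero is an open condition, so all late approximants belong to
        alternatives; the finitely many others are dropped by the shift by \<open>J\<close>.\<close>
      ultimately have "\<forall>\<^sub>F j in sequentially. (\<integral>x. k' x * W j x \<partial>P\<^sub>0) \<noteq> 0"
        by (rule tendsto_imp_eventually_ne)
      then obtain J where J: "\<And>j. J \<le> j \<Longrightarrow> (\<integral>x. k' x * W j x \<partial>P\<^sub>0) \<noteq> 0"
        by (auto simp: eventually_sequentially)
      have "\<exists>R. R \<in> ?\<K> \<and> P0.local_tangent R (W (j + J))" for j
      proof -
        obtain R where R: "R \<in> local_sequences P\<^sub>0 \<P>" "P0.local_tangent R (W (j + J))"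
          "(\<lambda>n. sqrt (real n) * (k (R n) - k P\<^sub>0)) \<longlonglongrightarrow> (\<integral>x. k' x * W (j + J) x \<partial>P\<^sub>0)"
          using P0.tangent_cone_local_sequence[OF W(1) k \<P>] by blast
        then have "R \<in> ?\<K>"
          using J[of "j + J"] by (auto simp: implicit_alternatives_def)
        with R show ?thesis by blast
      qed
      then obtain R where R: "\<And>j. R j \<in> ?\<K>" "\<And>j. P0.local_tangent (R j) (W (j + J))"
        by metis
      have "L2_lim P\<^sub>0 (\<lambda>j. W (j + J)) (\<lambda>x. h x + (- \<delta>) * e x)"
        using W(2) unfolding L2_lim_def by (auto intro: LIMSEQ_ignore_initial_segment)
      with R show ?thesis
        by (intro exI[of _ "\<lambda>j. W (j + J)"] exI[of _ R]) simp
    qed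
    then obtain W R where WR: "\<And>\<delta>. 0 < \<delta> \<Longrightarrow> L2_lim P\<^sub>0 (W \<delta>) (\<lambda>x. h x + (- \<delta>) * e x)"
      "\<And>\<delta> j. 0 < \<delta> \<Longrightarrow> P0.local_tangent (R \<delta> j) (W \<delta> j)" "\<And>\<delta> j. 0 < \<delta> \<Longrightarrow> R \<delta> j \<in> ?\<K>"
      by metis
    have "limsup (\<lambda>n. ereal (test_power \<psi> Q n))
        \<le> two_sided_power v (s * (\<integral>x. (e x)\<^sup>2 \<partial>P\<^sub>0)) (L2_norm P\<^sub>0 e)"
    proof (rule P0.two_sided_power_envelope)
      show "\<psi> \<in> test_sequences P\<^sub>0"
        using \<psi> by (simp add: asymptotically_unbiased_tests_def tests)
      show "P0.local_tangent Q (\<lambda>x. h x + s * e x)"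
        using Q by (simp flip: w_eq)
      show "limsup (\<lambda>n. ereal (test_power \<psi> (Q0 j) n)) \<le> two_sided_power v 0 (L2_norm P\<^sub>0 e)" for j
        using null_level[OF \<psi> Q0(1)] by (simp add: e_norm level)
      show "two_sided_power v 0 (L2_norm P\<^sub>0 e) \<le> liminf (\<lambda>n. ereal (test_power \<psi> (R \<delta> j) n))"
        if "0 < \<delta>" for \<delta> j
        using alt_level[OF \<psi> WR(3)[OF that]] by (simp add: e_norm level)
    qed (fact h_c e_c he s v w0(2) Q0(2) WR(1) WR(2) | simp add: e_norm \<sigma>)+
    also have "s * (\<integral>x. (e x)\<^sup>2 \<partial>P\<^sub>0) = r * m"
    proof -
      have "(\<integral>x. (e x)\<^sup>2 \<partial>P\<^sub>0) = \<sigma>\<^sup>2"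
        using e_norm L2_norm_power2[of P\<^sub>0 e] by simp
      then show ?thesis
        using \<sigma> by (simp add: s_def r_def abs_sgn mult.commute)
    qed
    \<comment> \<open>The limiting power is even in the mean, so the sign \<open>r\<close> has no
      effect.\<close>
    also have "two_sided_power v (r * m) (L2_norm P\<^sub>0 e) = two_sided_power v m \<sigma>"
      using r(3) by (auto simp: e_norm two_sided_power_minus abs_if split: if_splits)
    finally show ?thesis
      by (simp add: m_def)
  qed
  have "convergent (test_power \<phi> Q) \<and>
      (\<forall>\<psi>\<in>?\<Psi>. limsup (\<lambda>n. ereal (test_power \<psi> Q n)) \<le> ereal (lim (test_power \<phi> Q)))"
    if Q: "Q \<in> local_sequences P\<^sub>0 \<P>" for Q
  proof -
    obtain c g where g: "g \<in> tangent_cone P\<^sub>0 \<P>" and tangent: "P0.local_tangent Q (\<lambda>x. c * g x)"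
      and k_lim: "(\<lambda>n. sqrt (real n) * (k (Q n) - k P\<^sub>0)) \<longlonglongrightarrow> (\<integral>x. k' x * (c * g x) \<partial>P\<^sub>0)"
      using local[OF Q] by blast
    have "limsup (\<lambda>n. ereal (test_power \<psi> Q n)) \<le> two_sided_power v (\<integral>x. k' x * (c * g x) \<partial>P\<^sub>0) \<sigma>"
      if \<psi>: "\<psi> \<in> ?\<Psi>" for \<psi>
    \<comment> \<open>With zero inner product \<open>Q\<close> is itself an implicit hypothesis, and
      the level condition already gives the limiting power \<alpha>; only a nonzero inner product
      calls for the envelope.\<close>
    proof (cases "(\<integral>x. k' x * (c * g x) \<partial>P\<^sub>0) = 0")
      case True
      then have "Q \<in> ?\<H>"
        using Q k_lim by (simp add: implicit_hypotheses_def)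
      then show ?thesis
        using null_level[OF \<psi>] True level by simp
    next
      case False
      have "(\<lambda>x. c * g x + 0 * g x) \<in> tangent_space P\<^sub>0 \<P>"
        using g cone_T by (intro T_lincomb) auto
      then show ?thesis
        using False by (intro envelope \<psi> tangent) simp_all
    qed
    then show ?thesis
      using \<phi>_lim[OF tangent] by (auto simp: convergent_def limI)
  qed
  with \<phi>_in show ?thesis
    unfolding asymptotically_optimal_def \<phi>_def by blast
qed

end
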